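(* For any $r\in\mathbb Z_{\ge0}$, in the ring of symmetric functions $\Lambda_{q,t}$ we have $$e_1(X)\star e_r(X)=(1-q^{-1})\,[r+1]_t\,e_{r+1}(X)+q^{-1}e_1(X)e_r(X),$$ where $\star$ is the quantum multiplication and $e_r(X)$ is the $r$-th elementary symmetric function.
   Context: $[n]_t=\frac{1-t^n}{1-t}$. Let $q,t$ be indeterminates and $\mathbb Q_{q,t}=\mathbb Q(q,t)$. For $m\ge1$ put $\mathbb Q_{q,t}[X]_{(m)}=\mathbb Q_{q,t}[X_1,\dots,X_m]\subset\mathbb Q_{q,t}[X^{\pm1}]_{(m)}=\mathbb Q_{q,t}[X_1^{\pm1},\dots,X_m^{\pm1}]$, with the convention $X_{i+km}=q^{-k}X_i$ for $1\le i\le m$, $k\in\mathbb Z$ (so $X_0=qX_m$, $X_{m+1}=q^{-1}X_1$). Affine Hecke algebra: $\mathscr H_m$ is the $\mathbb Q_{q,t}$-algebra generated by $T_i$ ($i\in\mathbb Z/m\mathbb Z$) and $\Pi^{\pm1}$ with relations $(T_i-t)(T_i+1)=0$; $T_iT_{i+1}T_i=T_{i+1}T_iT_{i+1}$ if $m>2$; $T_iT_j=T_jT_i$ if $j\ne i\pm1$; $\Pi T_i=T_{i+1}\Pi$. (For $m=1$ no $T_i$ are present.) It acts (action denoted $\bullet$) on $\mathbb Q_{q,t}[X^{\pm1}]_{(m)}$ by $$T_i\bullet F=t\,s_i(F)+(t-1)\frac{F-s_i(F)}{1-X_iX_{i+1}^{-1}},\qquad \Pi\bullet F=X_1F(X_2,\dots,X_m,X_{m+1}),$$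 where for $1\le i\le m-1$ $s_i$ swaps $X_i$ and $X_{i+1}$, and $s_0(F)=X_1X_0^{-1}F(X_0,X_2,\dots,X_{m-1},X_{m+1})$. For $1\le i\le m$, $Y_i:=t^{m-i}T_{i-1}\cdots T_1\,\Pi\,T_{m-1}^{-1}\cdots T_i^{-1}\in\mathscr H_m$; these commute and generate a Laurent polynomial subalgebra with polynomial part $\mathbb Q_{q,t}[Y]_{(m)}$. The map $\mathsf q_{(m)}:\mathbb Q_{q,t}[Y]_{(m)}\to\mathbb Q_{q,t}[X]_{(m)}$, $F(Y)\mapsto F(Y)\bullet1$, is a linear isomorphism, and one sets $F\star G=\mathsf q_{(m)}(\mathsf q_{(m)}^{-1}(F)\cdot\mathsf q_{(m)}^{-1}(G))$. This product preserves symmetric polynomials and is compatible with the truncation maps $\pi_{m,m'}$ (setting $X_{m'+1}=\dots=X_m=0$), hence defines a product $\star$ (the quantum multiplication) on $\Lambda_{q,t}=\bigoplus_{d\ge0}\varprojlim_m(\mathbb Q_{q,t}[X]_{(m)})_d^{\mathfrak S_m}$ ($d$ = degree). *)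

theory Defs
  imports
    "HOL-Library.Poly_Mapping"
    "HOL-Computational_Algebra.Polynomial"
    "HOL-Computational_Algebra.Fraction_Field"
    "HOL-Combinatorics.Permutations"
    "HOL-Algebra.QuotRing"
    "HOL-Algebra.Generated_Rings"
begin

abbreviation keys :: "('a \<Rightarrow>\<^sub>0 'b::zero) \<Rightarrow> 'a set" where
  "keys \<equiv> Poly_Mapping.keys"

abbreviation lookup :: "('a \<Rightarrow>\<^sub>0 'b::zero) \<Rightarrow> 'a \<Rightarrow> 'b" where
  "lookup \<equiv> Poly_Mapping.lookup"

text \<open>The field of fractions of the polynomial ring in \<open>t\<close> over the polynomial ring in \<open>q\<close>.\<close>

type_synonym qt = "rat poly poly fract"

definition qq :: qt where "qq = Fract [:[:0, 1:]:] 1"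

definition tt :: qt where "tt = Fract [:0, 1:] 1"

definition tint :: "nat \<Rightarrow> qt" (\<open>[_]\<^sub>t\<close>) where
  "[n]\<^sub>t = (1 - tt ^ n) / (1 - tt)"

text \<open>
  Laurent polynomials in the variables \<open>X\<^sub>1, X\<^sub>2, \<dots>\<close>: an exponent vector is a finitely supported
  map from variable indices to integers.  The rings in the variables \<open>X\<^sub>1, \<dots>, X\<^sub>m\<close> are the
  subsets below, so that the inclusions between them are literal.
\<close>

type_synonym lpoly = "(nat \<Rightarrow>\<^sub>0 int) \<Rightarrow>\<^sub>0 qt"

definition lconst :: "qt \<Rightarrow> lpoly" where
  "lconst c = Poly_Mapping.single 0 c"

definition X :: "nat \<Rightarrow> lpoly" where
  "X i = Poly_Mapping.single (Poly_Mapping.single i 1) 1"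

definition laurent_polys :: "nat \<Rightarrow> lpoly set" where
  "laurent_polys m = {F. \<forall>\<alpha>\<in>keys F. keys \<alpha> \<subseteq> {1..m}}"

definition nonneg_exps :: "lpoly \<Rightarrow> bool" where
  "nonneg_exps F \<longleftrightarrow> (\<forall>\<alpha>\<in>keys F. \<forall>i. 0 \<le> lookup \<alpha> i)"

definition polys :: "nat \<Rightarrow> lpoly set" where
  "polys m = {F \<in> laurent_polys m. nonneg_exps F}"

text \<open>
  \<open>Xpow m j n\<close> is \<open>X\<^sub>j\<close> to the power \<open>n\<close> for arbitrary integers \<open>j\<close> and \<open>n\<close>, according to the convention
  \<open>X\<^bsub>i+km\<^esub> = q\<^sup>-\<^sup>k X\<^sub>i\<close> for \<open>i\<close> in \<open>{1..m}\<close>: there \<open>k = (j - 1) div m\<close>.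
\<close>

definition Xpow :: "nat \<Rightarrow> int \<Rightarrow> int \<Rightarrow> lpoly" where
  "Xpow m j n =
     Poly_Mapping.single (Poly_Mapping.single (nat ((j - 1) mod int m + 1)) n)
       (qq powi (- ((j - 1) div int m) * n))"

text \<open>\<open>lsubst m \<phi> F\<close> is \<open>F(X\<^bsub>\<phi>(1)\<^esub>, \<dots>, X\<^bsub>\<phi>(m)\<^esub>)\<close>.\<close>

definition lsubst :: "nat \<Rightarrow> (nat \<Rightarrow> int) \<Rightarrow> lpoly \<Rightarrow> lpoly" where
  "lsubst m \<phi> F =
     (\<Sum>\<alpha>\<in>keys F. lconst (lookup F \<alpha>) * (\<Prod>i\<in>{1..m}. Xpow m (\<phi> i) (lookup \<alpha> i)))"

text \<open>Exact division; the ring of Laurent polynomials is an integral domain.\<close>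

definition ldiv :: "lpoly \<Rightarrow> lpoly \<Rightarrow> lpoly" where
  "ldiv F G = (THE H. H * G = F)"

datatype hgen = GT nat | GPi | GPiInv

text \<open>
  The free monoid on the generators, written additively, so that finitely supported maps from
  words to the coefficient field form the free associative algebra.
\<close>

datatype hword = HWord (letters: "hgen list")

instantiation hword :: monoid_add
begin

definition zero_hword :: hword where "0 = HWord []"

definition plus_hword :: "hword \<Rightarrow> hword \<Rightarrow> hword" where
  "v + w = HWord (letters v @ letters w)"

instance
  by standard (simp_all add: zero_hword_def plus_hword_def)

end

type_synonym hfree = "hword \<Rightarrow>\<^sub>0 qt"

definition fconst :: "qt \<Rightarrow> hfree" where
  "fconst c = Poly_Mapping.single 0 c"

definition fgen :: "hgen \<Rightarrow> hfree" where
  "fgen g = Poly_Mapping.single (HWord [g]) 1"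

text \<open>The index set \<open>\<int>/m\<int>\<close> of the \<open>T\<^sub>i\<close>, by representatives; no \<open>T\<^sub>i\<close> are present for \<open>m = 1\<close>.\<close>

definition hidx :: "nat \<Rightarrow> nat set" where
  "hidx m = (if m = 1 then {} else {0..<m})"

definition hgens :: "nat \<Rightarrow> hgen set" where
  "hgens m = GT ` hidx m \<union> {GPi, GPiInv}"

definition free_alg :: "nat \<Rightarrow> hfree ring" where
  "free_alg m =
     \<lparr>carrier = {h. \<forall>w\<in>keys h. set (letters w) \<subseteq> hgens m},
      mult = (*), one = 1, zero = 0, add = (+)\<rparr>"

definition hecke_rels :: "nat \<Rightarrow> hfree set" where
  "hecke_rels m =
     (let T = (\<lambda>i. fgen (GT (i mod m))); P = fgen GPi; P' = fgen GPiInv in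
       {P * P' - 1, P' * P - 1} \<union>
       {(T i - fconst tt) * (T i + 1) | i. i \<in> hidx m} \<union>
       {T i * T (i + 1) * T i - T (i + 1) * T i * T (i + 1) | i. i \<in> hidx m \<and> m > 2} \<union>
       {T i * T j - T j * T i | i j. i \<in> hidx m \<and> j \<in> hidx m \<and>
          j \<noteq> (i + 1) mod m \<and> i \<noteq> (j + 1) mod m} \<union>
       {P * T i - T (i + 1) * P | i. i \<in> hidx m})"

definition hecke_ideal :: "nat \<Rightarrow> hfree set" where
  "hecke_ideal m = genideal (free_alg m) (hecke_rels m)"

definition hecke :: "nat \<Rightarrow> hfree set ring" where
  "hecke m = free_alg m Quot hecke_ideal m"

definition hclass :: "nat \<Rightarrow> hfree \<Rightarrow> hfree set" where
  "hclass m h = hecke_ideal m +>\<^bsub>free_alg m\<^esub> h"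

lemma keys_fgen [simp]: "keys (fgen g) = {HWord [g]}"
  by (simp add: fgen_def)

lemma ring_free_alg: "ring (free_alg m)"
proof (rule ringI)
  show "abelian_group (free_alg m)"
  proof (rule abelian_groupI)
    fix x y assume "x \<in> carrier (free_alg m)" "y \<in> carrier (free_alg m)"
    then show "x \<oplus>\<^bsub>free_alg m\<^esub> y \<in> carrier (free_alg m)"
      using keys_add[of x y] by (auto simp: free_alg_def)
  next
    fix x assume "x \<in> carrier (free_alg m)"
    then show "\<exists>y\<in>carrier (free_alg m). y \<oplus>\<^bsub>free_alg m\<^esub> x = \<zero>\<^bsub>free_alg m\<^esub>"
      by (intro bexI[of _ "- x"]) (auto simp: free_alg_def)
  qed (auto simp: free_alg_def ac_simps)
  show "Group.monoid (free_alg m)"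
  proof (rule Group.monoidI)
    fix x y assume xy: "x \<in> carrier (free_alg m)" "y \<in> carrier (free_alg m)"
    have "set (letters w) \<subseteq> hgens m" if "w \<in> keys (x * y)" for w
    proof -
      obtain u v where "w = u + v" "u \<in> keys x" "v \<in> keys y"
        using \<open>w \<in> keys (x * y)\<close> keys_mult[of x y] by blast
      then show ?thesis using xy by (fastforce simp: free_alg_def plus_hword_def)
    qed
    then show "x \<otimes>\<^bsub>free_alg m\<^esub> y \<in> carrier (free_alg m)" by (simp add: free_alg_def)
  qed (auto simp: free_alg_def zero_hword_def mult.assoc)
qed (auto simp: free_alg_def algebra_simps)

lemma hecke_rels_carrier: "hecke_rels m \<subseteq> carrier (free_alg m)"
proof -
  interpret F: ring "free_alg m" by (rule ring_free_alg)
  have minus: "x - y \<in> carrier (free_alg m)"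
    if "x \<in> carrier (free_alg m)" "y \<in> carrier (free_alg m)" for x y
    using that keys_diff[of x y] by (auto simp: free_alg_def)
  have plus: "x + y \<in> carrier (free_alg m)"
    if "x \<in> carrier (free_alg m)" "y \<in> carrier (free_alg m)" for x y
    using F.add.m_closed[OF that] by (simp add: free_alg_def)
  have times: "x * y \<in> carrier (free_alg m)"
    if "x \<in> carrier (free_alg m)" "y \<in> carrier (free_alg m)" for x y
    using F.m_closed[OF that] by (simp add: free_alg_def)
  have one: "1 \<in> carrier (free_alg m)" "fconst c \<in> carrier (free_alg m)" for c
    by (auto simp: free_alg_def zero_hword_def fconst_def)
  have P: "fgen GPi \<in> carrier (free_alg m)" "fgen GPiInv \<in> carrier (free_alg m)"
    by (auto simp: free_alg_def hgens_def)
  have T: "fgen (GT (i mod m)) \<in> carrier (free_alg m)" if "hidx m \<noteq> {}" for i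
    using that by (auto simp: free_alg_def hgens_def hidx_def split: if_splits)
  show ?thesis
    unfolding hecke_rels_def Let_def
    by (auto intro!: minus plus times one P T)
qed

lemma ideal_hecke_ideal: "ideal (hecke_ideal m) (free_alg m)"
  unfolding hecke_ideal_def
  by (rule ring.genideal_ideal[OF ring_free_alg hecke_rels_carrier])

lemma ring_hecke: "ring (hecke m)"
  unfolding hecke_def by (rule ideal.quotient_is_ring[OF ideal_hecke_ideal])

definition hs :: "nat \<Rightarrow> nat \<Rightarrow> lpoly \<Rightarrow> lpoly" where
  "hs m i F =
     (if i = 0
      then Xpow m 1 1 * Xpow m 0 (-1) *
             lsubst m (\<lambda>j. if j = 1 then 0 else if j = m then int m + 1 else int j) F
      else lsubst m (\<lambda>j. int (transpose i (i + 1) j)) F)"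

definition act_T :: "nat \<Rightarrow> nat \<Rightarrow> lpoly \<Rightarrow> lpoly" where
  "act_T m i F =
     lconst tt * hs m i F +
     lconst (tt - 1) * ldiv (F - hs m i F) (1 - Xpow m (int i) 1 * Xpow m (int i + 1) (-1))"

definition act_Pi :: "nat \<Rightarrow> lpoly \<Rightarrow> lpoly" where
  "act_Pi m F = X 1 * lsubst m (\<lambda>j. int j + 1) F"

primrec act_gen :: "nat \<Rightarrow> hgen \<Rightarrow> lpoly \<Rightarrow> lpoly" where
  "act_gen m (GT i) = act_T m i"
| "act_gen m GPi = act_Pi m"
| "act_gen m GPiInv = inv_into (laurent_polys m) (act_Pi m)"

definition act_word :: "nat \<Rightarrow> hword \<Rightarrow> lpoly \<Rightarrow> lpoly" where
  "act_word m w F = foldr (act_gen m) (letters w) F"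

definition act_free :: "nat \<Rightarrow> hfree \<Rightarrow> lpoly \<Rightarrow> lpoly" where
  "act_free m h F = (\<Sum>w\<in>keys h. lconst (lookup h w) * act_word m w F)"

text \<open>
  The action of an element of the Hecke algebra, i.e. of a coset \<open>H\<close>: all representatives
  act on a Laurent polynomial in \<open>X\<^sub>1, \<dots>, X\<^sub>m\<close> in the same way.
\<close>

definition act :: "nat \<Rightarrow> hfree set \<Rightarrow> lpoly \<Rightarrow> lpoly" where
  "act m H F = the_elem ((\<lambda>h. act_free m h F) ` H)"

definition hT :: "nat \<Rightarrow> nat \<Rightarrow> hfree set" where
  "hT m i = hclass m (fgen (GT i))"

definition hPi :: "nat \<Rightarrow> hfree set" where
  "hPi m = hclass m (fgen GPi)"

definition hscal :: "nat \<Rightarrow> qt \<Rightarrow> hfree set" where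
  "hscal m c = hclass m (fconst c)"

definition hprod :: "nat \<Rightarrow> hfree set list \<Rightarrow> hfree set" where
  "hprod m us = foldr (mult (hecke m)) us \<one>\<^bsub>hecke m\<^esub>"

definition hY :: "nat \<Rightarrow> nat \<Rightarrow> hfree set" where
  "hY m i =
     hprod m
       (hscal m (tt ^ (m - i)) #
        map (hT m) (rev [1..<i]) @
        hPi m #
        map (\<lambda>j. inv\<^bsub>hecke m\<^esub> (hT m j)) (rev [i..<m]))"

definition Y_polys :: "nat \<Rightarrow> hfree set set" where
  "Y_polys m = generate_ring (hecke m) (range (hscal m) \<union> hY m ` {1..m})"

definition qmap :: "nat \<Rightarrow> hfree set \<Rightarrow> lpoly" where
  "qmap m H = act m H 1"

definition qstar :: "nat \<Rightarrow> lpoly \<Rightarrow> lpoly \<Rightarrow> lpoly" where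
  "qstar m F G =
     qmap m (inv_into (Y_polys m) (qmap m) F \<otimes>\<^bsub>hecke m\<^esub> inv_into (Y_polys m) (qmap m) G)"

text \<open>Evaluation of a polynomial (an element with nonnegative exponents) at \<open>X\<^sub>i := v i\<close>.\<close>

definition peval :: "(nat \<Rightarrow> lpoly) \<Rightarrow> lpoly \<Rightarrow> lpoly" where
  "peval v F = (\<Sum>\<alpha>\<in>keys F. lconst (lookup F \<alpha>) * (\<Prod>i\<in>keys \<alpha>. v i ^ nat (lookup \<alpha> i)))"

definition sym_polys :: "nat \<Rightarrow> lpoly set" where
  "sym_polys m = {F \<in> polys m. \<forall>\<sigma>. \<sigma> permutes {1..m} \<longrightarrow> peval (\<lambda>i. X (\<sigma> i)) F = F}"

definition homogeneous :: "nat \<Rightarrow> lpoly \<Rightarrow> bool" where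
  "homogeneous d F \<longleftrightarrow> (\<forall>\<alpha>\<in>keys F. (\<Sum>i\<in>keys \<alpha>. lookup \<alpha> i) = int d)"

text \<open>\<open>trunc m' F\<close> is obtained from \<open>F\<close> by setting \<open>X\<^sub>i = 0\<close> for all \<open>i > m'\<close>.\<close>

definition trunc :: "nat \<Rightarrow> lpoly \<Rightarrow> lpoly" where
  "trunc m' F = peval (\<lambda>i. if i \<le> m' then X i else 0) F"

text \<open>
  The inverse limit over \<open>m \<ge> 1\<close> of the symmetric polynomials in \<open>m\<close> variables that are
  homogeneous of degree \<open>d\<close>, as the set of compatible families.  The component at \<open>m = 0\<close>
  carries no information and is fixed to \<open>0\<close>.
\<close>

definition sf_deg :: "nat \<Rightarrow> (nat \<Rightarrow> lpoly) set" where
  "sf_deg d =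
     {f. f 0 = 0 \<and>
         (\<forall>m\<ge>1. f m \<in> sym_polys m \<and> homogeneous d (f m)) \<and>
         (\<forall>m m'. 1 \<le> m' \<and> m' \<le> m \<longrightarrow> trunc m' (f m) = f m')}"

text \<open>The direct sum over \<open>d\<close>, formed inside the families indexed by \<open>m\<close>.\<close>

definition sf_set :: "(nat \<Rightarrow> lpoly) set" where
  "sf_set = {f. \<exists>D g. finite D \<and> (\<forall>d\<in>D. g d \<in> sf_deg d) \<and> f = (\<lambda>m. \<Sum>d\<in>D. g d m)}"

lemma lookup_lconst_mult [simp]: "lookup (lconst c * F) \<alpha> = c * lookup F \<alpha>"
  unfolding lconst_def mult_map_scale_conv_mult[symmetric]
  by (simp add: Poly_Mapping.map.rep_eq when_def)

lemma lconst_0 [simp]: "lconst 0 = 0" and lconst_1 [simp]: "lconst 1 = 1"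
  by (simp_all add: lconst_def)

lemma lconst_add: "lconst (a + b) = lconst a + lconst b"
  by (simp add: lconst_def single_add)

lemma lconst_mult: "lconst (a * b) = lconst a * lconst b"
  by (simp add: lconst_def mult_single)

lemma peval_superset:
  assumes "finite A" "keys F \<subseteq> A"
  shows "peval v F = (\<Sum>\<alpha>\<in>A. lconst (lookup F \<alpha>) * (\<Prod>i\<in>keys \<alpha>. v i ^ nat (lookup \<alpha> i)))"
  unfolding peval_def using assms
  by (intro sum.mono_neutral_left) (auto simp: in_keys_iff)

lemma peval_add: "peval v (F + G) = peval v F + peval v G"
proof -
  let ?A = "keys F \<union> keys G"
  have "keys (F + G) \<subseteq> ?A" by (rule keys_add)
  then show ?thesis
    by (simp add: peval_superset[of ?A] lookup_add lconst_add sum.distrib distrib_right)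
qed

lemma peval_0 [simp]: "peval v 0 = 0"
  by (simp add: peval_def)

lemma peval_sum: "peval v (sum f A) = (\<Sum>a\<in>A. peval v (f a))"
  by (induction A rule: infinite_finite_induct) (simp_all add: peval_add)

lemma peval_single:
  "peval v (Poly_Mapping.single \<alpha> c) = lconst c * (\<Prod>i\<in>keys \<alpha>. v i ^ nat (lookup \<alpha> i))"
  by (cases "c = 0") (simp_all add: peval_def)

lemma peval_lconst [simp]: "peval v (lconst c) = lconst c"
  unfolding lconst_def[of c] by (simp add: peval_single) (simp add: lconst_def)

lemma peval_1 [simp]: "peval v 1 = 1"
  using peval_lconst[of v 1] by simp

lemma peval_X [simp]: "peval v (X i) = v i"
  by (simp add: X_def peval_single)

lemma lpoly_sum_single: "F = (\<Sum>\<alpha>\<in>keys F. Poly_Mapping.single \<alpha> (lookup F \<alpha>))"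
  by (rule poly_mapping_eqI) (auto simp: lookup_sum lookup_single when_def in_keys_iff)

lemma peval_mult:
  assumes "nonneg_exps F" "nonneg_exps G"
  shows "peval v (F * G) = peval v F * peval v G"
proof -
  have mono: "(\<Prod>i\<in>keys (\<alpha> + \<beta>). v i ^ nat (lookup (\<alpha> + \<beta>) i)) =
      (\<Prod>i\<in>keys \<alpha>. v i ^ nat (lookup \<alpha> i)) * (\<Prod>i\<in>keys \<beta>. v i ^ nat (lookup \<beta> i))"
    if "\<alpha> \<in> keys F" "\<beta> \<in> keys G" for \<alpha> \<beta>
  proof -
    let ?A = "keys \<alpha> \<union> keys \<beta>"
    have *: "(\<Prod>i\<in>keys \<gamma>. v i ^ nat (lookup \<gamma> i)) = (\<Prod>i\<in>?A. v i ^ nat (lookup \<gamma> i))"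
      if "keys \<gamma> \<subseteq> ?A" for \<gamma> :: "nat \<Rightarrow>\<^sub>0 int"
      using that by (intro prod.mono_neutral_left) (auto simp: in_keys_iff)
    have nn: "0 \<le> lookup \<alpha> i" "0 \<le> lookup \<beta> i" for i
      using assms that by (auto simp: nonneg_exps_def)
    show ?thesis
      unfolding *[OF keys_add] *[OF Un_upper1] *[OF Un_upper2]
      by (simp add: prod.distrib lookup_add nat_add_distrib nn power_add)
  qed
  have "peval v (F * G) = peval v ((\<Sum>\<alpha>\<in>keys F. Poly_Mapping.single \<alpha> (lookup F \<alpha>)) *
      (\<Sum>\<beta>\<in>keys G. Poly_Mapping.single \<beta> (lookup G \<beta>)))"
    by (simp flip: lpoly_sum_single)
  also have "\<dots> = (\<Sum>\<alpha>\<in>keys F. \<Sum>\<beta>\<in>keys G.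
      (lconst (lookup F \<alpha>) * (\<Prod>i\<in>keys \<alpha>. v i ^ nat (lookup \<alpha> i))) *
      (lconst (lookup G \<beta>) * (\<Prod>i\<in>keys \<beta>. v i ^ nat (lookup \<beta> i))))"
    by (simp add: sum_product mult_single peval_sum peval_single mono lconst_mult mult_ac)
  also have "\<dots> = peval v F * peval v G"
    by (simp add: sum_product peval_def)
  finally show ?thesis .
qed

lemma nonneg_exps_mult: "nonneg_exps F \<Longrightarrow> nonneg_exps G \<Longrightarrow> nonneg_exps (F * G)"
  using keys_mult[of F G] by (fastforce simp: nonneg_exps_def lookup_add)

lemma polys_add: "F \<in> polys m \<Longrightarrow> G \<in> polys m \<Longrightarrow> F + G \<in> polys m"
  using keys_add[of F G] by (fastforce simp: polys_def laurent_polys_def nonneg_exps_def)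

lemma polys_mult: "F \<in> polys m \<Longrightarrow> G \<in> polys m \<Longrightarrow> F * G \<in> polys m"
proof -
  assume FG: "F \<in> polys m" "G \<in> polys m"
  have "keys \<gamma> \<subseteq> {1..m}" if "\<gamma> \<in> keys (F * G)" for \<gamma>
  proof -
    obtain \<alpha> \<beta> where "\<gamma> = \<alpha> + \<beta>" "\<alpha> \<in> keys F" "\<beta> \<in> keys G"
      using \<open>\<gamma> \<in> keys (F * G)\<close> keys_mult[of F G] by blast
    then show ?thesis
      using FG keys_add[of \<alpha> \<beta>] by (fastforce simp: polys_def laurent_polys_def)
  qed
  then show ?thesis
    using FG nonneg_exps_mult[of F G] by (auto simp: polys_def laurent_polys_def)
qed

lemma polys_lconst: "lconst c \<in> polys m"
  by (auto simp: polys_def laurent_polys_def nonneg_exps_def lconst_def)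

lemma polys_X: "i \<in> {1..m} \<Longrightarrow> X i \<in> polys m"
  by (auto simp: polys_def laurent_polys_def nonneg_exps_def X_def lookup_single when_def)

lemma sym_polys_mult: "F \<in> sym_polys m \<Longrightarrow> G \<in> sym_polys m \<Longrightarrow> F * G \<in> sym_polys m"
  by (auto simp: sym_polys_def polys_mult peval_mult) (auto simp: polys_def peval_mult)

lemma sym_polys_add: "F \<in> sym_polys m \<Longrightarrow> G \<in> sym_polys m \<Longrightarrow> F + G \<in> sym_polys m"
  by (auto simp: sym_polys_def polys_add peval_add)

lemma sym_polys_lconst: "lconst c \<in> sym_polys m"
  by (simp add: sym_polys_def polys_lconst)

lemma homogeneous_add: "homogeneous d F \<Longrightarrow> homogeneous d G \<Longrightarrow> homogeneous d (F + G)"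
  using keys_add[of F G] by (auto simp: homogeneous_def)

lemma homogeneous_mult:
  assumes "homogeneous d F" "homogeneous e G"
  shows "homogeneous (d + e) (F * G)"
  unfolding homogeneous_def
proof
  fix \<gamma> assume "\<gamma> \<in> keys (F * G)"
  then obtain \<alpha> \<beta> where \<gamma>: "\<gamma> = \<alpha> + \<beta>" and \<alpha>: "\<alpha> \<in> keys F" and \<beta>: "\<beta> \<in> keys G"
    using keys_mult[of F G] by blast
  let ?A = "keys \<alpha> \<union> keys \<beta>"
  have *: "(\<Sum>i\<in>keys \<delta>. lookup \<delta> i) = (\<Sum>i\<in>?A. lookup \<delta> i)" if "keys \<delta> \<subseteq> ?A"
    for \<delta> :: "nat \<Rightarrow>\<^sub>0 int"
    using that by (intro sum.mono_neutral_left) (auto simp: in_keys_iff)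
  have "(\<Sum>i\<in>keys \<gamma>. lookup \<gamma> i) = (\<Sum>i\<in>keys \<alpha>. lookup \<alpha> i) + (\<Sum>i\<in>keys \<beta>. lookup \<beta> i)"
    unfolding \<gamma> *[OF keys_add] *[OF Un_upper1] *[OF Un_upper2]
    by (simp add: lookup_add sum.distrib)
  then show "(\<Sum>i\<in>keys \<gamma>. lookup \<gamma> i) = int (d + e)"
    using assms \<alpha> \<beta> by (simp add: homogeneous_def)
qed

lemma homogeneous_lconst: "homogeneous 0 (lconst c)"
  by (auto simp: homogeneous_def lconst_def)

lemma homogeneous_X: "homogeneous 1 (X i)"
  by (auto simp: homogeneous_def X_def)

lemma nonneg_exps_sym: "F \<in> sym_polys m \<Longrightarrow> nonneg_exps F"
  by (auto simp: sym_polys_def polys_def)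

lemma sf_degI:
  assumes "f 0 = 0"
    and "\<And>m. m \<ge> 1 \<Longrightarrow> f m \<in> sym_polys m"
    and "\<And>m. m \<ge> 1 \<Longrightarrow> homogeneous d (f m)"
    and "\<And>m m'. 1 \<le> m' \<Longrightarrow> m' \<le> m \<Longrightarrow> trunc m' (f m) = f m'"
  shows "f \<in> sf_deg d"
  using assms unfolding sf_deg_def by blast

lemma sf_degD:
  assumes "f \<in> sf_deg d"
  shows "f 0 = 0"
    and "m \<ge> 1 \<Longrightarrow> f m \<in> sym_polys m"
    and "m \<ge> 1 \<Longrightarrow> homogeneous d (f m)"
    and "1 \<le> m' \<Longrightarrow> m' \<le> m \<Longrightarrow> trunc m' (f m) = f m'"
  using assms unfolding sf_deg_def by blast+

lemma sf_deg_0: "(\<lambda>m. 0) \<in> sf_deg d"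
  using sym_polys_lconst[of 0] by (intro sf_degI) (simp_all add: homogeneous_def trunc_def)

lemma sf_deg_add: "f \<in> sf_deg d \<Longrightarrow> g \<in> sf_deg d \<Longrightarrow> (\<lambda>m. f m + g m) \<in> sf_deg d"
proof (rule sf_degI)
  fix m m' :: nat
  assume fg: "f \<in> sf_deg d" "g \<in> sf_deg d" and m: "1 \<le> m'" "m' \<le> m"
  have "trunc m' (f m + g m) = trunc m' (f m) + trunc m' (g m)"
    by (simp add: trunc_def peval_add)
  then show "trunc m' (f m + g m) = f m' + g m'"
    using fg m by (simp add: sf_degD(4))
qed (simp_all add: sf_degD sym_polys_add homogeneous_add)

lemma sf_deg_mult:
  assumes "f \<in> sf_deg d" "g \<in> sf_deg e"
  shows "(\<lambda>m. f m * g m) \<in> sf_deg (d + e)"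
proof (rule sf_degI)
  fix m m' :: nat
  assume m: "1 \<le> m'" "m' \<le> m"
  then have "1 \<le> m" by simp
  then have "trunc m' (f m * g m) = trunc m' (f m) * trunc m' (g m)"
    using assms unfolding trunc_def by (blast intro: peval_mult nonneg_exps_sym sf_degD(2))
  then show "trunc m' (f m * g m) = f m' * g m'"
    using m assms by (simp add: sf_degD(4))
qed (use assms in \<open>simp_all add: sf_degD sym_polys_mult homogeneous_mult\<close>)

lemma sf_deg_const: "(\<lambda>m. if m = 0 then 0 else lconst c) \<in> sf_deg 0"
  using sym_polys_lconst[of c] homogeneous_lconst[of c]
  by (intro sf_degI) (simp_all add: trunc_def)

lemma sf_deg_subset: "f \<in> sf_deg d \<Longrightarrow> f \<in> sf_set"
  unfolding sf_set_def by (auto intro!: exI[of _ "{d}"] exI[of _ "\<lambda>_. f"])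

lemma sf_set_0: "(\<lambda>m. 0) \<in> sf_set"
  by (rule sf_deg_subset[OF sf_deg_0])

lemma sf_set_add:
  assumes "f \<in> sf_set" "g \<in> sf_set"
  shows "(\<lambda>m. f m + g m) \<in> sf_set"
proof -
  obtain D u where D: "finite D" "\<forall>d\<in>D. u d \<in> sf_deg d" "f = (\<lambda>m. \<Sum>d\<in>D. u d m)"
    using assms(1) by (auto simp: sf_set_def)
  obtain E v where E: "finite E" "\<forall>d\<in>E. v d \<in> sf_deg d" "g = (\<lambda>m. \<Sum>d\<in>E. v d m)"
    using assms(2) by (auto simp: sf_set_def)
  define u' where "u' d = (if d \<in> D then u d else (\<lambda>m. 0))" for d
  define v' where "v' d = (if d \<in> E then v d else (\<lambda>m. 0))" for d
  have f: "f m = (\<Sum>d\<in>D \<union> E. u' d m)" for m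
    unfolding D(3) u'_def by (rule sum.mono_neutral_cong_left) (use D E in auto)
  have g: "g m = (\<Sum>d\<in>D \<union> E. v' d m)" for m
    unfolding E(3) v'_def by (rule sum.mono_neutral_cong_left) (use D E in auto)
  have "(\<lambda>m. u' d m + v' d m) \<in> sf_deg d" for d
    by (rule sf_deg_add) (use D E sf_deg_0 in \<open>auto simp: u'_def v'_def\<close>)
  then show ?thesis
    unfolding sf_set_def using D(1) E(1)
    by (auto intro!: exI[of _ "D \<union> E"] exI[of _ "\<lambda>d m. u' d m + v' d m"]
        simp: f g sum.distrib)
qed

lemma sf_set_sum:
  "(\<And>a. a \<in> A \<Longrightarrow> f a \<in> sf_set) \<Longrightarrow> (\<lambda>m. \<Sum>a\<in>A. f a m) \<in> sf_set"
  by (induction A rule: infinite_finite_induct) (simp_all add: sf_set_0 sf_set_add)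

lemma sf_set_mult:
  assumes "f \<in> sf_set" "g \<in> sf_set"
  shows "(\<lambda>m. f m * g m) \<in> sf_set"
proof -
  obtain D u where D: "finite D" "\<forall>d\<in>D. u d \<in> sf_deg d" "f = (\<lambda>m. \<Sum>d\<in>D. u d m)"
    using assms(1) by (auto simp: sf_set_def)
  obtain E v where E: "finite E" "\<forall>d\<in>E. v d \<in> sf_deg d" "g = (\<lambda>m. \<Sum>d\<in>E. v d m)"
    using assms(2) by (auto simp: sf_set_def)
  have "(\<lambda>m. \<Sum>d\<in>D. \<Sum>e\<in>E. u d m * v e m) \<in> sf_set"
    by (intro sf_set_sum sf_deg_subset[OF sf_deg_mult]) (use D E in auto)
  then show ?thesis unfolding D(3) E(3) sum_product .
qed

lemma sf_set_const: "(\<lambda>m. if m = 0 then 0 else lconst c) \<in> sf_set"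
  by (rule sf_deg_subset[OF sf_deg_const])

lemma sf_set_comp_0: "f \<in> sf_set \<Longrightarrow> f 0 = 0"
  by (auto simp: sf_set_def sf_deg_def)

lemma sf_set_scale: "f \<in> sf_set \<Longrightarrow> (\<lambda>m. lconst c * f m) \<in> sf_set"
proof -
  assume f: "f \<in> sf_set"
  have "(\<lambda>m. lconst c * f m) = (\<lambda>m. (if m = 0 then 0 else lconst c) * f m)"
    using sf_set_comp_0[OF f] by (intro ext) simp
  then show ?thesis using sf_set_mult[OF sf_set_const[of c] f] by (simp only:)
qed

typedef symfun = sf_set
  morphisms comp_at Abs_symfun
  using sf_set_0 by blast

text \<open>\<open>comp_at f m\<close> is the image of the symmetric function \<open>f\<close> in \<open>m\<close> variables.\<close>

setup_lifting type_definition_symfun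

instantiation symfun :: comm_ring_1
begin

lift_definition zero_symfun :: symfun is "\<lambda>m. 0"
  by (rule sf_set_0)

lift_definition one_symfun :: symfun is "\<lambda>m. if m = 0 then 0 else 1"
  by (rule sf_set_const[of 1, unfolded lconst_1])

lift_definition plus_symfun :: "symfun \<Rightarrow> symfun \<Rightarrow> symfun" is "\<lambda>f g m. f m + g m"
  by (rule sf_set_add)

lift_definition times_symfun :: "symfun \<Rightarrow> symfun \<Rightarrow> symfun" is "\<lambda>f g m. f m * g m"
  by (rule sf_set_mult)

lift_definition uminus_symfun :: "symfun \<Rightarrow> symfun" is "\<lambda>f m. - f m"
  subgoal for f
    using sf_set_scale[of f "- 1"]
    by (simp add: lconst_def single_uminus)
  done

lift_definition minus_symfun :: "symfun \<Rightarrow> symfun \<Rightarrow> symfun" is "\<lambda>f g m. f m - g m"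
  subgoal for f g
    using sf_set_add[OF _ sf_set_scale, of f g "- 1"]
    by (simp add: lconst_def single_uminus)
  done

instance
proof
  fix a b c :: symfun
  show "1 * a = a" by transfer (simp add: sf_set_comp_0 fun_eq_iff)
  show "a * b * c = a * (b * c)" by transfer (simp add: mult.assoc)
  show "a * b = b * a" by transfer (simp add: mult.commute)
  show "a + b + c = a + (b + c)" by transfer (simp add: add.assoc)
  show "a + b = b + a" by transfer (simp add: add.commute)
  show "0 + a = a" by transfer simp
  show "- a + a = 0" by transfer simp
  show "a - b = a + - b" by transfer simp
  show "(a + b) * c = a * c + b * c" by transfer (simp add: distrib_right)
  show "(0::symfun) \<noteq> 1"
  proof
    assume "(0::symfun) = 1"
    then have "comp_at 0 1 = comp_at 1 1" by simp
    then show False by (simp add: zero_symfun.rep_eq one_symfun.rep_eq)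
  qed
qed

end

lift_definition sf_scale :: "qt \<Rightarrow> symfun \<Rightarrow> symfun" (infixr \<open>*\<^sub>s\<close> 75) is
  "\<lambda>c f m. lconst c * f m"
  by (rule sf_set_scale)

definition elem_sym :: "nat \<Rightarrow> nat \<Rightarrow> lpoly" where
  "elem_sym m r = (\<Sum>S | S \<subseteq> {1..m} \<and> card S = r. \<Prod>i\<in>S. X i)"

lemma nonneg_exps_X: "nonneg_exps (X i)"
  by (simp add: nonneg_exps_def X_def lookup_single when_def)

lemma nonneg_exps_prod_X: "finite S \<Longrightarrow> nonneg_exps (\<Prod>i\<in>S. X i)"
proof (induction S rule: finite_induct)
  case empty
  then show ?case by (simp add: nonneg_exps_def)
next
  case (insert i S)
  then show ?case by (simp add: nonneg_exps_mult nonneg_exps_X)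
qed

lemma peval_prod_X: "peval v (\<Prod>i\<in>S. X i) = (\<Prod>i\<in>S. v i)"
proof (cases "finite S")
  case True
  then show ?thesis
  proof (induction S rule: finite_induct)
    case (insert i S)
    then show ?case by (simp add: peval_mult nonneg_exps_X nonneg_exps_prod_X)
  qed simp
qed simp

lemma polys_prod_X: "finite S \<Longrightarrow> S \<subseteq> {1..m} \<Longrightarrow> (\<Prod>i\<in>S. X i) \<in> polys m"
proof (induction S rule: finite_induct)
  case empty
  then show ?case using polys_lconst[of 1] by simp
next
  case (insert i S)
  then show ?case by (simp add: polys_mult polys_X del: One_nat_def)
qed

lemma homogeneous_prod_X: "finite S \<Longrightarrow> homogeneous (card S) (\<Prod>i\<in>S. X i)"
proof (induction S rule: finite_induct)
  case empty
  then show ?case by (simp add: homogeneous_def)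
next
  case (insert i S)
  then show ?case using homogeneous_mult[OF homogeneous_X insert.IH] by simp
qed

lemma polys_sum: "(\<And>a. a \<in> A \<Longrightarrow> f a \<in> polys m) \<Longrightarrow> sum f A \<in> polys m"
  using polys_lconst[of 0 m]
  by (induction A rule: infinite_finite_induct) (simp_all add: polys_add)

lemma homogeneous_sum: "(\<And>a. a \<in> A \<Longrightarrow> homogeneous d (f a)) \<Longrightarrow> homogeneous d (sum f A)"
  by (induction A rule: infinite_finite_induct)
     (simp_all add: homogeneous_add, simp_all add: homogeneous_def)

lemma finite_index_set: "S \<subseteq> {1..m::nat} \<Longrightarrow> finite S"
  by (rule finite_subset[OF _ finite_atLeastAtMost])

lemma elem_sym_sym: "elem_sym m r \<in> sym_polys m"
proof -
  have poly: "elem_sym m r \<in> polys m"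
    unfolding elem_sym_def
    by (rule polys_sum, rule polys_prod_X) (auto intro: finite_index_set simp del: One_nat_def)
  have "peval (\<lambda>i. X (\<sigma> i)) (elem_sym m r) = elem_sym m r" if \<sigma>: "\<sigma> permutes {1..m}" for \<sigma>
  proof -
    have "peval (\<lambda>i. X (\<sigma> i)) (elem_sym m r) =
        (\<Sum>S | S \<subseteq> {1..m} \<and> card S = r. \<Prod>i\<in>S. X (\<sigma> i))"
      by (simp add: elem_sym_def peval_sum peval_prod_X)
    also have "\<dots> = (\<Sum>S | S \<subseteq> {1..m} \<and> card S = r. \<Prod>i\<in>\<sigma> ` S. X i)"
      by (simp add: prod.reindex permutes_inj_on[OF \<sigma>])
    also have "\<dots> = elem_sym m r"
      unfolding elem_sym_def
    proof (rule sum.reindex_bij_witness[of _ "\<lambda>S. inv_into UNIV \<sigma> ` S" "\<lambda>S. \<sigma> ` S"])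
      note \<sigma>' = permutes_inv[OF \<sigma>]
      fix S assume S: "S \<in> {S. S \<subseteq> {1..m} \<and> card S = r}"
      show "inv_into UNIV \<sigma> ` \<sigma> ` S = S" "\<sigma> ` inv_into UNIV \<sigma> ` S = S"
        using permutes_inverses[OF \<sigma>] by (simp_all add: image_image)
      show "\<sigma> ` S \<in> {S. S \<subseteq> {1..m} \<and> card S = r}"
        using S permutes_image[OF \<sigma>] card_image[OF permutes_inj_on[OF \<sigma>]] by auto
      show "inv_into UNIV \<sigma> ` S \<in> {S. S \<subseteq> {1..m} \<and> card S = r}"
        using S permutes_image[OF \<sigma>'] card_image[OF permutes_inj_on[OF \<sigma>']] by auto
    qed auto
    finally show ?thesis .
  qed
  with poly show ?thesis by (simp add: sym_polys_def)
qed

lemma elem_sym_homogeneous: "homogeneous r (elem_sym m r)"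
  unfolding elem_sym_def
proof (rule homogeneous_sum)
  fix S assume "S \<in> {S. S \<subseteq> {1..m} \<and> card S = r}"
  then show "homogeneous r (\<Prod>i\<in>S. X i)"
    using homogeneous_prod_X[OF finite_index_set, of S m] by simp
qed

lemma trunc_elem_sym:
  assumes "m' \<le> m"
  shows "trunc m' (elem_sym m r) = elem_sym m' r"
proof -
  have "trunc m' (elem_sym m r) =
      (\<Sum>S | S \<subseteq> {1..m} \<and> card S = r. \<Prod>i\<in>S. if i \<le> m' then X i else 0)"
    by (simp add: trunc_def elem_sym_def peval_sum peval_prod_X)
  also have "\<dots> = (\<Sum>S | S \<subseteq> {1..m'} \<and> card S = r. \<Prod>i\<in>S. if i \<le> m' then X i else 0)"
  proof (rule sum.mono_neutral_right)
    show "\<forall>S\<in>{S. S \<subseteq> {1..m} \<and> card S = r} - {S. S \<subseteq> {1..m'} \<and> card S = r}.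
        (\<Prod>i\<in>S. if i \<le> m' then X i else 0) = 0"
    proof
      fix S assume S: "S \<in> {S. S \<subseteq> {1..m} \<and> card S = r} - {S. S \<subseteq> {1..m'} \<and> card S = r}"
      then have "finite S" using finite_subset by auto
      moreover obtain i where "i \<in> S" "\<not> i \<le> m'" using S by fastforce
      ultimately show "(\<Prod>i\<in>S. if i \<le> m' then X i else 0) = 0"
        by (intro prod_zero) auto
    qed
  qed (use assms in auto)
  also have "\<dots> = elem_sym m' r"
    unfolding elem_sym_def by (intro sum.cong prod.cong) auto
  finally show ?thesis .
qed

lift_definition sf_e :: "nat \<Rightarrow> symfun" is "\<lambda>r m. if m = 0 then 0 else elem_sym m r"
  subgoal for r
    by (rule sf_deg_subset[of _ r], rule sf_degI)
       (simp_all add: elem_sym_sym elem_sym_homogeneous trunc_elem_sym)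
  done

text \<open>
  The family of the products in \<open>m\<close> variables belongs to the ring of symmetric functions because
  the products preserve symmetric polynomials and are compatible with truncation.
\<close>

definition sf_star :: "symfun \<Rightarrow> symfun \<Rightarrow> symfun" (infixl \<open>\<star>\<close> 70) where
  "f \<star> g = Abs_symfun (\<lambda>m. if m = 0 then 0 else qstar m (comp_at f m) (comp_at g m))"

end

theory Submission
  imports Defs "HOL-Computational_Algebra.Polynomial_Factorial"
begin

text \<open>
  Write \<open>X\<^sub>S\<close> for the product of the \<open>X\<^sub>i\<close> with \<open>i \<in> S\<close>.  Since \<open>Y\<^sub>i\<close> acts on \<open>1\<close> by \<open>X\<^sub>i\<close> and the \<open>Y\<^sub>i\<close>
  commute, \<open>\<star>\<close>-multiplication by \<open>e\<^sub>1(X)\<close> is the action of \<open>\<Sum>\<^sub>i Y\<^sub>i\<close>, at least on the image of the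
  polynomials in the \<open>Y\<^sub>i\<close>.  That image contains every \<open>X\<^sub>S\<close>, because \<open>Y\<^sub>i\<close> acts on \<open>X\<^sub>S\<close> by
  \<open>t\<^bsup>|S|\<^esup> X\<^bsub>S \<union> {i}\<^esub>\<close> whenever \<open>i < min S\<close>.  On the symmetric polynomial \<open>e\<^sub>r\<close> the factors \<open>T\<^sub>j\<^sup>-\<^sup>1\<close> of \<open>Y\<^sub>i\<close>
  act by the scalar \<open>t\<^sup>-\<^sup>1\<close>, and \<open>\<Pi>\<close> turns \<open>e\<^sub>r\<close> into \<open>q\<^sup>-\<^sup>1 X\<^sub>1 e\<^sub>r + (1 - q\<^sup>-\<^sup>1) X\<^sub>1 e\<^sub>r(X\<^sub>2, \<dots>, X\<^sub>m)\<close>.  The operator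
  \<open>T\<^bsub>i-1\<^esub> \<dots> T\<^sub>1\<close> moves \<open>X\<^sub>1\<close> to \<open>X\<^sub>i\<close> in the first summand, and turns the second one into the sum of the
  \<open>X\<^sub>S\<close> with \<open>i \<in> S\<close> and \<open>|S| = r + 1\<close>, each with the weight \<open>t\<close> to the number of elements of \<open>S\<close>
  below \<open>i\<close>.  Summed over \<open>i \<in> S\<close> these weights give \<open>1 + t + \<dots> + t\<^sup>r = [r + 1]\<^sub>t\<close>.
\<close>

subsection \<open>Laurent polynomials and substitutions\<close>

lemma qq_nonzero [simp]: "qq \<noteq> 0"
  by (simp add: qq_def Zero_fract_def eq_fract)

lemma tt_nonzero [simp]: "tt \<noteq> 0"
  by (simp add: tt_def Zero_fract_def eq_fract)

lemma tt_neq_1 [simp]: "tt \<noteq> 1"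
  by (simp add: tt_def One_fract_def eq_fract one_pCons)

lemma lconst_diff: "lconst (a - b) = lconst a - lconst b"
  by (simp add: lconst_def single_diff)

lemma lconst_minus: "lconst (- a) = - lconst a"
  by (simp add: lconst_def single_uminus)

lemma lconst_sum: "lconst (sum f A) = (\<Sum>a\<in>A. lconst (f a))"
  by (induction A rule: infinite_finite_induct) (simp_all add: lconst_add)

lemma lconst_eq_0_iff [simp]: "lconst a = 0 \<longleftrightarrow> a = 0"
  by (metis lconst_0 lconst_def lookup_single_eq lookup_zero)

lemma lconst_inverse_cancel [simp]:
  "a \<noteq> 0 \<Longrightarrow> lconst (inverse a) * lconst a = 1"
  "a \<noteq> 0 \<Longrightarrow> lconst a * lconst (inverse a) = 1"
  by (simp_all flip: lconst_mult)

lemma X_eq_iff [simp]: "X i = X j \<longleftrightarrow> i = j"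
proof
  assume "X i = X j"
  then have "keys (X i) = keys (X j)" by simp
  then have "Poly_Mapping.single i (1::int) = Poly_Mapping.single j 1" by (simp add: X_def)
  then have "keys (Poly_Mapping.single i (1::int)) = keys (Poly_Mapping.single j (1::int))" by simp
  then show "i = j" by simp
qed simp

lemma laurent_add [simp]:
  "F \<in> laurent_polys m \<Longrightarrow> G \<in> laurent_polys m \<Longrightarrow> F + G \<in> laurent_polys m"
  using keys_add[of F G] by (fastforce simp: laurent_polys_def)

lemma laurent_mult [simp]:
  assumes "F \<in> laurent_polys m" "G \<in> laurent_polys m"
  shows "F * G \<in> laurent_polys m"
proof -
  have "keys \<gamma> \<subseteq> {1..m}" if "\<gamma> \<in> keys (F * G)" for \<gamma>
  proof -
    obtain \<alpha> \<beta> where "\<gamma> = \<alpha> + \<beta>" "\<alpha> \<in> keys F" "\<beta> \<in> keys G"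
      using \<open>\<gamma> \<in> keys (F * G)\<close> keys_mult[of F G] by blast
    then show ?thesis
      using assms keys_add[of \<alpha> \<beta>] by (fastforce simp: laurent_polys_def)
  qed
  then show ?thesis by (auto simp: laurent_polys_def)
qed

lemma laurent_lconst [simp]: "lconst c \<in> laurent_polys m"
  by (auto simp: laurent_polys_def lconst_def)

lemma laurent_0 [simp]: "0 \<in> laurent_polys m" and laurent_1 [simp]: "1 \<in> laurent_polys m"
  using laurent_lconst[of 0 m] laurent_lconst[of 1 m] by simp_all

lemma laurent_minus [simp]: "F \<in> laurent_polys m \<Longrightarrow> - F \<in> laurent_polys m"
  using laurent_mult[OF laurent_lconst[of "- 1"], of F m] by (simp add: lconst_minus)

lemma laurent_diff [simp]:
  "F \<in> laurent_polys m \<Longrightarrow> G \<in> laurent_polys m \<Longrightarrow> F - G \<in> laurent_polys m"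
  using laurent_add[of F m "- G"] by simp

lemma laurent_sum [simp]:
  "(\<And>a. a \<in> A \<Longrightarrow> f a \<in> laurent_polys m) \<Longrightarrow> sum f A \<in> laurent_polys m"
  by (induction A rule: infinite_finite_induct) simp_all

lemma laurent_prod [simp]:
  "(\<And>a. a \<in> A \<Longrightarrow> f a \<in> laurent_polys m) \<Longrightarrow> prod f A \<in> laurent_polys m"
  by (induction A rule: infinite_finite_induct) simp_all

lemma laurent_X [simp]: "1 \<le> i \<Longrightarrow> i \<le> m \<Longrightarrow> X i \<in> laurent_polys m"
  by (auto simp: laurent_polys_def X_def)

lemma laurent_Xpow [simp]:
  assumes "1 \<le> m"
  shows "Xpow m j n \<in> laurent_polys m"
proof -
  have "0 \<le> (j - 1) mod int m" "(j - 1) mod int m < int m"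
    using assms by simp_all
  then have "nat ((j - 1) mod int m + 1) \<in> {1..m}"
    unfolding atLeastAtMost_iff by linarith
  then show ?thesis
    by (auto simp: laurent_polys_def Xpow_def)
qed

lemma Xpow_0 [simp]: "Xpow m j 0 = 1"
  by (simp add: Xpow_def)

lemma Xpow_add: "Xpow m j (n + n') = Xpow m j n * Xpow m j n'"
  by (simp add: Xpow_def mult_single single_add[symmetric] power_int_add[symmetric] algebra_simps)

lemma Xpow_of_nat: "i \<in> {1..m} \<Longrightarrow> Xpow m (int i) n = Poly_Mapping.single (Poly_Mapping.single i n) 1"
  by (simp add: Xpow_def)

lemma Xpow_1: "i \<in> {1..m} \<Longrightarrow> Xpow m (int i) 1 = X i"
  by (simp add: Xpow_of_nat X_def)

text \<open>Adding k*m to j adds k to the quotient of j - 1 by m and leaves the remainder alone, so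
  the convention X_{i+km} = q^(-k) X_i can be applied from any integer index.\<close>

lemma Xpow_shift:
  assumes "1 \<le> m"
  shows "Xpow m (j + k * int m) n = lconst (qq powi (- k * n)) * Xpow m j n"
proof -
  have "(j + k * int m - 1) div int m = (j - 1) div int m + k"
    using div_mult_self1[of "int m" "j - 1" k] assms by (simp add: algebra_simps)
  moreover have "(j + k * int m - 1) mod int m = (j - 1) mod int m"
    using mod_mult_self1[of "j - 1" k "int m"] by (simp add: algebra_simps)
  ultimately show ?thesis
    by (simp add: Xpow_def lconst_def mult_single power_int_add[symmetric] algebra_simps)
qed

lemma Xpow_uminus [simp]: "Xpow m j n * Xpow m j (- n) = 1"
  by (simp flip: Xpow_add)

lemma lsubst_superset:
  assumes "finite A" "keys F \<subseteq> A"
  shows "lsubst m \<phi> F = (\<Sum>\<alpha>\<in>A. lconst (lookup F \<alpha>) * (\<Prod>i\<in>{1..m}. Xpow m (\<phi> i) (lookup \<alpha> i)))"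
  unfolding lsubst_def using assms
  by (intro sum.mono_neutral_left) (auto simp: in_keys_iff)

lemma lsubst_add: "lsubst m \<phi> (F + G) = lsubst m \<phi> F + lsubst m \<phi> G"
proof -
  let ?A = "keys F \<union> keys G"
  have "keys (F + G) \<subseteq> ?A" by (rule keys_add)
  then show ?thesis
    by (simp add: lsubst_superset[of ?A] lookup_add lconst_add sum.distrib distrib_right)
qed

lemma lsubst_0 [simp]: "lsubst m \<phi> 0 = 0"
  by (simp add: lsubst_def)

lemma lsubst_sum: "lsubst m \<phi> (sum f A) = (\<Sum>a\<in>A. lsubst m \<phi> (f a))"
  by (induction A rule: infinite_finite_induct) (simp_all add: lsubst_add)

lemma lsubst_single:
  "lsubst m \<phi> (Poly_Mapping.single \<alpha> c) = lconst c * (\<Prod>i\<in>{1..m}. Xpow m (\<phi> i) (lookup \<alpha> i))"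
  by (simp add: lsubst_superset[of "{\<alpha>}"])

lemma lsubst_mult: "lsubst m \<phi> (F * G) = lsubst m \<phi> F * lsubst m \<phi> G"
proof -
  have "lsubst m \<phi> (F * G) = lsubst m \<phi> ((\<Sum>\<alpha>\<in>keys F. Poly_Mapping.single \<alpha> (lookup F \<alpha>)) *
      (\<Sum>\<beta>\<in>keys G. Poly_Mapping.single \<beta> (lookup G \<beta>)))"
    by (simp flip: lpoly_sum_single)
  also have "\<dots> = (\<Sum>\<alpha>\<in>keys F. \<Sum>\<beta>\<in>keys G.
      (lconst (lookup F \<alpha>) * (\<Prod>i\<in>{1..m}. Xpow m (\<phi> i) (lookup \<alpha> i))) *
      (lconst (lookup G \<beta>) * (\<Prod>i\<in>{1..m}. Xpow m (\<phi> i) (lookup \<beta> i))))"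
    by (simp add: sum_product mult_single lsubst_sum lsubst_single lookup_add Xpow_add
        prod.distrib lconst_mult mult_ac)
  also have "\<dots> = lsubst m \<phi> F * lsubst m \<phi> G"
    by (simp add: sum_product lsubst_def)
  finally show ?thesis .
qed

lemma lsubst_lconst [simp]: "lsubst m \<phi> (lconst c) = lconst c"
  unfolding lconst_def[of c] by (simp add: lsubst_single) (simp add: lconst_def)

lemma lsubst_1 [simp]: "lsubst m \<phi> 1 = 1"
  using lsubst_lconst[of m \<phi> 1] by simp

lemma lsubst_minus: "lsubst m \<phi> (- F) = - lsubst m \<phi> F"
  using lsubst_add[of m \<phi> "- F" F] by (simp add: eq_neg_iff_add_eq_0)

lemma lsubst_diff: "lsubst m \<phi> (F - G) = lsubst m \<phi> F - lsubst m \<phi> G"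
  using lsubst_add[of m \<phi> F "- G"] by (simp add: lsubst_minus)

lemma lsubst_prod: "lsubst m \<phi> (prod f A) = (\<Prod>a\<in>A. lsubst m \<phi> (f a))"
  by (induction A rule: infinite_finite_induct) (simp_all add: lsubst_mult)

lemma lsubst_laurent [simp]: "1 \<le> m \<Longrightarrow> lsubst m \<phi> F \<in> laurent_polys m"
  unfolding lsubst_def by simp

lemma lsubst_Xpow:
  assumes "i \<in> {1..m}"
  shows "lsubst m \<phi> (Xpow m (int i) n) = Xpow m (\<phi> i) n"
proof -
  have "(\<Prod>j\<in>{1..m}. Xpow m (\<phi> j) (lookup (Poly_Mapping.single i n) j)) =
      (\<Prod>j\<in>{i}. Xpow m (\<phi> j) (lookup (Poly_Mapping.single i n) j))"
    using assms by (intro prod.mono_neutral_right) (auto simp: lookup_single when_def)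
  then show ?thesis
    using assms by (simp add: Xpow_of_nat lsubst_single)
qed

lemma lsubst_X: "i \<in> {1..m} \<Longrightarrow> lsubst m \<phi> (X i) = Xpow m (\<phi> i) 1"
  using lsubst_Xpow[of i m \<phi> 1] by (simp add: Xpow_1)

text \<open>Substitutions are ring homomorphisms that fix the constants, so composites can be
  compared on powers of single variables. Later identities between composites of substitutions are
  reduced to this check.\<close>

lemma lsubst_comp:
  assumes "\<And>i n. i \<in> {1..m} \<Longrightarrow> lsubst m \<phi> (Xpow m (\<psi> i) n) = Xpow m (\<chi> i) n"
  shows "lsubst m \<phi> (lsubst m \<psi> F) = lsubst m \<chi> F"
proof -
  have "lsubst m \<phi> (\<Prod>i\<in>{1..m}. Xpow m (\<psi> i) (lookup \<alpha> i)) =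
      (\<Prod>i\<in>{1..m}. Xpow m (\<chi> i) (lookup \<alpha> i))" for \<alpha>
    unfolding lsubst_prod by (intro prod.cong refl assms)
  then show ?thesis
    by (simp add: lsubst_def[of m \<psi>] lsubst_sum lsubst_mult) (simp add: lsubst_def)
qed

text \<open>A map of indices that commutes with translation by m respects the convention X_{i+km} =
  q^(-k) X_i, so its effect on an arbitrary X_j follows from that on X_1, ..., X_m.\<close>

lemma lsubst_Xpow_periodic:
  assumes "1 \<le> m" "\<And>j k. \<phi> (j + k * int m) = \<phi> j + k * int m"
  shows "lsubst m (\<lambda>j. \<phi> (int j)) (Xpow m j n) = Xpow m (\<phi> j) n"
proof -
  define i where "i = nat ((j - 1) mod int m + 1)"
  define k where "k = (j - 1) div int m"
  have "0 \<le> (j - 1) mod int m" "(j - 1) mod int m < int m"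
    using assms(1) by simp_all
  then have i: "i \<in> {1..m}" "int i = (j - 1) mod int m + 1"
    unfolding i_def atLeastAtMost_iff by linarith+
  have j: "j = int i + k * int m"
    using div_mult_mod_eq[of "j - 1" "int m"] i(2) by (simp add: k_def)
  show ?thesis
    unfolding j using assms i(1) by (simp add: Xpow_shift lsubst_mult lsubst_Xpow del: One_nat_def)
qed

lemma lsubst_cong:
  "(\<And>i. i \<in> {1..m} \<Longrightarrow> \<phi> i = \<psi> i) \<Longrightarrow> lsubst m \<phi> F = lsubst m \<psi> F"
  unfolding lsubst_def by (intro sum.cong prod.cong arg_cong2[where f = "(*)"] refl) auto

lemma single_eq_prod_Xpow:
  assumes "keys \<alpha> \<subseteq> {1..m}"
  shows "Poly_Mapping.single \<alpha> c = lconst c * (\<Prod>i\<in>{1..m}. Xpow m (int i) (lookup \<alpha> i))"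
proof -
  have single_prod: "(\<Prod>i\<in>A. Poly_Mapping.single (f i) 1) = Poly_Mapping.single (sum f A) (1::qt)"
    if "finite A" for A :: "nat set" and f :: "nat \<Rightarrow> nat \<Rightarrow>\<^sub>0 int"
    using that by (induction A rule: finite_induct) (simp_all add: mult_single)
  have "(\<Sum>i\<in>{1..m}. Poly_Mapping.single i (lookup \<alpha> i)) = \<alpha>"
  proof (rule poly_mapping_eqI)
    fix j
    have "lookup (\<Sum>i\<in>{1..m}. Poly_Mapping.single i (lookup \<alpha> i)) j =
        (\<Sum>i\<in>{1..m}. if i = j then lookup \<alpha> i else 0)"
      by (auto simp: lookup_sum lookup_single when_def intro!: sum.cong)
    also have "\<dots> = lookup \<alpha> j"
      using assms by (auto simp: in_keys_iff)
    finally show "lookup (\<Sum>i\<in>{1..m}. Poly_Mapping.single i (lookup \<alpha> i)) j = lookup \<alpha> j" .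
  qed
  then show ?thesis
    by (simp add: Xpow_of_nat single_prod lconst_def mult_single)
qed

lemma lsubst_id:
  assumes "F \<in> laurent_polys m"
  shows "lsubst m int F = F"
proof -
  have "lsubst m int F = (\<Sum>\<alpha>\<in>keys F. Poly_Mapping.single \<alpha> (lookup F \<alpha>))"
    unfolding lsubst_def using assms
    by (intro sum.cong) (auto simp: laurent_polys_def single_eq_prod_Xpow)
  then show ?thesis by (simp flip: lpoly_sum_single)
qed

lemma X_mult_inverse: "i \<in> {1..m} \<Longrightarrow> X i * Xpow m (int i) (- 1) = 1"
  using Xpow_uminus[of m "int i" 1] by (simp only: Xpow_1)

lemma Xpow_induct:
  fixes n :: int
  assumes "P 1" "P (Xpow m j 1)" "P (Xpow m j (- 1))"
    and mult: "\<And>F G. P F \<Longrightarrow> P G \<Longrightarrow> P (F * G)"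
  shows "P (Xpow m j n)"
proof (induction n rule: int_induct[where k = 0])
  case (step1 i)
  then show ?case using mult[OF step1(2) assms(2)] by (simp add: Xpow_add)
next
  case (step2 i)
  then show ?case using mult[OF step2(2) assms(3)] by (simp flip: Xpow_add)
qed (simp add: assms)

text \<open>Constants, variables and inverse variables generate the Laurent polynomials as a ring.
  This is the induction behind the divisibility in \<open>act_T_divisible\<close>.\<close>

lemma laurent_induct [consumes 1, case_names const var varinv add mult]:
  assumes F: "F \<in> laurent_polys m"
    and const: "\<And>c. P (lconst c)"
    and var: "\<And>i. i \<in> {1..m} \<Longrightarrow> P (X i)"
    and varinv: "\<And>i. i \<in> {1..m} \<Longrightarrow> P (Xpow m (int i) (- 1))"
    and add: "\<And>F G. P F \<Longrightarrow> P G \<Longrightarrow> P (F + G)"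
    and mult: "\<And>F G. P F \<Longrightarrow> P G \<Longrightarrow> P (F * G)"
  shows "P F"
proof -
  have one: "P 1" using const[of 1] by simp
  have pow: "P (Xpow m (int i) n)" if "i \<in> {1..m}" for i n
    by (rule Xpow_induct[of P]) (use that one var varinv mult in \<open>auto simp: Xpow_1\<close>)
  have prods: "P (\<Prod>i\<in>A. Xpow m (int i) (n i))" if "A \<subseteq> {1..m}" for A n
    using finite_index_set[OF that] that
    by (induction A rule: finite_induct) (auto intro!: mult pow simp: one)
  have terms: "P (Poly_Mapping.single \<alpha> (lookup F \<alpha>))" if "\<alpha> \<in> keys F" for \<alpha>
  proof -
    have "keys \<alpha> \<subseteq> {1..m}" using that F unfolding laurent_polys_def by blast
    then show ?thesis by (simp only: single_eq_prod_Xpow) (intro mult const prods order_refl)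
  qed
  have "P (\<Sum>\<alpha>\<in>A. Poly_Mapping.single \<alpha> (lookup F \<alpha>))" if "A \<subseteq> keys F" for A
    using finite_subset[OF that finite_keys] that const[of 0]
    by (induction A rule: finite_induct) (auto intro!: add terms)
  then show ?thesis by (subst lpoly_sum_single) blast
qed

subsection \<open>The operators \<open>T\<^sub>i\<close> and \<open>\<Pi>\<close>\<close>

lemma ldiv_eqI: "u \<noteq> 0 \<Longrightarrow> H * u = F \<Longrightarrow> ldiv F u = H"
  unfolding ldiv_def by (rule the_equality) auto

text \<open>The restriction to V matters: the exact division in T_i and the inverse of \<Pi> are
  controlled only on Laurent polynomials in X_1, ..., X_m.\<close>

definition linear_on :: "lpoly set \<Rightarrow> (lpoly \<Rightarrow> lpoly) \<Rightarrow> bool" where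
  "linear_on V f \<longleftrightarrow> (\<forall>F\<in>V. f F \<in> V) \<and> (\<forall>F\<in>V. \<forall>G\<in>V. f (F + G) = f F + f G) \<and>
     (\<forall>F\<in>V. \<forall>c. f (lconst c * F) = lconst c * f F)"

lemma linear_onD:
  assumes "linear_on V f" "F \<in> V"
  shows "f F \<in> V" "G \<in> V \<Longrightarrow> f (F + G) = f F + f G" "f (lconst c * F) = lconst c * f F"
  using assms by (auto simp: linear_on_def)

lemma linear_on_comp: "linear_on V f \<Longrightarrow> linear_on V g \<Longrightarrow> linear_on V (\<lambda>F. f (g F))"
  by (simp add: linear_on_def)

lemma linear_on_foldr: "(\<And>x. x \<in> set xs \<Longrightarrow> linear_on V (f x)) \<Longrightarrow> linear_on V (foldr f xs)"
  by (induction xs) (simp_all add: linear_on_def)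

lemma linear_on_sum:
  assumes "linear_on (laurent_polys m) f" "\<And>a. a \<in> A \<Longrightarrow> g a \<in> laurent_polys m"
  shows "f (sum g A) = (\<Sum>a\<in>A. f (g a))"
proof -
  have "f 0 = 0"
    using linear_onD(3)[OF assms(1) laurent_0, of 0] by simp
  then show ?thesis
    using assms(2)
    by (induction A rule: infinite_finite_induct) (simp_all add: linear_onD(2)[OF assms(1)])
qed

section \<open>Transpositions of the variables and divided differences\<close>

lemma lsubst_perm_comp:
  assumes "\<And>j. j \<in> {1..m} \<Longrightarrow> \<tau> j \<in> {1..m}"
  shows "lsubst m (\<lambda>j. int (\<sigma> j)) (lsubst m (\<lambda>j. int (\<tau> j)) F) =
    lsubst m (\<lambda>j. int (\<sigma> (\<tau> j))) F"
  by (intro lsubst_comp lsubst_Xpow assms)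

lemma hs_pos: "1 \<le> i \<Longrightarrow> hs m i = lsubst m (\<lambda>j. int (transpose i (Suc i) j))"
  by (simp add: hs_def fun_eq_iff)

lemma hs_X:
  assumes "1 \<le> i" "i < m" "j \<in> {1..m}"
  shows "hs m i (X j) = X (transpose i (Suc i) j)"
proof -
  have "transpose i (Suc i) j \<in> {1..m}"
    using assms by (auto simp: transpose_def)
  then show ?thesis
    using assms by (simp add: hs_pos lsubst_X Xpow_1 del: One_nat_def)
qed

lemma hs_add: "1 \<le> i \<Longrightarrow> hs m i (F + G) = hs m i F + hs m i G"
  and hs_diff: "1 \<le> i \<Longrightarrow> hs m i (F - G) = hs m i F - hs m i G"
  and hs_mult: "1 \<le> i \<Longrightarrow> hs m i (F * G) = hs m i F * hs m i G"
  and hs_lconst: "1 \<le> i \<Longrightarrow> hs m i (lconst c) = lconst c"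
  and hs_laurent: "1 \<le> i \<Longrightarrow> i < m \<Longrightarrow> hs m i F \<in> laurent_polys m"
  by (simp_all add: hs_pos lsubst_add lsubst_diff lsubst_mult)

lemma hs_hs:
  assumes "1 \<le> i" "i < m" "F \<in> laurent_polys m"
  shows "hs m i (hs m i F) = F"
proof -
  have "hs m i (hs m i F) = lsubst m (\<lambda>j. int (transpose i (Suc i) (transpose i (Suc i) j))) F"
    unfolding hs_pos[OF assms(1)]
    by (rule lsubst_perm_comp) (use assms in \<open>auto simp: transpose_def\<close>)
  then show ?thesis using lsubst_id[OF assms(3)] by simp
qed

lemma hs_comm:
  assumes "1 \<le> i" "i < m" "1 \<le> j" "j < m" "Suc i < j"
  shows "hs m i (hs m j F) = hs m j (hs m i F)"
proof -
  have "hs m i (hs m j F) = lsubst m (\<lambda>k. int (transpose i (Suc i) (transpose j (Suc j) k))) F"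
    unfolding hs_pos[OF assms(1)] hs_pos[OF assms(3)]
    by (rule lsubst_perm_comp) (use assms in \<open>auto simp: transpose_def\<close>)
  also have "\<dots> = lsubst m (\<lambda>k. int (transpose j (Suc j) (transpose i (Suc i) k))) F"
    by (rule lsubst_cong) (use assms in \<open>auto simp: transpose_def\<close>)
  also have "\<dots> = hs m j (hs m i F)"
    unfolding hs_pos[OF assms(1)] hs_pos[OF assms(3)]
    by (rule lsubst_perm_comp[symmetric]) (use assms in \<open>auto simp: transpose_def\<close>)
  finally show ?thesis .
qed

lemma hs_braid:
  assumes "1 \<le> i" "Suc i < m"
  shows "hs m i (hs m (Suc i) (hs m i F)) = hs m (Suc i) (hs m i (hs m (Suc i) F))"
proof -
  let ?s = "transpose i (Suc i)" and ?s' = "transpose (Suc i) (Suc (Suc i))"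
  have 1: "1 \<le> Suc i" by simp
  have "hs m i (hs m (Suc i) (hs m i F)) = lsubst m (\<lambda>k. int (?s (?s' (?s k)))) F"
    unfolding hs_pos[OF assms(1)] hs_pos[OF 1]
    by (subst lsubst_perm_comp, use assms in \<open>force simp: transpose_def\<close>,
        rule lsubst_perm_comp, use assms in \<open>force simp: transpose_def\<close>)
  also have "\<dots> = lsubst m (\<lambda>k. int (?s' (?s (?s' k)))) F"
    by (rule lsubst_cong) (use assms in \<open>auto simp: transpose_def\<close>)
  also have "\<dots> = hs m (Suc i) (hs m i (hs m (Suc i) F))"
    unfolding hs_pos[OF assms(1)] hs_pos[OF 1]
    by (subst lsubst_perm_comp, use assms in \<open>force simp: transpose_def\<close>,
        rule lsubst_perm_comp[symmetric], use assms in \<open>force simp: transpose_def\<close>)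
  finally show ?thesis .
qed

text \<open>The F for which the quotient exists are closed under products by the twisted Leibniz
  rule FG - s(F) s(G) = F (G - s(G)) + (F - s(F)) s(G), and under sums. Hence it suffices to exhibit
  the quotient for constants, variables and inverse variables.\<close>

lemma act_T_divisible:
  assumes i: "1 \<le> i" "i < m" and "F \<in> laurent_polys m"
  shows "\<exists>H\<in>laurent_polys m. H * (1 - X i * Xpow m (int (Suc i)) (- 1)) = F - hs m i F"
proof -
  let ?u = "1 - X i * Xpow m (int (Suc i)) (- 1)"
  define P where "P F \<longleftrightarrow> F \<in> laurent_polys m \<and> (\<exists>H\<in>laurent_polys m. H * ?u = F - hs m i F)" for F
  have m: "1 \<le> m" using i by simp
  let ?V = "\<lambda>j. Xpow m (int j) (- 1)"
  have Vi: "X i * ?V i = 1" "X (Suc i) * ?V (Suc i) = 1"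
    using i by (intro X_mult_inverse; simp)+
  from assms(3) have "P F"
  proof (induction F rule: laurent_induct)
    case (const c)
    then show ?case
      using i by (auto simp: P_def hs_lconst intro!: bexI[of _ 0])
  next
    case (var j)
    consider "j = i" | "j = Suc i" | "j \<noteq> i" "j \<noteq> Suc i" by blast
    then show ?case
    proof cases
      case 1
      have "- X (Suc i) * ?u = X i - X (Suc i)" using Vi by Groebner_Basis.algebra
      then show ?thesis
        using 1 i var by (auto simp: P_def hs_X intro!: bexI[of _ "- X (Suc i)"])
    next
      case 2
      have "X (Suc i) * ?u = X (Suc i) - X i" using Vi by Groebner_Basis.algebra
      then show ?thesis
        using 2 i var by (auto simp: P_def hs_X intro!: bexI[of _ "X (Suc i)"])
    next
      case 3
      then show ?thesis
        using i var by (auto simp: P_def hs_X intro!: bexI[of _ 0])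
    qed
  next
    case (varinv j)
    have hsV: "hs m i (?V j) = ?V (transpose i (Suc i) j)"
      using i varinv by (simp add: hs_pos lsubst_Xpow)
    consider "j = i" | "j = Suc i" | "j \<noteq> i" "j \<noteq> Suc i" by blast
    then show ?case
    proof cases
      case 1
      have "?V i * ?u = ?V i - ?V (Suc i)" using Vi by Groebner_Basis.algebra
      then show ?thesis
        using 1 m hsV by (auto simp: P_def intro!: bexI[of _ "?V i"])
    next
      case 2
      have "- ?V i * ?u = ?V (Suc i) - ?V i" using Vi by Groebner_Basis.algebra
      then show ?thesis
        using 2 m hsV by (auto simp: P_def intro!: bexI[of _ "- ?V i"])
    next
      case 3
      then show ?thesis
        using m hsV by (auto simp: P_def intro!: bexI[of _ 0])
    qed
  next
    case (add F G)
    then obtain H K where "H \<in> laurent_polys m" "K \<in> laurent_polys m"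
      "H * ?u = F - hs m i F" "K * ?u = G - hs m i G" by (auto simp: P_def)
    then show ?case
      using add i unfolding P_def
      by (auto simp: hs_add distrib_right intro!: bexI[of _ "H + K"])
  next
    case (mult F G)
    then obtain H K where HK: "H \<in> laurent_polys m" "K \<in> laurent_polys m"
      "H * ?u = F - hs m i F" "K * ?u = G - hs m i G" by (auto simp: P_def)
    then have "(F * K + H * hs m i G) * ?u = F * G - hs m i F * hs m i G" by Groebner_Basis.algebra
    then show ?case
      using mult HK i unfolding P_def
      by (auto simp: hs_mult hs_laurent intro!: bexI[of _ "F * K + H * hs m i G"])
  qed
  then show ?thesis by (simp add: P_def)
qed

lemma one_minus_ratio_neq_0:
  assumes "1 \<le> i" "i < m"
  shows "1 - X i * Xpow m (int (Suc i)) (- 1) \<noteq> 0"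
proof
  let ?V = "Xpow m (int (Suc i)) (- 1)"
  assume "1 - X i * ?V = 0"
  moreover have "X (Suc i) * ?V = 1"
    using assms by (intro X_mult_inverse) simp
  ultimately have "X i = X (Suc i)" by Groebner_Basis.algebra
  then show False by simp
qed

text \<open>Clearing the denominator, the defining formula of \<open>T\<^sub>i\<close> becomes an equation in the integral
  domain of Laurent polynomials, which determines \<open>T\<^sub>i F\<close>.\<close>

lemma act_T_mult:
  assumes i: "1 \<le> i" "i < m" and F: "F \<in> laurent_polys m"
  shows "act_T m i F \<in> laurent_polys m"
    and "(X (Suc i) - X i) * act_T m i F =
      (lconst tt - 1) * X (Suc i) * F + (X (Suc i) - lconst tt * X i) * hs m i F"
proof -
  let ?V = "Xpow m (int (Suc i)) (- 1)"
  let ?u = "1 - X i * ?V"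
  obtain H where H: "H \<in> laurent_polys m" "H * ?u = F - hs m i F"
    using act_T_divisible[OF assms] by blast
  have Xi: "Xpow m (int i) 1 = X i" using i by (simp add: Xpow_1)
  have T: "act_T m i F = lconst tt * hs m i F + (lconst tt - 1) * H"
    using ldiv_eqI[OF one_minus_ratio_neq_0[OF i] H(2)] Xi
    by (simp add: act_T_def lconst_diff add.commute)
  then show "act_T m i F \<in> laurent_polys m"
    using H i by (simp add: hs_laurent)
  have V: "X (Suc i) * ?V = 1"
    using i by (intro X_mult_inverse) simp
  have "(X (Suc i) - X i) * H = X (Suc i) * (F - hs m i F)"
    using V H(2) by Groebner_Basis.algebra
  then show "(X (Suc i) - X i) * act_T m i F =
      (lconst tt - 1) * X (Suc i) * F + (X (Suc i) - lconst tt * X i) * hs m i F"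
    unfolding T by Groebner_Basis.algebra
qed

lemma act_T_eqI:
  assumes i: "1 \<le> i" "i < m" and F: "F \<in> laurent_polys m"
    and G: "(X (Suc i) - X i) * G =
      (lconst tt - 1) * X (Suc i) * F + (X (Suc i) - lconst tt * X i) * hs m i F"
  shows "act_T m i F = G"
proof -
  have "(X (Suc i) - X i) * act_T m i F = (X (Suc i) - X i) * G"
    using act_T_mult(2)[OF i F] G by simp
  then show ?thesis by simp
qed

text \<open>Composites of the T_i involve the values s_j(T_i F). Applying the ring homomorphism s_j
  to the cleared equation yields an equation for these as well.\<close>

lemma hs_act_T_mult:
  assumes i: "1 \<le> i" "i < m" and F: "F \<in> laurent_polys m" and j: "1 \<le> j" "j < m"
  shows "(hs m j (X (Suc i)) - hs m j (X i)) * hs m j (act_T m i F) =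
      (lconst tt - 1) * hs m j (X (Suc i)) * hs m j F +
      (hs m j (X (Suc i)) - lconst tt * hs m j (X i)) * hs m j (hs m i F)"
  using arg_cong[OF act_T_mult(2)[OF i F], of "hs m j"] j
  by (simp add: hs_mult hs_diff hs_add hs_lconst hs_lconst[of j m 1, simplified])

lemma linear_act_T:
  assumes i: "1 \<le> i" "i < m"
  shows "linear_on (laurent_polys m) (act_T m i)"
proof -
  note T = act_T_mult[OF i]
  have "act_T m i (F + G) = act_T m i F + act_T m i G"
    if "F \<in> laurent_polys m" "G \<in> laurent_polys m" for F G
  proof (rule act_T_eqI[OF i laurent_add[OF that]])
    show "(X (Suc i) - X i) * (act_T m i F + act_T m i G) =
        (lconst tt - 1) * X (Suc i) * (F + G) + (X (Suc i) - lconst tt * X i) * hs m i (F + G)"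
      unfolding hs_add[OF i(1)] using T(2)[OF that(1)] T(2)[OF that(2)] by Groebner_Basis.algebra
  qed
  moreover have "act_T m i (lconst c * F) = lconst c * act_T m i F"
    if "F \<in> laurent_polys m" for F c
  proof (rule act_T_eqI[OF i laurent_mult[OF laurent_lconst that]])
    show "(X (Suc i) - X i) * (lconst c * act_T m i F) = (lconst tt - 1) * X (Suc i) *
        (lconst c * F) + (X (Suc i) - lconst tt * X i) * hs m i (lconst c * F)"
      unfolding hs_mult[OF i(1)] hs_lconst[OF i(1)] using T(2)[OF that] by Groebner_Basis.algebra
  qed
  ultimately show ?thesis using T by (simp add: linear_on_def)
qed

section \<open>Hecke relations for T_1, ..., T_{m-1}\<close>

lemma act_T_quadratic:
  assumes i: "1 \<le> i" "i < m" and F: "F \<in> laurent_polys m"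
  shows "act_T m i (act_T m i F) = (lconst tt - 1) * act_T m i F + lconst tt * F"
proof (rule act_T_eqI[OF i act_T_mult(1)[OF i F]])
  let ?a = "X i" and ?b = "X (Suc i)"
  have s: "hs m i ?a = ?b" "hs m i ?b = ?a" using i by (auto simp: hs_X)
  have 1: "(?b - ?a) * act_T m i F = (lconst tt - 1) * ?b * F + (?b - lconst tt * ?a) * hs m i F"
    by (rule act_T_mult(2)[OF i F])
  have 2: "(?a - ?b) * hs m i (act_T m i F) =
      (lconst tt - 1) * ?a * hs m i F + (?a - lconst tt * ?b) * F"
    using hs_act_T_mult[OF i F i] by (simp add: s hs_hs[OF i F])
  \<comment> \<open>The additional factor \<open>?b - ?a\<close> allows T_i F and s_i(T_i F) to be
    eliminated by the two cleared equations; it is cancelled afterwards.\<close>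
  have "(?b - ?a) * ((?b - ?a) * ((lconst tt - 1) * act_T m i F + lconst tt * F)) =
      (?b - ?a) * ((lconst tt - 1) * ?b * act_T m i F +
        (?b - lconst tt * ?a) * hs m i (act_T m i F))"
    using 1 2 by Groebner_Basis.algebra
  then show "(?b - ?a) * ((lconst tt - 1) * act_T m i F + lconst tt * F) =
      (lconst tt - 1) * ?b * act_T m i F + (?b - lconst tt * ?a) * hs m i (act_T m i F)"
    by simp
qed

text \<open>With s = s_i and s' = s_{i+1}, the values f, f1, f2, f12, f21, f121 stand for F, sF,
  s'F, ss'F, s'sF, ss'sF, and the capital letters for intermediate results of the two triple
  products R = T T' T F and R' = T' T T' F. In a field every equation can be solved, so R and R'
  become combinations of the six values whose coefficients can be compared.\<close>

lemma braid_field: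
  fixes a b c t :: "'f :: field"
  assumes neq: "a \<noteq> b" "b \<noteq> c" "a \<noteq> c"
    and H: "(b - a) * H = (t - 1) * b * f + (b - t * a) * f1"
      "(a - b) * H1 = (t - 1) * a * f1 + (a - t * b) * f"
      "(c - a) * H2 = (t - 1) * c * f2 + (c - t * a) * f21"
      "(c - b) * H12 = (t - 1) * c * f12 + (c - t * b) * f121"
      "(c - b) * G = (t - 1) * c * H + (c - t * b) * H2"
      "(c - a) * G1 = (t - 1) * c * H1 + (c - t * a) * H12"
      "(b - a) * R = (t - 1) * b * G + (b - t * a) * G1"
    and K: "(c - b) * K = (t - 1) * c * f + (c - t * b) * f2"
      "(b - c) * K2 = (t - 1) * b * f2 + (b - t * c) * f"
      "(c - a) * K1 = (t - 1) * c * f1 + (c - t * a) * f12"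
      "(b - a) * K21 = (t - 1) * b * f21 + (b - t * a) * f121"
      "(b - a) * M = (t - 1) * b * K + (b - t * a) * K1"
      "(c - a) * M2 = (t - 1) * c * K2 + (c - t * a) * K21"
      "(c - b) * R' = (t - 1) * c * M + (c - t * b) * M2"
  shows "R = R'"
proof -
  \<comment> \<open>This coefficient turns a cleared equation for T into T F = p F + (t - p)
    s(F).\<close>
  define p where "p x y = (t - 1) * y / (y - x)" for x y
  have pm: "(y - x) * p x y = (t - 1) * y" if "x \<noteq> y" for x y
    using that by (simp add: p_def)
  have p: "u = p x y * v + (t - p x y) * w"
    if "(y - x) * u = (t - 1) * y * v + (y - t * x) * w" "x \<noteq> y" for u v w x y
  proof -
    have "(y - x) * u = (y - x) * (p x y * v + (t - p x y) * w)"
      using that(1) pm[OF that(2)] by Groebner_Basis.algebra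
    then show ?thesis using that(2) by simp
  qed
  have swap: "p y x = t - 1 - p x y" if "x \<noteq> y" for x y
  proof -
    have "(y - x) * p y x = (y - x) * (t - 1 - p x y)"
      using pm[OF that] pm[OF that[symmetric]] by Groebner_Basis.algebra
    then show ?thesis using that by simp
  qed
  \<comment> \<open>The one relation between the three coefficients that is needed: it matches the
    coefficients of f1, a rearrangement of it those of f2, and both together those of f. The
    coefficients of f12, f21 and f121 already agree.\<close>
  have cocycle: "p a b * p b c + p a c * (t - 1 - p a b) = p b c * p a c"
  proof -
    have "(b - a) * (c - b) * (c - a) * (p a b * p b c + p a c * (t - 1 - p a b)) =
        (b - a) * (c - b) * (c - a) * (p b c * p a c)"
      using pm[OF neq(1)] pm[OF neq(2)] pm[OF neq(3)] by Groebner_Basis.algebra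
    then show ?thesis using neq by simp
  qed
  have "R = (p a b * (p a b * p b c + p a c * (t - 1 - p a b)) + p a c * t) * f
      + (t - p a b) * (p a b * p b c + p a c * (t - 1 - p a b)) * f1
      + p a b * (t - p b c) * p a c * f2
      + p a b * (t - p b c) * (t - p a c) * f21
      + (t - p a b) * (t - p a c) * p b c * f12
      + (t - p a b) * (t - p a c) * (t - p b c) * f121"
    unfolding p[OF H(7) neq(1)] p[OF H(6) neq(3)] p[OF H(5) neq(2)] p[OF H(4) neq(2)]
      p[OF H(3) neq(3)] p[OF H(2) neq(1)[symmetric]] p[OF H(1) neq(1)] swap[OF neq(1)]
    by Groebner_Basis.algebra
  moreover have "R' = (p b c * (p a b * p b c + p a c * (t - 1 - p b c)) + p a c * t) * f
      + (t - p a b) * p b c * p a c * f1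
      + (p a b * p b c + p a c * (t - 1 - p b c)) * (t - p b c) * f2
      + p a b * (t - p b c) * (t - p a c) * f21
      + (t - p a b) * (t - p a c) * p b c * f12
      + (t - p a b) * (t - p a c) * (t - p b c) * f121"
    unfolding p[OF K(7) neq(2)] p[OF K(6) neq(3)] p[OF K(5) neq(1)] p[OF K(4) neq(1)]
      p[OF K(3) neq(3)] p[OF K(2) neq(2)[symmetric]] p[OF K(1) neq(2)] swap[OF neq(2)]
    by Groebner_Basis.algebra
  moreover have "p a b * p b c + p a c * (t - 1 - p b c) = p a b * p a c"
    using cocycle by Groebner_Basis.algebra
  ultimately show ?thesis using cocycle by simp
qed
text \<open>Laurent polynomials form an integral domain but not a field, so the equations are
  transported along the embedding into the fraction field.\<close>

lemma braid_idom:
  fixes a b c t :: "'a :: idom"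
  assumes neq: "a \<noteq> b" "b \<noteq> c" "a \<noteq> c"
    and H: "(b - a) * H = (t - 1) * b * f + (b - t * a) * f1"
      "(a - b) * H1 = (t - 1) * a * f1 + (a - t * b) * f"
      "(c - a) * H2 = (t - 1) * c * f2 + (c - t * a) * f21"
      "(c - b) * H12 = (t - 1) * c * f12 + (c - t * b) * f121"
      "(c - b) * G = (t - 1) * c * H + (c - t * b) * H2"
      "(c - a) * G1 = (t - 1) * c * H1 + (c - t * a) * H12"
      "(b - a) * R = (t - 1) * b * G + (b - t * a) * G1"
    and K: "(c - b) * K = (t - 1) * c * f + (c - t * b) * f2"
      "(b - c) * K2 = (t - 1) * b * f2 + (b - t * c) * f"
      "(c - a) * K1 = (t - 1) * c * f1 + (c - t * a) * f12"
      "(b - a) * K21 = (t - 1) * b * f21 + (b - t * a) * f121"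
      "(b - a) * M = (t - 1) * b * K + (b - t * a) * K1"
      "(c - a) * M2 = (t - 1) * c * K2 + (c - t * a) * K21"
      "(c - b) * R' = (t - 1) * c * M + (c - t * b) * M2"
  shows "R = R'"
proof -
  note to_fract = arg_cong[where f = to_fract]
    and simps = to_fract_mult to_fract_add to_fract_diff to_fract_1
  have "to_fract R = to_fract R'"
    by (rule braid_field[OF _ _ _ H[THEN to_fract, unfolded simps] K[THEN to_fract, unfolded simps]])
       (use neq in simp_all)
  then show ?thesis by simp
qed

lemma act_T_braid:
  assumes i: "1 \<le> i" "Suc i < m" and F: "F \<in> laurent_polys m"
  shows "act_T m i (act_T m (Suc i) (act_T m i F)) = act_T m (Suc i) (act_T m i (act_T m (Suc i) F))"
proof -
  let ?T = "act_T m i" and ?T' = "act_T m (Suc i)"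
  let ?s = "hs m i" and ?s' = "hs m (Suc i)"
  let ?a = "X i" and ?b = "X (Suc i)" and ?c = "X (Suc (Suc i))"
  have i': "1 \<le> i" "i < m" "1 \<le> Suc i" using i by auto
  have s: "?s ?a = ?b" "?s ?b = ?a" "?s ?c = ?c" "?s' ?a = ?a" "?s' ?b = ?c" "?s' ?c = ?b"
    using i by (auto simp: hs_X)
  note T = act_T_mult[OF i'(1,2)] and T' = act_T_mult[OF i'(3) i(2)]
  have L: "?T F \<in> laurent_polys m" "?T' F \<in> laurent_polys m"
    "?T' (?T F) \<in> laurent_polys m" "?T (?T' F) \<in> laurent_polys m"
    by (simp_all add: T T' F)
  have sT: "(?s ?b - ?s ?a) * ?s (?T G) =
      (lconst tt - 1) * ?s ?b * ?s G + (?s ?b - lconst tt * ?s ?a) * ?s (?s G)"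
    and s'T: "(?s' ?b - ?s' ?a) * ?s' (?T G) =
      (lconst tt - 1) * ?s' ?b * ?s' G + (?s' ?b - lconst tt * ?s' ?a) * ?s' (?s G)"
    and sT': "(?s ?c - ?s ?b) * ?s (?T' G) =
      (lconst tt - 1) * ?s ?c * ?s G + (?s ?c - lconst tt * ?s ?b) * ?s (?s' G)"
    and s'T': "(?s' ?c - ?s' ?b) * ?s' (?T' G) =
      (lconst tt - 1) * ?s' ?c * ?s' G + (?s' ?c - lconst tt * ?s' ?b) * ?s' (?s' G)"
    if "G \<in> laurent_polys m" for G
    using hs_act_T_mult[OF i'(1,2) that i'(1,2)] hs_act_T_mult[OF i'(1,2) that i'(3) i(2)]
      hs_act_T_mult[OF i'(3) i(2) that i'(1,2)] hs_act_T_mult[OF i'(3) i(2) that i'(3) i(2)]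
    by blast+
  note hs = hs_mult[OF i'(1)] hs_diff[OF i'(1)] hs_add[OF i'(1)] hs_lconst[OF i'(1)]
    hs_lconst[OF i'(1), of m 1, unfolded lconst_1]
    hs_mult[OF i'(3)] hs_diff[OF i'(3)] hs_add[OF i'(3)] hs_lconst[OF i'(3)]
    hs_lconst[OF i'(3), of m 1, unfolded lconst_1]
  have ss'T: "(?c - ?b) * ?s (?s' (?T F)) =
      (lconst tt - 1) * ?c * ?s (?s' F) + (?c - lconst tt * ?b) * ?s (?s' (?s F))"
    using arg_cong[OF s'T[OF F], of ?s] unfolding hs s .
  \<comment> \<open>The braid relation for transpositions rewrites s's s'F as ss'sF, so that both
    triple products refer to the same value f121.\<close>
  have s'sT': "(?b - ?a) * ?s' (?s (?T' F)) =
      (lconst tt - 1) * ?b * ?s' (?s F) + (?b - lconst tt * ?a) * ?s (?s' (?s F))"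
    using arg_cong[OF sT'[OF F], of ?s'] unfolding hs s hs_braid[OF i, symmetric] .
  show ?thesis
    by (rule braid_idom[OF _ _ _ T(2)[OF F] sT[OF F, unfolded s hs_hs[OF i'(1,2) F]]
          s'T[OF F, unfolded s] ss'T T'(2)[OF L(1)] sT'[OF L(1), unfolded s] T(2)[OF L(3)]
          T'(2)[OF F] s'T'[OF F, unfolded s hs_hs[OF i'(3) i(2) F]] sT'[OF F, unfolded s] s'sT'
          T(2)[OF L(2)] s'T[OF L(2), unfolded s] T'(2)[OF L(4)]])
       simp_all
qed

text \<open>For indices far apart, s_j fixes the denominator of T_i and conversely. After
  multiplication by both denominators, both composites are the same combination of F and its images
  under s_i, s_j and their product.\<close>

lemma commute_idom:
  fixes a b c d t :: "'a :: idom"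
  assumes neq: "a \<noteq> b" "c \<noteq> d"
    and "(b - a) * H = (t - 1) * b * f + (b - t * a) * f1"
      "(b - a) * H2 = (t - 1) * b * f2 + (b - t * a) * f12"
      "(d - c) * G = (t - 1) * d * H + (d - t * c) * H2"
      "(d - c) * K = (t - 1) * d * f + (d - t * c) * f2"
      "(d - c) * K1 = (t - 1) * d * f1 + (d - t * c) * f12"
      "(b - a) * M = (t - 1) * b * K + (b - t * a) * K1"
  shows "G = M"
proof -
  have "(b - a) * (d - c) * G = (b - a) * (d - c) * M"
    using assms(3-) by Groebner_Basis.algebra
  then show ?thesis using neq by simp
qed

lemma act_T_commute:
  assumes i: "1 \<le> i" "i < m" and j: "1 \<le> j" "j < m" and ij: "Suc i < j"
    and F: "F \<in> laurent_polys m"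
  shows "act_T m j (act_T m i F) = act_T m i (act_T m j F)"
proof -
  have s: "hs m j (X i) = X i" "hs m j (X (Suc i)) = X (Suc i)"
    "hs m i (X j) = X j" "hs m i (X (Suc j)) = X (Suc j)"
    using i j ij by (auto simp: hs_X)
  show ?thesis
    by (rule commute_idom[OF _ _ act_T_mult(2)[OF i F]
          hs_act_T_mult[OF i F j, unfolded s hs_comm[OF i j ij, symmetric]]
          act_T_mult(2)[OF j act_T_mult(1)[OF i F]] act_T_mult(2)[OF j F]
          hs_act_T_mult[OF j F i, unfolded s] act_T_mult(2)[OF i act_T_mult(1)[OF j F]]])
       simp_all
qed

section \<open>The cyclic shift of the variables and the operator \<Pi>\<close>

abbreviation lshift :: "nat \<Rightarrow> lpoly \<Rightarrow> lpoly" where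
  "lshift m \<equiv> lsubst m (\<lambda>j. int j + 1)"

lemma lshift_Xpow: "1 \<le> m \<Longrightarrow> lshift m (Xpow m j n) = Xpow m (j + 1) n"
  using lsubst_Xpow_periodic[of m "\<lambda>j. j + 1" j n] by simp

lemma lshift_X: "1 \<le> i \<Longrightarrow> i < m \<Longrightarrow> lshift m (X i) = X (Suc i)"
  using lsubst_X[of i m "\<lambda>j. int j + 1"] Xpow_1[of "Suc i" m] by (simp add: add.commute)

lemma Xpow_Suc_m:
  assumes "1 \<le> m"
  shows "Xpow m (int m + 1) n = lconst (qq powi (- n)) * Xpow m 1 n"
  using Xpow_shift[OF assms, of 1 1 n] by (simp add: add.commute)

text \<open>Here the index leaves the range 1, ..., m; the resulting X_{m+1} = q^(-1) X_1 is the
  source of q in the action of \<Pi>.\<close>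

lemma lshift_X_last:
  assumes "1 \<le> m"
  shows "lshift m (X m) = lconst (inverse qq) * X 1"
  using lsubst_X[of m m "\<lambda>j. int j + 1"] Xpow_1[of 1 m] Xpow_Suc_m[OF assms, of 1] assms
  by simp

lemma lshift_inverse:
  assumes "1 \<le> m" "F \<in> laurent_polys m"
  shows "lsubst m (\<lambda>j. int j - 1) (lshift m F) = F" "lshift m (lsubst m (\<lambda>j. int j - 1) F) = F"
proof -
  have 1: "lsubst m (\<lambda>j. int j - 1) (Xpow m j n) = Xpow m (j - 1) n" for j n
    using lsubst_Xpow_periodic[of m "\<lambda>j. j - 1" j n] assms by simp
  have "lsubst m (\<lambda>j. int j - 1) (lshift m F) = lsubst m int F"
    by (rule lsubst_comp) (simp add: 1)
  then show "lsubst m (\<lambda>j. int j - 1) (lshift m F) = F" by (simp add: lsubst_id assms)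
  have "lshift m (lsubst m (\<lambda>j. int j - 1) F) = lsubst m int F"
    by (rule lsubst_comp) (simp add: lshift_Xpow assms)
  then show "lshift m (lsubst m (\<lambda>j. int j - 1) F) = F" by (simp add: lsubst_id assms)
qed

lemma act_Pi_laurent: "1 \<le> m \<Longrightarrow> act_Pi m F \<in> laurent_polys m"
  by (simp add: act_Pi_def)

lemma linear_act_Pi: "1 \<le> m \<Longrightarrow> linear_on (laurent_polys m) (act_Pi m)"
  by (simp add: linear_on_def act_Pi_def lsubst_add lsubst_mult algebra_simps)

text \<open>The inverse divides by X_1 and shifts the variables back. Bijectivity makes the
  \<open>inv_into\<close> in the action of \<open>GPiInv\<close> a genuine two-sided
  inverse.\<close>

lemma bij_act_Pi:
  assumes m: "1 \<le> m"
  shows "bij_betw (act_Pi m) (laurent_polys m) (laurent_polys m)"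
proof (rule bij_betw_byWitness)
  let ?V = "Xpow m (int 1) (- 1)"
  let ?g = "\<lambda>G. lsubst m (\<lambda>j. int j - 1) (?V * G)"
  have V: "X 1 * ?V = 1"
    using m by (intro X_mult_inverse) simp
  have 1: "?V * (X 1 * F) = F" "X 1 * (?V * F) = F" for F
    using V by Groebner_Basis.algebra+
  show "\<forall>F\<in>laurent_polys m. ?g (act_Pi m F) = F"
    unfolding act_Pi_def 1 using lshift_inverse[OF m] by blast
  show "\<forall>F\<in>laurent_polys m. act_Pi m (?g F) = F"
  proof
    fix F assume "F \<in> laurent_polys m"
    then have "?V * F \<in> laurent_polys m" using m by simp
    then show "act_Pi m (?g F) = F"
      unfolding act_Pi_def by (simp only: lshift_inverse(2)[OF m] 1(2))
  qed
qed (use m in \<open>auto simp: act_Pi_laurent\<close>)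

definition Pi_inv :: "nat \<Rightarrow> lpoly \<Rightarrow> lpoly" where
  "Pi_inv m = inv_into (laurent_polys m) (act_Pi m)"

lemma Pi_inv:
  assumes "1 \<le> m" "F \<in> laurent_polys m"
  shows "Pi_inv m F \<in> laurent_polys m" "act_Pi m (Pi_inv m F) = F" "Pi_inv m (act_Pi m F) = F"
  unfolding Pi_inv_def using bij_act_Pi[OF assms(1)] assms(2)
  by (auto simp: bij_betw_def inv_into_into f_inv_into_f)

lemma linear_Pi_inv:
  assumes "1 \<le> m"
  shows "linear_on (laurent_polys m) (Pi_inv m)"
proof -
  note [simp] = Pi_inv[OF assms] linear_onD[OF linear_act_Pi[OF assms]]
  have "Pi_inv m (F + G) = Pi_inv m F + Pi_inv m G"
    if "F \<in> laurent_polys m" "G \<in> laurent_polys m" for F G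
    using Pi_inv(3)[OF assms, of "Pi_inv m F + Pi_inv m G"] that by simp
  moreover have "Pi_inv m (lconst c * F) = lconst c * Pi_inv m F"
    if "F \<in> laurent_polys m" for F c
    using Pi_inv(3)[OF assms, of "lconst c * Pi_inv m F"] that by simp
  ultimately show ?thesis by (simp add: linear_on_def)
qed

lemma lshift_hs:
  assumes "1 \<le> i" "Suc i < m"
  shows "lshift m (hs m i F) = hs m (Suc i) (lshift m F)"
proof -
  have "lshift m (hs m i F) = lsubst m (\<lambda>j. int (transpose i (Suc i) j) + 1) F"
    unfolding hs_pos[OF assms(1)] using assms by (intro lsubst_comp) (simp add: lshift_Xpow)
  also have "\<dots> = hs m (Suc i) (lshift m F)"
  proof -
    have "hs m (Suc i) (Xpow m (int j + 1) n) = Xpow m (int (transpose i (Suc i) j) + 1) n"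
      if "j \<in> {1..m}" for j n
    \<comment> \<open>For j = m the shifted variable is q^(-1) X_1; the first transposition fixes m
      and the second fixes 1.\<close>
    proof (cases "j = m")
      case True
      have "transpose i (Suc i) m = m" using assms by (auto simp: transpose_def)
      moreover have "transpose (Suc i) (Suc (Suc i)) 1 = 1" using assms by (auto simp: transpose_def)
      ultimately show ?thesis
        using assms True lsubst_Xpow[of 1 m] by (simp add: Xpow_Suc_m hs_pos lsubst_mult)
    next
      case False
      have "hs m (Suc i) (Xpow m (int (Suc j)) n) =
          Xpow m (int (transpose (Suc i) (Suc (Suc i)) (Suc j))) n"
        unfolding hs_pos[of "Suc i", simplified] using False that by (intro lsubst_Xpow) simp
      moreover have "transpose (Suc i) (Suc (Suc i)) (Suc j) = Suc (transpose i (Suc i) j)"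
        by (auto simp: transpose_def)
      ultimately show ?thesis by (simp add: add.commute)
    qed
    then show ?thesis
      unfolding hs_pos[of "Suc i", simplified] by (intro lsubst_comp[symmetric])
  qed
  finally show ?thesis .
qed

lemma act_Pi_T:
  assumes i: "1 \<le> i" "Suc i < m" and F: "F \<in> laurent_polys m"
  shows "act_Pi m (act_T m i F) = act_T m (Suc i) (act_Pi m F)"
proof (rule act_T_eqI[symmetric])
  have 1: "hs m (Suc i) (X 1) = X 1"
    using i by (subst hs_X) auto
  have "(X (Suc (Suc i)) - X (Suc i)) * lshift m (act_T m i F) =
      (lconst tt - 1) * X (Suc (Suc i)) * lshift m F +
      (X (Suc (Suc i)) - lconst tt * X (Suc i)) * hs m (Suc i) (lshift m F)"
    using arg_cong[OF act_T_mult(2)[OF i(1) _ F], of "lshift m"] i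
    by (simp add: lsubst_add lsubst_diff lsubst_mult lshift_X lshift_hs)
  then show "(X (Suc (Suc i)) - X (Suc i)) * act_Pi m (act_T m i F) =
      (lconst tt - 1) * X (Suc (Suc i)) * act_Pi m F +
      (X (Suc (Suc i)) - lconst tt * X (Suc i)) * hs m (Suc i) (act_Pi m F)"
    unfolding act_Pi_def hs_mult[of "Suc i", simplified] 1 by Groebner_Basis.algebra
qed (use i in \<open>auto simp: act_Pi_laurent\<close>)

text \<open>Two shifts carry X_{m-1}, X_m to q^(-1) X_1, q^(-1) X_2 with the same scalar, and
  therefore conjugate s_{m-1} into s_1, passing over s_0.\<close>

lemma lshift_lshift_hs:
  assumes "2 \<le> m"
  shows "lshift m (lshift m (hs m (m - 1) F)) = hs m 1 (lshift m (lshift m F))"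
proof -
  have m: "1 \<le> m" "1 \<le> m - 1" "Suc (m - 1) = m" using assms by auto
  have 2: "lshift m (lshift m F) = lsubst m (\<lambda>j. int j + 2) F" for F
    by (rule lsubst_comp) (simp add: lshift_Xpow m, simp add: add.commute)
  have 3: "lsubst m (\<lambda>j. int j + 2) (Xpow m j n) = Xpow m (j + 2) n" for j n
    using lsubst_Xpow_periodic[of m "\<lambda>j. j + 2" j n] m by simp
  have "lshift m (lshift m (hs m (m - 1) F)) = lsubst m (\<lambda>j. int (transpose (m - 1) m j) + 2) F"
    unfolding 2 hs_pos[OF m(2)] m(3) by (intro lsubst_comp) (simp add: 3)
  also have "\<dots> = hs m 1 (lshift m (lshift m F))"
  proof -
    have X_past: "Xpow m (int m + int k) n = lconst (qq powi - n) * Xpow m (int k) n" for k n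
      using Xpow_shift[OF m(1), of "int k" 1 n] by (simp add: add.commute)
    have "hs m 1 (Xpow m (int j + 2) n) = Xpow m (int (transpose (m - 1) m j) + 2) n"
      if "j \<in> {1..m}" for j n
    proof -
      have "j = m \<or> j = m - 1 \<or> j < m - 1"
        using that unfolding atLeastAtMost_iff by arith
      then consider "j = m" | "j = m - 1" | "j < m - 1" by blast
      then show ?thesis
      proof cases
        case 1
        then have "hs m 1 (Xpow m (int j + 2) n) = lconst (qq powi - n) * Xpow m (int (transpose 1 2 2)) n"
          using X_past[of 2 n] assms lsubst_Xpow[of 2 m]
          by (simp add: hs_pos lsubst_mult numeral_2_eq_2)
        also have "\<dots> = Xpow m (int (transpose (m - 1) m j) + 2) n"
          using 1 X_past[of 1 n] m by (simp add: of_nat_diff add.commute)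
        finally show ?thesis .
      next
        case 2
        then have "hs m 1 (Xpow m (int j + 2) n) = lconst (qq powi - n) * Xpow m (int (transpose 1 2 1)) n"
          using X_past[of 1 n] assms lsubst_Xpow[of 1 m]
          by (simp add: hs_pos lsubst_mult numeral_2_eq_2 of_nat_diff add.commute)
        also have "\<dots> = Xpow m (int (transpose (m - 1) m j) + 2) n"
          using 2 X_past[of 2 n] m by simp
        finally show ?thesis .
      next
        case 3
        then have "hs m 1 (Xpow m (int (j + 2)) n) = Xpow m (int (transpose 1 2 (j + 2))) n"
          using lsubst_Xpow[of "j + 2" m] by (simp add: hs_pos numeral_2_eq_2)
        moreover have "transpose 1 2 (j + 2) = j + 2" "transpose (m - 1) m j = j"
          using 3 that by (auto simp: transpose_def)
        moreover have "int (j + 2) = int j + 2" by simp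
        ultimately show ?thesis by (simp only:)
      qed
    qed
    then show ?thesis
      unfolding 2 hs_pos[OF order_refl] by (intro lsubst_comp[symmetric]) simp
  qed
  finally show ?thesis .
qed

text \<open>This combines \<Pi> T_{m-1} = T_0 \<Pi> and \<Pi> T_0 = T_1 \<Pi> into a relation
  without T_0, so that only cleared equations for positive indices occur. Together with the first of
  the two it gives the second.\<close>

lemma act_Pi_Pi_T:
  assumes m: "2 \<le> m" and F: "F \<in> laurent_polys m"
  shows "act_Pi m (act_Pi m (act_T m (m - 1) F)) = act_T m 1 (act_Pi m (act_Pi m F))"
proof (rule act_T_eqI[symmetric])
  have Pi2: "act_Pi m (act_Pi m G) = X 1 * (X 2 * lshift m (lshift m G))" for G
    using m lshift_X[of 1 m] by (simp add: act_Pi_def lsubst_mult numeral_2_eq_2)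
  have X1: "lshift m (lshift m (X (m - 1))) = lconst (inverse qq) * X 1"
    and X2: "lshift m (lshift m (X m)) = lconst (inverse qq) * X 2"
    using m lshift_X[of "m - 1" m] lshift_X[of 1 m]
    by (simp_all add: lshift_X_last lsubst_mult numeral_2_eq_2)
  have s: "hs m 1 (X 1) = X 2" "hs m 1 (X 2) = X 1"
    using m by (subst hs_X; simp add: numeral_2_eq_2)+
  have m': "1 \<le> m - 1" "m - 1 < m" "Suc (m - 1) = m" using m by auto
  \<comment> \<open>Both variables of the denominator acquire q^(-1) under two shifts, so this
    scalar can be cancelled. The prefactor X_1 X_2 of the square of \<Pi> is fixed by s_1 and is
    multiplied in afterwards.\<close>
  have "lconst (inverse qq) * ((X 2 - X 1) * lshift m (lshift m (act_T m (m - 1) F))) =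
      lconst (inverse qq) * ((lconst tt - 1) * X 2 * lshift m (lshift m F) +
        (X 2 - lconst tt * X 1) * hs m 1 (lshift m (lshift m F)))"
    using arg_cong[OF act_T_mult(2)[OF m'(1,2) F], of "\<lambda>F. lshift m (lshift m F)"]
    unfolding lsubst_add lsubst_diff lsubst_mult m'(3) X1 X2 lshift_lshift_hs[OF m] lsubst_lconst
      lsubst_1 by Groebner_Basis.algebra
  then have "(X 2 - X 1) * lshift m (lshift m (act_T m (m - 1) F)) =
      (lconst tt - 1) * X 2 * lshift m (lshift m F) +
        (X 2 - lconst tt * X 1) * hs m 1 (lshift m (lshift m F))"
    by simp
  then have "(X 2 - X 1) * act_Pi m (act_Pi m (act_T m (m - 1) F)) =
      (lconst tt - 1) * X 2 * act_Pi m (act_Pi m F) +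
      (X 2 - lconst tt * X 1) * hs m 1 (act_Pi m (act_Pi m F))"
    unfolding Pi2 hs_mult[OF order_refl] s by Groebner_Basis.algebra
  then show "(X (Suc 1) - X 1) * act_Pi m (act_Pi m (act_T m (m - 1) F)) =
      (lconst tt - 1) * X (Suc 1) * act_Pi m (act_Pi m F) +
      (X (Suc 1) - lconst tt * X 1) * hs m 1 (act_Pi m (act_Pi m F))"
    by (simp add: numeral_2_eq_2)
qed (use m in \<open>auto simp: act_Pi_laurent\<close>)

text \<open>The explicit formula for T_0 is matched with the conjugate of T_{m-1} by \<Pi>: this
  conjugation takes s_{m-1} to s_0, and the shift carries the denominator of T_{m-1} to that of
  T_0.\<close>

lemma act_Pi_T_last:
  assumes m: "2 \<le> m" and F: "F \<in> laurent_polys m"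
  shows "act_Pi m (act_T m (m - 1) F) = act_T m 0 (act_Pi m F)"
proof -
  let ?\<phi> = "\<lambda>j. if j = 1 then 0 else if j = m then int m + 1 else int j"
  have m': "1 \<le> m" "1 \<le> m - 1" "m - 1 < m" "Suc (m - 1) = m" using m by auto
  have X1: "Xpow m 1 n = Poly_Mapping.single (Poly_Mapping.single 1 n) 1" for n
    using Xpow_of_nat[of 1 m n] m by simp
  have X0: "Xpow m (int m + j) n = lconst (qq powi - n) * Xpow m j n" for j n
    using Xpow_shift[OF m'(1), of j 1 n] by (simp add: add.commute)
  have "lsubst m ?\<phi> (lshift m F) = lsubst m (\<lambda>j. int (transpose (m - 1) m j) + 1) F"
  proof (rule lsubst_comp)
    fix j n assume j: "j \<in> {1..m}"
    show "lsubst m ?\<phi> (Xpow m (int j + 1) n) = Xpow m (int (transpose (m - 1) m j) + 1) n"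
    \<comment> \<open>For j = m both sides are powers of q^(-1) X_0: on the left X_{m+1} = q^(-1)
      X_1 is sent to q^(-1) X_0, on the right m is transposed to m - 1, which is shifted to X_m =
      q^(-1) X_0.\<close>
    proof (cases "j = m")
      case True
      then show ?thesis
        using lsubst_Xpow[of 1 m ?\<phi> n] m X0[of 1 n] X0[of 0 n] by (simp add: lsubst_mult of_nat_diff)
    next
      case False
      then have "lsubst m ?\<phi> (Xpow m (int (Suc j)) n) = Xpow m (?\<phi> (Suc j)) n"
        using j by (intro lsubst_Xpow) simp
      then show ?thesis
        using False j m by (auto simp: transpose_def add.commute)
    qed
  qed
  also have "\<dots> = lshift m (hs m (m - 1) F)"
    unfolding hs_pos[OF m'(2)] m'(4) using m by (intro lsubst_comp[symmetric]) (simp add: lshift_Xpow)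
  finally have shift: "lsubst m ?\<phi> (lshift m F) = lshift m (hs m (m - 1) F)" .
  have 0: "Xpow m 0 (- 1) * Xpow m 0 1 = 1"
    using Xpow_uminus[of m 0 1] by (simp add: mult.commute)
  \<comment> \<open>The substitution in s_0 turns the factor X_1 of \<Pi> F into X_0, and the
    prefactor X_1 X_0^(-1) of s_0 turns it back.\<close>
  have "lsubst m ?\<phi> (X 1) = Xpow m 0 1"
    using lsubst_X[of 1 m ?\<phi>] m by simp
  then have hs0: "hs m 0 (act_Pi m F) = act_Pi m (hs m (m - 1) F)"
    using 0 Xpow_1[of 1 m] m shift
    by (simp add: hs_def act_Pi_def lsubst_mult mult.assoc)
  let ?u = "1 - X (m - 1) * Xpow m (int m) (- 1)"
  have u: "?u \<noteq> 0"
    using one_minus_ratio_neq_0[OF m'(2,3)] m' by simp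
  \<comment> \<open>X_{m-1} is shifted to X_m = q^(-1) X_0 and X_m to q^(-1) X_1; the scalars cancel
    in the ratio.\<close>
  have u0: "lshift m ?u = 1 - Xpow m 0 1 * Xpow m 1 (- 1)"
  proof -
    have "lshift m (X (m - 1)) = lconst (inverse qq) * Xpow m 0 1"
      using lshift_X[of "m - 1" m] Xpow_1[of m m] X0[of 0 1] m by simp
    moreover have "lshift m (Xpow m (int m) (- 1)) = lconst qq * Xpow m 1 (- 1)"
      using X0[of 1 "- 1"] m by (simp add: lshift_Xpow)
    moreover have "lconst (inverse qq) * lconst qq = 1" by simp
    ultimately show ?thesis
      unfolding lsubst_diff lsubst_mult lsubst_1 by Groebner_Basis.algebra
  qed
  have "?u \<in> laurent_polys m" using m by simp
  then have "lshift m ?u \<noteq> 0"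
    using u lshift_inverse(1)[OF m'(1), of ?u] by force
  then have u0': "1 - Xpow m 0 1 * Xpow m 1 (- 1) \<noteq> 0" by (simp only: u0 not_False_eq_True)
  obtain H where H: "H * ?u = F - hs m (m - 1) F"
    using act_T_divisible[OF m'(2,3) F] m' by auto
  have "act_Pi m H * lshift m ?u = act_Pi m F - act_Pi m (hs m (m - 1) F)"
    using arg_cong[OF H, of "lshift m"]
    unfolding act_Pi_def lsubst_mult lsubst_diff by Groebner_Basis.algebra
  then have "ldiv (act_Pi m F - act_Pi m (hs m (m - 1) F)) (1 - Xpow m 0 1 * Xpow m 1 (- 1)) =
      act_Pi m H"
    unfolding u0 by (rule ldiv_eqI[OF u0'])
  then have "act_T m 0 (act_Pi m F) =
      lconst tt * act_Pi m (hs m (m - 1) F) + lconst (tt - 1) * act_Pi m H"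
    by (simp add: act_T_def hs0)
  also have "\<dots> = act_Pi m (act_T m (m - 1) F)"
  proof -
    have "act_T m (m - 1) F = lconst tt * hs m (m - 1) F + lconst (tt - 1) * H"
      using ldiv_eqI[OF u H] m Xpow_1[of "m - 1" m] by (simp add: act_T_def of_nat_diff)
    then show ?thesis
      by (simp add: act_Pi_def lsubst_add lsubst_mult algebra_simps)
  qed
  finally show ?thesis by simp
qed

subsection \<open>The defining relations of the Hecke algebra\<close>

lemma act_T_0_eq:
  assumes "2 \<le> m" "F \<in> laurent_polys m"
  shows "act_T m 0 F = act_Pi m (act_T m (m - 1) (Pi_inv m F))"
  using act_Pi_T_last[OF assms(1), of "Pi_inv m F"] assms by (simp add: Pi_inv)

lemma linear_on_act_T:
  assumes m: "2 \<le> m" and i: "i < m"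
  shows "linear_on (laurent_polys m) (act_T m i)"
proof (cases "i = 0")
  case True
  have "1 \<le> m" using m by simp
  then have "linear_on (laurent_polys m) (\<lambda>F. act_Pi m (act_T m (m - 1) (Pi_inv m F)))"
    using m by (intro linear_on_comp[OF linear_act_Pi]
        linear_on_comp[OF linear_act_T linear_Pi_inv]) auto
  then show ?thesis
    unfolding True linear_on_def by (simp add: act_T_0_eq[OF m])
qed (use i linear_act_T in auto)

text \<open>With the index read modulo m, the cyclic successor is plain \<open>Suc\<close>, so that
  inductions over the natural numbers can run around the cycle.\<close>

definition cyc_T :: "nat \<Rightarrow> nat \<Rightarrow> lpoly \<Rightarrow> lpoly" where
  "cyc_T m i = act_T m (i mod m)"

lemma linear_cyc_T: "2 \<le> m \<Longrightarrow> linear_on (laurent_polys m) (cyc_T m i)"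
  unfolding cyc_T_def by (intro linear_on_act_T) auto

text \<open>Away from the wrap-around this is the shifted cleared equation. For index 0, T_0 is
  replaced by \<Pi> T_{m-1} \<Pi>^(-1), and the relation for the square of \<Pi> applies.\<close>

lemma act_Pi_cyc_T:
  assumes m: "2 \<le> m" and F: "F \<in> laurent_polys m"
  shows "act_Pi m (cyc_T m i F) = cyc_T m (Suc i) (act_Pi m F)"
proof -
  have m1: "1 \<le> m" using m by simp
  have i: "i mod m < m" using m by simp
  have Suc: "Suc i mod m = Suc (i mod m) mod m" by (simp add: mod_Suc_eq)
  consider "i mod m = 0" | "i mod m = m - 1" | "1 \<le> i mod m" "Suc (i mod m) < m"
    using i by linarith
  then show ?thesis
  proof cases
    case 1
    have "act_Pi m (act_T m 0 F) = act_Pi m (act_Pi m (act_T m (m - 1) (Pi_inv m F)))"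
      using act_T_0_eq[OF m F] by simp
    also have "\<dots> = act_T m 1 (act_Pi m F)"
      using act_Pi_Pi_T[OF m, of "Pi_inv m F"] Pi_inv[OF m1 F] by simp
    finally show ?thesis using 1 m by (simp add: cyc_T_def Suc)
  next
    case 2
    then show ?thesis using act_Pi_T_last[OF m F] m by (simp add: cyc_T_def Suc)
  next
    case 3
    then show ?thesis using act_Pi_T[OF 3 F] by (simp add: cyc_T_def Suc)
  qed
qed

text \<open>Conjugation by \<open>\<Pi>\<close> raises the indices of the \<open>T\<^sub>i\<close> by one, so it suffices to check the
  relations for indices between \<open>1\<close> and \<open>m - 1\<close>.\<close>

lemma cyc_T_quadratic:
  assumes m: "2 \<le> m" and F: "F \<in> laurent_polys m"
  shows "cyc_T m i (cyc_T m i F) = (lconst tt - 1) * cyc_T m i F + lconst tt * F"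
proof -
  have m1: "1 \<le> m" using m by simp
  note L = linear_onD[OF linear_cyc_T[OF m]] linear_onD[OF linear_act_Pi[OF m1]]
  have *: "cyc_T m (Suc k) (cyc_T m (Suc k) F) = lconst (tt - 1) * cyc_T m (Suc k) F + lconst tt * F"
    if "F \<in> laurent_polys m" for k F
    using that
  proof (induction k arbitrary: F)
    case 0
    then show ?case using act_T_quadratic[of 1 m F] m by (simp add: cyc_T_def lconst_diff)
  next
    case (Suc k)
    define G where "G = Pi_inv m F"
    have G: "G \<in> laurent_polys m" "F = act_Pi m G" using Pi_inv[OF m1 Suc.prems] by (auto simp: G_def)
    show ?case
      using arg_cong[OF Suc.IH[OF G(1)], of "act_Pi m"] G(1)
      by (simp add: G(2) L act_Pi_cyc_T[OF m])
  qed
  \<comment> \<open>The induction covers successors only; passing from i to i + m, which is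
    positive, includes the index 0.\<close>
  have "cyc_T m (i + m) = cyc_T m i" by (simp add: cyc_T_def)
  moreover have "i + m = Suc (i + m - 1)" using m by simp
  ultimately show ?thesis using *[OF F, of "i + m - 1"] by (simp add: lconst_diff)
qed

lemma cyc_T_braid:
  assumes m: "2 < m" and F: "F \<in> laurent_polys m"
  shows "cyc_T m i (cyc_T m (Suc i) (cyc_T m i F)) = cyc_T m (Suc i) (cyc_T m i (cyc_T m (Suc i) F))"
proof -
  have m1: "1 \<le> m" and m2: "2 \<le> m" using m by auto
  note L = linear_onD[OF linear_cyc_T[OF m2]] linear_onD[OF linear_act_Pi[OF m1]]
  have *: "cyc_T m (Suc k) (cyc_T m (Suc (Suc k)) (cyc_T m (Suc k) F)) =
      cyc_T m (Suc (Suc k)) (cyc_T m (Suc k) (cyc_T m (Suc (Suc k)) F))"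
    if "F \<in> laurent_polys m" for k F
    using that
  proof (induction k arbitrary: F)
    case 0
    then show ?case using act_T_braid[of 1 m F] m by (simp add: cyc_T_def)
  next
    case (Suc k)
    define G where "G = Pi_inv m F"
    have G: "G \<in> laurent_polys m" "F = act_Pi m G" using Pi_inv[OF m1 Suc.prems] by (auto simp: G_def)
    show ?case
      using arg_cong[OF Suc.IH[OF G(1)], of "act_Pi m"] G(1)
      by (simp add: G(2) L act_Pi_cyc_T[OF m2])
  qed
  have "cyc_T m (i + m) = cyc_T m i" "cyc_T m (Suc (i + m)) = cyc_T m (Suc i)"
    by (simp_all add: cyc_T_def mod_Suc)
  moreover have "i + m = Suc (i + m - 1)" using m by simp
  ultimately show ?thesis using *[OF F, of "i + m - 1"] by simp
qed

lemma cyc_T_commute: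
  assumes ij: "i < m" "j < m" "j \<noteq> Suc i mod m" "i \<noteq> Suc j mod m"
    and F: "F \<in> laurent_polys m"
  shows "cyc_T m i (cyc_T m j F) = cyc_T m j (cyc_T m i F)"
proof -
  \<comment> \<open>d is the difference of the indices. The bounds on d make T_1 and T_{1+d} a
    nonadjacent pair with indices below m, where the induction starts.\<close>
  have *: "cyc_T m (Suc k) (cyc_T m (Suc (k + d)) F) = cyc_T m (Suc (k + d)) (cyc_T m (Suc k) F)"
    if "2 \<le> d" "Suc d < m" "F \<in> laurent_polys m" for k d F
    using that(3)
  proof (induction k arbitrary: F)
    case 0
    then show ?case
      using act_T_commute[of 1 m "Suc d" F] that by (simp add: cyc_T_def)
  next
    case (Suc k)
    have m: "2 \<le> m" "1 \<le> m" using that by auto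
    define G where "G = Pi_inv m F"
    have G: "G \<in> laurent_polys m" "F = act_Pi m G"
      using Pi_inv[OF m(2) Suc.prems] by (auto simp: G_def)
    show ?case
      using arg_cong[OF Suc.IH[OF G(1)], of "act_Pi m"] G(1)
      by (simp add: G(2) act_Pi_cyc_T[OF m(1)] linear_onD[OF linear_cyc_T[OF m(1)]])
  qed
  have main: "cyc_T m i (cyc_T m j F) = cyc_T m j (cyc_T m i F)"
    if ij: "i < j" "j < m" "j \<noteq> Suc i mod m" "i \<noteq> Suc j mod m" for i j
  proof -
    \<comment> \<open>The second bound excludes the pair i = 0, j = m - 1, which is adjacent on the
      cycle.\<close>
    have d: "2 \<le> j - i" "Suc (j - i) < m"
      using ij by (auto simp: mod_Suc split: if_splits)
    have "cyc_T m (i + m) = cyc_T m i" "cyc_T m (j + m) = cyc_T m j"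
      by (simp_all add: cyc_T_def)
    moreover have "i + m = Suc (i + m - 1)" "j + m = Suc (i + m - 1 + (j - i))"
      using ij by auto
    ultimately show ?thesis using *[OF d F, of "i + m - 1"] by simp
  qed
  then show ?thesis
    using ij by (cases i j rule: linorder_cases) (auto intro: main main[symmetric])
qed

subsection \<open>The action of the Hecke algebra\<close>

lemma act_gen_GPiInv: "act_gen m GPiInv = Pi_inv m"
  by (simp add: Pi_inv_def)

lemma linear_act_gen:
  assumes "1 \<le> m" "g \<in> hgens m"
  shows "linear_on (laurent_polys m) (act_gen m g)"
  using assms by (cases g)
    (auto simp: hgens_def hidx_def linear_act_Pi linear_Pi_inv act_gen_GPiInv
      simp del: act_gen.simps(3) split: if_splits intro!: linear_on_act_T)

lemma linear_act_word:
  "1 \<le> m \<Longrightarrow> set (letters w) \<subseteq> hgens m \<Longrightarrow> linear_on (laurent_polys m) (act_word m w)"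
  unfolding act_word_def[abs_def] by (rule linear_on_foldr) (auto intro: linear_act_gen)

lemma act_word_add: "act_word m (v + w) F = act_word m v (act_word m w F)"
  by (simp add: act_word_def plus_hword_def)

lemma act_free_superset:
  assumes "finite A" "keys h \<subseteq> A"
  shows "act_free m h F = (\<Sum>w\<in>A. lconst (lookup h w) * act_word m w F)"
  unfolding act_free_def using assms
  by (intro sum.mono_neutral_left) (auto simp: in_keys_iff)

lemma act_free_add: "act_free m (h + h') F = act_free m h F + act_free m h' F"
proof -
  let ?A = "keys h \<union> keys h'"
  have "keys (h + h') \<subseteq> ?A" by (rule keys_add)
  then show ?thesis
    by (simp add: act_free_superset[of ?A] lookup_add lconst_add sum.distrib distrib_right)
qed

lemma act_free_0 [simp]: "act_free m 0 F = 0"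
  by (simp add: act_free_def)

lemma act_free_sum: "act_free m (sum f A) F = (\<Sum>a\<in>A. act_free m (f a) F)"
  by (induction A rule: infinite_finite_induct) (simp_all add: act_free_add)

lemma act_free_single: "act_free m (Poly_Mapping.single w c) F = lconst c * act_word m w F"
  by (simp add: act_free_superset[of "{w}"])

lemma act_free_minus: "act_free m (- h) F = - act_free m h F"
  using act_free_add[of m "- h" h F] by (simp add: eq_neg_iff_add_eq_0)

lemma act_free_diff: "act_free m (h - h') F = act_free m h F - act_free m h' F"
  using act_free_add[of m h "- h'" F] by (simp add: act_free_minus)

lemma act_free_fconst: "act_free m (fconst c) F = lconst c * F"
  by (simp add: fconst_def act_free_single act_word_def zero_hword_def)

lemma act_free_1: "act_free m 1 F = F"
  using act_free_fconst[of m 1 F] by (simp add: fconst_def)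

lemma act_free_fgen: "act_free m (fgen g) F = act_gen m g F"
  by (simp add: fgen_def act_free_single act_word_def)

lemma free_alg_simps [simp]:
  "mult (free_alg m) = (*)" "add (free_alg m) = (+)" "one (free_alg m) = 1" "zero (free_alg m) = 0"
  by (simp_all add: free_alg_def)

lemma free_alg_closed:
  shows "h \<in> carrier (free_alg m) \<Longrightarrow> h' \<in> carrier (free_alg m) \<Longrightarrow> h + h' \<in> carrier (free_alg m)"
    and "h \<in> carrier (free_alg m) \<Longrightarrow> h' \<in> carrier (free_alg m) \<Longrightarrow> h * h' \<in> carrier (free_alg m)"
    and "h \<in> carrier (free_alg m) \<Longrightarrow> - h \<in> carrier (free_alg m)"
    and "h \<in> carrier (free_alg m) \<Longrightarrow> h' \<in> carrier (free_alg m) \<Longrightarrow> h - h' \<in> carrier (free_alg m)"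
    and "fconst c \<in> carrier (free_alg m)" "1 \<in> carrier (free_alg m)" "0 \<in> carrier (free_alg m)"
    and "g \<in> hgens m \<Longrightarrow> fgen g \<in> carrier (free_alg m)"
proof -
  interpret F: ring "free_alg m" by (rule ring_free_alg)
  show "h \<in> carrier (free_alg m) \<Longrightarrow> h' \<in> carrier (free_alg m) \<Longrightarrow> h + h' \<in> carrier (free_alg m)"
    and "h \<in> carrier (free_alg m) \<Longrightarrow> h' \<in> carrier (free_alg m) \<Longrightarrow> h * h' \<in> carrier (free_alg m)"
    and "1 \<in> carrier (free_alg m)" "0 \<in> carrier (free_alg m)"
    using F.a_closed F.m_closed F.one_closed F.zero_closed by simp_all
  show "h \<in> carrier (free_alg m) \<Longrightarrow> - h \<in> carrier (free_alg m)"
    by (simp add: free_alg_def)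
  show "h - h' \<in> carrier (free_alg m)"
    if "h \<in> carrier (free_alg m)" "h' \<in> carrier (free_alg m)"
    using that keys_diff[of h h'] by (auto simp: free_alg_def)
  show "fconst c \<in> carrier (free_alg m)"
    by (auto simp: free_alg_def zero_hword_def fconst_def)
  show "g \<in> hgens m \<Longrightarrow> fgen g \<in> carrier (free_alg m)"
    by (auto simp: free_alg_def)
qed

lemma free_alg_a_inv:
  assumes "h \<in> carrier (free_alg m)"
  shows "\<ominus>\<^bsub>free_alg m\<^esub> h = - h"
proof -
  interpret F: ring "free_alg m" by (rule ring_free_alg)
  show ?thesis
    by (rule F.minus_equality) (use assms in \<open>simp_all add: free_alg_closed\<close>)
qed

lemma linear_act_free:
  assumes m: "1 \<le> m" and h: "h \<in> carrier (free_alg m)"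
  shows "linear_on (laurent_polys m) (act_free m h)"
proof -
  have w: "linear_on (laurent_polys m) (act_word m w)" if "w \<in> keys h" for w
    using h that by (intro linear_act_word[OF m]) (auto simp: free_alg_def)
  show ?thesis
    unfolding linear_on_def act_free_def
    by (simp add: linear_onD[OF w] sum_distrib_left sum.distrib distrib_left mult.left_commute)
qed

lemma act_free_mult:
  assumes m: "1 \<le> m" and h: "h \<in> carrier (free_alg m)" "h' \<in> carrier (free_alg m)"
    and F: "F \<in> laurent_polys m"
  shows "act_free m (h * h') F = act_free m h (act_free m h' F)"
proof -
  have w: "linear_on (laurent_polys m) (act_word m w)" if "w \<in> keys h \<union> keys h'" for w
    using h that by (intro linear_act_word[OF m]) (auto simp: free_alg_def)
  have sum_single: "k = (\<Sum>w\<in>keys k. Poly_Mapping.single w (lookup k w))" for k :: hfree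
    by (rule poly_mapping_eqI) (auto simp: lookup_sum lookup_single when_def in_keys_iff)
  have "act_free m (h * h') F = act_free m ((\<Sum>v\<in>keys h. Poly_Mapping.single v (lookup h v)) *
      (\<Sum>w\<in>keys h'. Poly_Mapping.single w (lookup h' w))) F"
    by (simp flip: sum_single)
  also have "\<dots> = (\<Sum>v\<in>keys h. \<Sum>w\<in>keys h'.
      lconst (lookup h v) * (lconst (lookup h' w) * act_word m v (act_word m w F)))"
    by (simp add: sum_product mult_single act_free_sum act_free_single act_word_add lconst_mult
        mult.assoc)
  also have "\<dots> = (\<Sum>v\<in>keys h. lconst (lookup h v) * act_word m v (act_free m h' F))"
  proof (rule sum.cong)
    fix v assume v: "v \<in> keys h"
    have "act_word m v (act_free m h' F) =
        (\<Sum>w\<in>keys h'. lconst (lookup h' w) * act_word m v (act_word m w F))"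
      unfolding act_free_def using v F
      by (subst linear_on_sum[OF w]) (auto simp: linear_onD[OF w])
    then show "(\<Sum>w\<in>keys h'. lconst (lookup h v) *
        (lconst (lookup h' w) * act_word m v (act_word m w F))) =
        lconst (lookup h v) * act_word m v (act_free m h' F)"
      by (simp add: sum_distrib_left)
  qed simp
  also have "\<dots> = act_free m h (act_free m h' F)"
    by (simp add: act_free_def)
  finally show ?thesis .
qed

section \<open>Descent of the action to the quotient algebra\<close>

lemma act_free_hecke_rels:
  assumes m: "1 \<le> m" and h: "h \<in> hecke_rels m" and F: "F \<in> laurent_polys m"
  shows "act_free m h F = 0"
proof -
  have P: "fgen GPi \<in> carrier (free_alg m)" "fgen GPiInv \<in> carrier (free_alg m)"
    by (simp_all add: free_alg_closed hgens_def)
  have T: "fgen (GT (i mod m)) \<in> carrier (free_alg m)" if "i' \<in> hidx m" for i i'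
    using that by (intro free_alg_closed) (auto simp: hgens_def hidx_def split: if_splits)
  have m2: "2 \<le> m" if "i \<in> hidx m" for i
    using that m by (auto simp: hidx_def split: if_splits)
  have act_T: "act_free m (fgen (GT (i mod m))) G = cyc_T m i G" for i G
    by (simp add: act_free_fgen cyc_T_def)
  have act_P: "act_free m (fgen GPi) G = act_Pi m G" "act_free m (fgen GPiInv) G = Pi_inv m G" for G
    by (simp_all add: act_free_fgen Pi_inv_def)
  note L = linear_onD[OF linear_cyc_T] linear_onD[OF linear_act_Pi[OF m]]
  note simps = act_free_mult[OF m] act_free_diff act_free_add act_free_1 act_free_fconst act_T act_P
    free_alg_closed P T L Pi_inv[OF m] F
  consider "h = fgen GPi * fgen GPiInv - 1" | "h = fgen GPiInv * fgen GPi - 1"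
    | i where "i \<in> hidx m" "h = (fgen (GT (i mod m)) - fconst tt) * (fgen (GT (i mod m)) + 1)"
    | i where "i \<in> hidx m" "m > 2" "h = fgen (GT (i mod m)) * fgen (GT ((i + 1) mod m)) * fgen (GT (i mod m))
        - fgen (GT ((i + 1) mod m)) * fgen (GT (i mod m)) * fgen (GT ((i + 1) mod m))"
    | i j where "i \<in> hidx m" "j \<in> hidx m" "j \<noteq> (i + 1) mod m" "i \<noteq> (j + 1) mod m"
        "h = fgen (GT (i mod m)) * fgen (GT (j mod m)) - fgen (GT (j mod m)) * fgen (GT (i mod m))"
    | i where "i \<in> hidx m" "h = fgen GPi * fgen (GT (i mod m)) - fgen (GT ((i + 1) mod m)) * fgen GPi"
    using h unfolding hecke_rels_def Let_def by blast
  then show ?thesis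
  proof cases
    case (3 i)
    note m2 = m2[OF 3(1)] and T = T[OF 3(1)]
    show ?thesis
      using cyc_T_quadratic[OF m2 F, of i] m2 T
      by (simp add: 3(2) simps algebra_simps)
  next
    case (4 i)
    note m2 = m2[OF 4(1)] and T = T[OF 4(1)]
    show ?thesis
      using cyc_T_braid[OF 4(2) F, of i] m2 T by (simp add: 4(3) simps)
  next
    case (5 i j)
    note m2 = m2[OF 5(1)] and T = T[OF 5(1)]
    have "i < m" "j < m" using 5(1,2) by (auto simp: hidx_def split: if_splits)
    then show ?thesis
      using cyc_T_commute[of i m j F] F m2 T 5(3,4) by (simp add: 5(5) simps del: mod_less)
  next
    case (6 i)
    note m2 = m2[OF 6(1)] and T = T[OF 6(1)]
    show ?thesis
      using act_Pi_cyc_T[OF m2 F, of i] m2 T by (simp add: 6(2) simps)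
  qed (simp_all add: simps)
qed

text \<open>The elements that annihilate all Laurent polynomials form a two-sided ideal containing
  the defining relations, hence it contains the ideal they generate. Absorption from the right uses
  that the free algebra preserves the Laurent polynomials.\<close>

lemma act_free_hecke_ideal:
  assumes m: "1 \<le> m" and "h \<in> hecke_ideal m" and F: "F \<in> laurent_polys m"
  shows "act_free m h F = 0"
proof -
  interpret R: ring "free_alg m" by (rule ring_free_alg)
  let ?I = "{h \<in> carrier (free_alg m). \<forall>F\<in>laurent_polys m. act_free m h F = 0}"
  have "ideal ?I (free_alg m)"
  proof (rule idealI[OF ring_free_alg])
    show "subgroup ?I (add_monoid (free_alg m))"
    proof (rule R.add.subgroupI)
      fix a assume a: "a \<in> ?I"
      then show "\<ominus>\<^bsub>free_alg m\<^esub> a \<in> ?I"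
        by (simp add: free_alg_a_inv act_free_minus free_alg_closed)
    next
      show "?I \<noteq> {}" using free_alg_closed(7)[of m] by force
    qed (auto simp: act_free_add free_alg_closed)
  next
    fix a x assume ax: "a \<in> ?I" "x \<in> carrier (free_alg m)"
    have "act_free m x 0 = 0"
      using linear_onD(3)[OF linear_act_free[OF m ax(2)] laurent_0, of 0] by simp
    then show "x \<otimes>\<^bsub>free_alg m\<^esub> a \<in> ?I"
      using ax by (simp add: act_free_mult[OF m] free_alg_closed)
    show "a \<otimes>\<^bsub>free_alg m\<^esub> x \<in> ?I"
      using ax linear_onD(1)[OF linear_act_free[OF m ax(2)]]
      by (simp add: act_free_mult[OF m] free_alg_closed)
  qed
  moreover have "hecke_rels m \<subseteq> ?I"
    using hecke_rels_carrier act_free_hecke_rels[OF m] by auto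
  ultimately have "hecke_ideal m \<subseteq> ?I"
    unfolding hecke_ideal_def by (rule R.genideal_minimal)
  then show ?thesis using assms by auto
qed

text \<open>Elements of a coset differ by the ideal, which acts as zero; so the image in the
  definition of \<open>act\<close> is a singleton and \<open>the_elem\<close> returns its
  value.\<close>

lemma act_hclass:
  assumes m: "1 \<le> m" and F: "F \<in> laurent_polys m"
  shows "act m (hclass m h) F = act_free m h F"
proof -
  interpret I: ideal "hecke_ideal m" "free_alg m" by (rule ideal_hecke_ideal)
  have "0 \<in> hecke_ideal m" using subgroup.one_closed[OF I.a_subgroup] by simp
  moreover have "hclass m h = (\<lambda>i. i + h) ` hecke_ideal m"
    by (auto simp: hclass_def a_r_coset_def')
  ultimately have "(\<lambda>h. act_free m h F) ` hclass m h = {act_free m h F}"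
    using act_free_hecke_ideal[OF m _ F] by (auto simp: act_free_add image_image)
  then show ?thesis by (simp add: act_def)
qed

lemma hclass_hom: "hclass m \<in> ring_hom (free_alg m) (hecke m)"
  using ideal.rcos_ring_hom[OF ideal_hecke_ideal[of m]]
  by (simp add: hclass_def[abs_def] hecke_def)

lemma carrier_heckeE:
  assumes "H \<in> carrier (hecke m)"
  obtains h where "h \<in> carrier (free_alg m)" "H = hclass m h"
  using assms by (auto simp: hecke_def FactRing_def A_RCOSETS_def' hclass_def)

lemma hclass_carrier: "h \<in> carrier (free_alg m) \<Longrightarrow> hclass m h \<in> carrier (hecke m)"
  by (rule ring_hom_closed[OF hclass_hom])

lemma hclass_eqI:
  assumes "a \<in> carrier (free_alg m)" "b \<in> carrier (free_alg m)" "a - b \<in> hecke_ideal m"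
  shows "hclass m a = hclass m b"
proof -
  interpret R: ring "free_alg m" by (rule ring_free_alg)
  show ?thesis
    using R.quotient_eq_iff_same_a_r_cos[OF ideal_hecke_ideal assms(1,2)] assms
    by (simp add: hclass_def a_minus_def free_alg_a_inv)
qed

context
  fixes m :: nat
  assumes m: "1 \<le> m"
begin

lemma linear_act:
  assumes "H \<in> carrier (hecke m)"
  shows "linear_on (laurent_polys m) (act m H)"
proof -
  obtain h where h: "h \<in> carrier (free_alg m)" "H = hclass m h"
    using carrier_heckeE[OF assms] .
  then show ?thesis
    using linear_act_free[OF m h(1)] by (simp add: linear_on_def act_hclass[OF m])
qed

lemma act_mult:
  assumes "H \<in> carrier (hecke m)" "H' \<in> carrier (hecke m)" "F \<in> laurent_polys m"
  shows "act m (H \<otimes>\<^bsub>hecke m\<^esub> H') F = act m H (act m H' F)"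
proof -
  obtain h h' where h: "h \<in> carrier (free_alg m)" "H = hclass m h"
    "h' \<in> carrier (free_alg m)" "H' = hclass m h'"
    using assms(1,2) by (metis carrier_heckeE)
  then have "H \<otimes>\<^bsub>hecke m\<^esub> H' = hclass m (h * h')"
    using ring_hom_mult[OF hclass_hom] by simp
  then show ?thesis
    using h assms(3) linear_onD(1)[OF linear_act_free[OF m h(3)]]
    by (simp add: act_hclass[OF m] act_free_mult[OF m])
qed

lemma act_add:
  assumes "H \<in> carrier (hecke m)" "H' \<in> carrier (hecke m)" "F \<in> laurent_polys m"
  shows "act m (H \<oplus>\<^bsub>hecke m\<^esub> H') F = act m H F + act m H' F"
proof -
  obtain h h' where h: "h \<in> carrier (free_alg m)" "H = hclass m h"
    "h' \<in> carrier (free_alg m)" "H' = hclass m h'"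
    using assms(1,2) by (metis carrier_heckeE)
  then have "H \<oplus>\<^bsub>hecke m\<^esub> H' = hclass m (h + h')"
    using ring_hom_add[OF hclass_hom] by simp
  then show ?thesis
    using assms(3) by (simp add: h act_hclass[OF m] act_free_add)
qed

lemma act_one: "F \<in> laurent_polys m \<Longrightarrow> act m \<one>\<^bsub>hecke m\<^esub> F = F"
  using ring_hom_one[OF hclass_hom, of m] act_hclass[OF m, of F 1] by (simp add: act_free_1)

lemma act_a_inv:
  assumes "H \<in> carrier (hecke m)" "F \<in> laurent_polys m"
  shows "act m (\<ominus>\<^bsub>hecke m\<^esub> H) F = - act m H F"
proof -
  interpret H: ring "hecke m" by (rule ring_hecke)
  obtain h where h: "h \<in> carrier (free_alg m)" "H = hclass m h"
    using carrier_heckeE[OF assms(1)] .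
  have "hclass m (- h) \<oplus>\<^bsub>hecke m\<^esub> hclass m h = hclass m 0"
    using ring_hom_add[OF hclass_hom, of "- h" m h] h by (simp add: free_alg_closed)
  also have "\<dots> = \<zero>\<^bsub>hecke m\<^esub>"
    using ring_hom_zero[OF hclass_hom ring_free_alg ring_hecke, of m] by simp
  finally have "\<ominus>\<^bsub>hecke m\<^esub> H = hclass m (- h)"
    using h by (intro H.minus_equality) (auto simp: hclass_carrier free_alg_closed)
  then show ?thesis
    using h assms(2) by (simp add: act_hclass[OF m] act_free_minus)
qed

lemma hscal_carrier: "hscal m c \<in> carrier (hecke m)"
  by (simp add: hscal_def hclass_carrier free_alg_closed)

lemma act_hscal: "F \<in> laurent_polys m \<Longrightarrow> act m (hscal m c) F = lconst c * F"
  by (simp add: hscal_def act_hclass[OF m] act_free_fconst)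

lemma hPi_carrier: "hPi m \<in> carrier (hecke m)"
  by (simp add: hPi_def hclass_carrier free_alg_closed hgens_def)

lemma act_hPi: "F \<in> laurent_polys m \<Longrightarrow> act m (hPi m) F = act_Pi m F"
  by (simp add: hPi_def act_hclass[OF m] act_free_fgen)

lemma hT_carrier:
  assumes "1 \<le> i" "i < m"
  shows "hT m i \<in> carrier (hecke m)"
  using assms by (simp add: hT_def hclass_carrier free_alg_closed hgens_def hidx_def)

lemma act_hT: "F \<in> laurent_polys m \<Longrightarrow> act m (hT m i) F = act_T m i F"
  by (simp add: hT_def act_hclass[OF m] act_free_fgen)

text \<open>\<open>hY\<close> contains inverses of the T_j in the quotient ring, and these have the
  intended meaning only for units.\<close>

lemma hT_Units:
  assumes i: "1 \<le> i" "i < m"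
  shows "hT m i \<in> Units (hecke m)"
proof -
  interpret I: ideal "hecke_ideal m" "free_alg m" by (rule ideal_hecke_ideal)
  let ?T = "fgen (GT i)"
  \<comment> \<open>The quadratic relation reads T (T - (t - 1)) = t, which gives this inverse;
    scalars are central, so it works on both sides.\<close>
  let ?y = "fconst (inverse tt) * (?T - fconst (tt - 1))"
  have central: "fconst c * h = h * fconst c" for c and h :: hfree
  proof -
    have single: "fconst c * Poly_Mapping.single w a = Poly_Mapping.single w a * fconst c" for w a
      by (simp add: fconst_def mult_single mult.commute)
    have h: "h = (\<Sum>w\<in>keys h. Poly_Mapping.single w (lookup h w))"
      by (rule poly_mapping_eqI) (auto simp: lookup_sum lookup_single when_def in_keys_iff)
    show ?thesis
      by (subst (1 2) h) (simp only: sum_distrib_left sum_distrib_right single)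
  qed
  have fconst: "fconst (tt - 1) = fconst tt - 1" "fconst (inverse tt) * fconst tt = 1"
    by (simp_all add: fconst_def single_diff mult_single)
  have T: "?T \<in> carrier (free_alg m)"
    using i by (simp add: free_alg_closed hgens_def hidx_def)
  then have y: "?y \<in> carrier (free_alg m)" by (simp add: free_alg_closed)
  have "(?T - fconst tt) * (?T + 1) \<in> hecke_rels m"
  proof -
    have "i \<in> hidx m" "i mod m = i" using i by (auto simp: hidx_def)
    then show ?thesis unfolding hecke_rels_def Let_def by force
  qed
  then have "(?T - fconst tt) * (?T + 1) \<in> hecke_ideal m"
    unfolding hecke_ideal_def using I.genideal_self[OF hecke_rels_carrier] by blast
  then have rel: "fconst (inverse tt) * ((?T - fconst tt) * (?T + 1)) \<in> hecke_ideal m"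
    using I.I_l_closed[of _ "fconst (inverse tt)"] by (simp add: free_alg_closed)
  have "?y * ?T - 1 = fconst (inverse tt) * ((?T - fconst tt) * (?T + 1))"
  proof -
    have "fconst (inverse tt) * (fconst tt * ?T) = ?T"
      using fconst(2) by (simp flip: mult.assoc)
    with fconst(2) show ?thesis unfolding fconst(1) by (simp add: algebra_simps)
  qed
  then have 1: "hclass m (?y * ?T) = hclass m 1"
    using rel T y by (intro hclass_eqI) (simp_all add: free_alg_closed)
  have "?T * ?y = ?y * ?T"
  proof -
    have "?T * ?y = fconst (inverse tt) * (?T * (?T - fconst (tt - 1)))"
      unfolding mult.assoc[symmetric] central[of "inverse tt" ?T] ..
    also have "?T * (?T - fconst (tt - 1)) = (?T - fconst (tt - 1)) * ?T"
      unfolding left_diff_distrib right_diff_distrib central[of "tt - 1" ?T] ..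
    finally show ?thesis by (simp only: mult.assoc)
  qed
  with 1 have "hclass m ?y \<otimes>\<^bsub>hecke m\<^esub> hT m i = \<one>\<^bsub>hecke m\<^esub>"
    "hT m i \<otimes>\<^bsub>hecke m\<^esub> hclass m ?y = \<one>\<^bsub>hecke m\<^esub>"
    using ring_hom_mult[OF hclass_hom, of ?y m ?T] ring_hom_mult[OF hclass_hom, of ?T m ?y]
      ring_hom_one[OF hclass_hom, of m] T y
    by (simp_all add: hT_def)
  then show ?thesis
    using hT_carrier[OF i] hclass_carrier[OF y] unfolding Units_def by blast
qed

end

subsection \<open>Commutativity of the \<open>Y\<^sub>i\<close>\<close>

text \<open>The inverse of T_i as read off from the quadratic relation.\<close>

definition act_Tinv :: "nat \<Rightarrow> nat \<Rightarrow> lpoly \<Rightarrow> lpoly" where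
  "act_Tinv m i F = lconst (inverse tt) * (act_T m i F - lconst (tt - 1) * F)"

text \<open>The factor t^(m-i) of Y_i is left out, which makes the recursion \<open>Y_Suc\<close>
  free of scalars; \<open>act_hY\<close> puts it back. In a \<open>foldr\<close> over a reversed
  list the smallest index acts first.\<close>

definition act_Y :: "nat \<Rightarrow> nat \<Rightarrow> lpoly \<Rightarrow> lpoly" where
  "act_Y m i F = foldr (act_T m) (rev [1..<i]) (act_Pi m (foldr (act_Tinv m) (rev [i..<m]) F))"

lemma foldr_rev_upt_Suc: "i \<le> k \<Longrightarrow> foldr f (rev [i..<Suc k]) x = f k (foldr f (rev [i..<k]) x)"
  by simp

lemma foldr_rev_upt_first: "i < k \<Longrightarrow> foldr f (rev [i..<k]) x = foldr f (rev [Suc i..<k]) (f i x)"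
  by (simp add: upt_conv_Cons)

context
  fixes m :: nat
  assumes m: "1 \<le> m"
begin

lemma T_closed: "1 \<le> i \<Longrightarrow> i < m \<Longrightarrow> F \<in> laurent_polys m \<Longrightarrow> act_T m i F \<in> laurent_polys m"
  by (rule act_T_mult)

lemma linear_act_Tinv:
  assumes "1 \<le> i" "i < m"
  shows "linear_on (laurent_polys m) (act_Tinv m i)"
  using linear_onD[OF linear_act_T[OF assms]]
  by (simp add: linear_on_def act_Tinv_def algebra_simps)

lemma Tinv_closed: "1 \<le> i \<Longrightarrow> i < m \<Longrightarrow> F \<in> laurent_polys m \<Longrightarrow> act_Tinv m i F \<in> laurent_polys m"
  by (rule linear_onD(1)[OF linear_act_Tinv])

lemma T_Tinv:
  assumes i: "1 \<le> i" "i < m" and F: "F \<in> laurent_polys m"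
  shows "act_T m i (act_Tinv m i F) = F" "act_Tinv m i (act_T m i F) = F"
proof -
  note L = linear_onD[OF linear_act_T[OF i]]
  have 1: "act_T m i F - lconst (tt - 1) * F = act_T m i F + lconst (1 - tt) * F"
    by (simp add: lconst_diff algebra_simps)
  have 2: "lconst (inverse tt) * lconst tt = 1" by simp
  have "act_T m i (act_Tinv m i F) =
      lconst (inverse tt) * (act_T m i (act_T m i F) + lconst (1 - tt) * act_T m i F)"
    unfolding act_Tinv_def 1 using L F by simp
  also have "\<dots> = F"
    unfolding act_T_quadratic[OF i F] lconst_diff lconst_1 using 2 by Groebner_Basis.algebra
  finally show "act_T m i (act_Tinv m i F) = F" .
  show "act_Tinv m i (act_T m i F) = F"
    unfolding act_Tinv_def act_T_quadratic[OF i F] lconst_diff lconst_1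
    using 2 by Groebner_Basis.algebra
qed

lemma T_comm:
  assumes "1 \<le> i" "i < m" "1 \<le> j" "j < m" "Suc i < j \<or> Suc j < i" "F \<in> laurent_polys m"
  shows "act_T m i (act_T m j F) = act_T m j (act_T m i F)"
  using assms act_T_commute[of i m j F] act_T_commute[of j m i F] by auto

lemma T_Tinv_comm:
  assumes "1 \<le> i" "i < m" "1 \<le> j" "j < m" "Suc i < j \<or> Suc j < i" "F \<in> laurent_polys m"
  shows "act_T m i (act_Tinv m j F) = act_Tinv m j (act_T m i F)"
proof -
  have "act_T m j (act_T m i (act_Tinv m j F)) = act_T m i F"
    using assms T_comm[of j i "act_Tinv m j F"] by (auto simp: T_Tinv Tinv_closed)
  then have "act_Tinv m j (act_T m j (act_T m i (act_Tinv m j F))) = act_Tinv m j (act_T m i F)"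
    by simp
  then show ?thesis using assms by (simp add: T_Tinv T_closed Tinv_closed)
qed

lemma Tinv_comm:
  assumes "1 \<le> i" "i < m" "1 \<le> j" "j < m" "Suc i < j \<or> Suc j < i" "F \<in> laurent_polys m"
  shows "act_Tinv m i (act_Tinv m j F) = act_Tinv m j (act_Tinv m i F)"
proof -
  have "act_T m i (act_Tinv m j (act_Tinv m i F)) = act_Tinv m j F"
    using assms T_Tinv_comm[of i j "act_Tinv m i F"] by (auto simp: T_Tinv Tinv_closed)
  then have "act_Tinv m i (act_T m i (act_Tinv m j (act_Tinv m i F))) = act_Tinv m i (act_Tinv m j F)"
    by simp
  then show ?thesis using assms by (simp add: T_Tinv T_closed Tinv_closed)
qed

text \<open>Writing F as T_i T_{i+1} H, or as T_{i+1} T_i K in the second case, reduces these mixed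
  forms to the braid relation for the T_i.\<close>

lemma Tinv_braid:
  assumes i: "1 \<le> i" "Suc i < m" and F: "F \<in> laurent_polys m"
  shows "act_Tinv m (Suc i) (act_Tinv m i (act_T m (Suc i) F)) =
      act_T m i (act_Tinv m (Suc i) (act_Tinv m i F))"
    and "act_Tinv m i (act_Tinv m (Suc i) (act_T m i F)) =
      act_T m (Suc i) (act_Tinv m i (act_Tinv m (Suc i) F))"
proof -
  note simps = T_Tinv T_closed Tinv_closed
  define H where "H = act_Tinv m (Suc i) (act_Tinv m i F)"
  have H: "H \<in> laurent_polys m" "F = act_T m i (act_T m (Suc i) H)"
    using i F by (simp_all add: H_def simps)
  show "act_Tinv m (Suc i) (act_Tinv m i (act_T m (Suc i) F)) =
      act_T m i (act_Tinv m (Suc i) (act_Tinv m i F))"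
    unfolding H(2) using i H(1) by (simp add: act_T_braid[symmetric] simps)
  define K where "K = act_Tinv m i (act_Tinv m (Suc i) F)"
  have K: "K \<in> laurent_polys m" "F = act_T m (Suc i) (act_T m i K)"
    using i F by (simp_all add: K_def simps)
  show "act_Tinv m i (act_Tinv m (Suc i) (act_T m i F)) =
      act_T m (Suc i) (act_Tinv m i (act_Tinv m (Suc i) F))"
    unfolding K(2) using i K(1) by (simp add: act_T_braid simps)
qed

lemma act_Pi_Tinv:
  assumes i: "1 \<le> i" "Suc i < m" and F: "F \<in> laurent_polys m"
  shows "act_Pi m (act_Tinv m i F) = act_Tinv m (Suc i) (act_Pi m F)"
proof -
  have "act_T m (Suc i) (act_Pi m (act_Tinv m i F)) = act_Pi m F"
    using act_Pi_T[OF i, of "act_Tinv m i F"] i F by (simp add: T_Tinv Tinv_closed)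
  then have "act_Tinv m (Suc i) (act_T m (Suc i) (act_Pi m (act_Tinv m i F))) =
      act_Tinv m (Suc i) (act_Pi m F)" by simp
  then show ?thesis using i m by (simp add: T_Tinv act_Pi_laurent)
qed

section \<open>Moving T_j and \<Pi> past chains of inverses\<close>

abbreviation Tinvs :: "nat \<Rightarrow> nat \<Rightarrow> lpoly \<Rightarrow> lpoly" where
  "Tinvs i k \<equiv> foldr (act_Tinv m) (rev [i..<k])"

lemma Tinvs_closed:
  "1 \<le> i \<Longrightarrow> k \<le> m \<Longrightarrow> F \<in> laurent_polys m \<Longrightarrow> Tinvs i k F \<in> laurent_polys m"
  by (rule linear_onD(1)[OF linear_on_foldr]) (auto intro: linear_act_Tinv)

lemma Tinvs_far:
  assumes "1 \<le> j" "j < m" "1 \<le> i" "k \<le> m" "Suc j < i \<or> k < j" "F \<in> laurent_polys m"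
  shows "act_T m j (Tinvs i k F) = Tinvs i k (act_T m j F)"
    and "act_Tinv m j (Tinvs i k F) = Tinvs i k (act_Tinv m j F)"
proof -
  have "act_T m j (Tinvs i k F) = Tinvs i k (act_T m j F) \<and>
      act_Tinv m j (Tinvs i k F) = Tinvs i k (act_Tinv m j F)"
    using assms(4,5)
  proof (induction k)
    case (Suc k)
    show ?case
    proof (cases "i \<le> k")
      case True
      then have "Suc j < k \<or> Suc k < j" "Suc j < i \<or> k < j" using Suc.prems by auto
      moreover have "1 \<le> k" "k < m" using True Suc.prems assms by auto
      ultimately show ?thesis
        using Suc.IH True assms T_Tinv_comm[of j k "Tinvs i k F"] Tinv_comm[of j k "Tinvs i k F"]
        by (simp add: Tinvs_closed)
    qed auto
  qed simp
  then show "act_T m j (Tinvs i k F) = Tinvs i k (act_T m j F)"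
    "act_Tinv m j (Tinvs i k F) = Tinvs i k (act_Tinv m j F)" by blast+
qed

text \<open>T_{j+1} commutes with the factors of index below j; the pair with indices j and j + 1
  turns it into T_j by a mixed braid relation; the remaining factors commute with T_j.\<close>

lemma Tinvs_braid:
  assumes "1 \<le> i" "i \<le> j" "Suc j < k" "k \<le> m" "F \<in> laurent_polys m"
  shows "Tinvs i k (act_T m (Suc j) F) = act_T m j (Tinvs i k F)"
  using assms(3,4)
proof (induction k)
  case (Suc k)
  show ?case
  proof (cases "Suc j = k")
    case True
    have j: "1 \<le> j" "Suc j < m" using True Suc.prems assms by auto
    have split: "Tinvs i (Suc k) G = act_Tinv m (Suc j) (act_Tinv m j (Tinvs i j G))" for G
      using assms(2) by (simp flip: True)
    have "Tinvs i j (act_T m (Suc j) F) = act_T m (Suc j) (Tinvs i j F)"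
      using j assms(1,5) by (intro Tinvs_far(1)[symmetric]) auto
    moreover have "Tinvs i j F \<in> laurent_polys m"
      using j assms(1,5) by (intro Tinvs_closed) auto
    ultimately show ?thesis
      unfolding split using Tinv_braid(1)[OF j] by simp
  next
    case False
    then show ?thesis
      using Suc assms by (simp add: T_Tinv_comm Tinvs_closed)
  qed
qed simp

lemma act_Pi_Tinvs:
  assumes "k < m" "F \<in> laurent_polys m"
  shows "act_Pi m (Tinvs 1 k F) = Tinvs 2 (Suc k) (act_Pi m F)"
  using assms(1)
proof (induction k)
  case (Suc k)
  show ?case
  proof (cases "k = 0")
    case False
    then show ?thesis
      using Suc assms by (simp add: act_Pi_Tinv Tinvs_closed)
  qed simp
qed simp

text \<open>The two chains can be interleaved, since the last factor of the inner chain commutes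
  with all but the last factor of the outer one. Each step of k then adds one pair, which raises the
  index by one through the second mixed braid relation.\<close>

lemma Tinvs_Tinvs_T:
  assumes "1 \<le> k" "k < m" "F \<in> laurent_polys m"
  shows "Tinvs 1 k (Tinvs 2 (Suc k) (act_T m 1 F)) = act_T m k (Tinvs 1 k (Tinvs 2 (Suc k) F))"
  using assms(1,2)
proof (induction k rule: dec_induct)
  case (step k)
  have "Tinvs 1 (Suc k) (Tinvs 2 (Suc (Suc k)) G) =
      act_Tinv m k (act_Tinv m (Suc k) (Tinvs 1 k (Tinvs 2 (Suc k) G)))" if "G \<in> laurent_polys m" for G
    using step Tinvs_far(2)[of "Suc k" 1 k "Tinvs 2 (Suc k) G"] that
    by (simp add: foldr_rev_upt_Suc Tinvs_closed del: upt_Suc)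
  then show ?case
    using step assms by (simp add: Tinv_braid(2) Tinvs_closed T_closed del: upt_Suc)
qed simp

section \<open>The operators Y_i: recursion and commutation\<close>

lemma linear_act_Y:
  assumes "1 \<le> i" "i \<le> m"
  shows "linear_on (laurent_polys m) (act_Y m i)"
proof -
  have "linear_on (laurent_polys m) (foldr (act_T m) (rev [1..<i]))"
    "linear_on (laurent_polys m) (Tinvs i m)"
    using assms by (auto intro!: linear_on_foldr linear_act_T linear_act_Tinv)
  then show ?thesis
    unfolding act_Y_def[abs_def] by (rule linear_on_comp[OF _ linear_on_comp[OF linear_act_Pi[OF m]]])
qed

lemma Y_closed: "1 \<le> i \<Longrightarrow> i \<le> m \<Longrightarrow> F \<in> laurent_polys m \<Longrightarrow> act_Y m i F \<in> laurent_polys m"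
  by (rule linear_onD(1)[OF linear_act_Y])

lemma Y_Suc:
  assumes "1 \<le> i" "i < m" "F \<in> laurent_polys m"
  shows "act_Y m (Suc i) F = act_T m i (act_Y m i (act_T m i F))"
  using assms by (simp add: act_Y_def foldr_rev_upt_first[of i m] T_Tinv)

text \<open>With D the chain T_{m-1}^(-1) ... T_2^(-1), the operators are \<Pi> D T_1^(-1) and T_1
  \<Pi> D, so the claim is that T_1 commutes with \<Pi> D \<Pi> D = \<Pi> \<Pi> D' D, where D' is
  the chain with indices lowered by one. Passing D' D turns T_1 into T_{m-1}, and the square of
  \<Pi> turns T_{m-1} back into T_1.\<close>

lemma Y_1_Y_2:
  assumes "2 \<le> m" and F: "F \<in> laurent_polys m"
  shows "act_Y m 1 (act_Y m 2 F) = act_Y m 2 (act_Y m 1 F)"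
proof -
  note simps = T_Tinv T_closed Tinv_closed Tinvs_closed act_Pi_laurent[OF m]
  let ?D = "Tinvs 2 m"
  have PDPD: "act_Pi m (?D (act_Pi m (?D G))) = act_Pi m (act_Pi m (Tinvs 1 (m - 1) (?D G)))"
    if "G \<in> laurent_polys m" for G
    using act_Pi_Tinvs[of "m - 1" "?D G"] assms that by (simp add: Tinvs_closed)
  have Y1: "act_Y m 1 G = act_Pi m (?D (act_Tinv m 1 G))" for G
    using assms foldr_rev_upt_first[of 1 m "act_Tinv m" G] by (simp add: act_Y_def numeral_2_eq_2)
  have Y2: "act_Y m 2 G = act_T m 1 (act_Pi m (?D G))" for G
    by (simp add: act_Y_def numeral_2_eq_2)
  have "act_T m 1 (act_Pi m (?D (act_Pi m (?D G)))) = act_Pi m (?D (act_Pi m (?D (act_T m 1 G))))"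
    if "G \<in> laurent_polys m" for G
    using Tinvs_Tinvs_T[of "m - 1" G] assms that
      act_Pi_Pi_T[of m "Tinvs 1 (m - 1) (?D G)"]
    by (simp add: PDPD simps)
  then have "act_T m 1 (act_Pi m (?D (act_Pi m (?D (act_Tinv m 1 F))))) = act_Pi m (?D (act_Pi m (?D F)))"
    using assms by (simp add: simps)
  then show ?thesis
    using assms unfolding Y1 Y2 by (simp add: simps)
qed

text \<open>Induction on i through \<open>Y_Suc\<close>. For i = 1 the chain of inverses lowers the
  index j by one and \<Pi> raises it again. For j = i - 2 the recursion is unfolded twice and the
  braid relation is used on both sides. Otherwise T_j commutes with T_{i-1} and, by induction, with
  Y_{i-1}.\<close>

lemma T_Y:
  assumes "1 \<le> i" "i \<le> m" "1 \<le> j" "j < m" "j \<noteq> i" "Suc j \<noteq> i" "F \<in> laurent_polys m"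
  shows "act_T m j (act_Y m i F) = act_Y m i (act_T m j F)"
  using assms
proof (induction i arbitrary: j F rule: less_induct)
  case (less i)
  note simps = T_closed Y_closed
  consider "i = 1" | "2 \<le> i" "Suc (Suc j) = i" | "2 \<le> i" "Suc (Suc j) \<noteq> i"
    using less.prems by linarith
  then show ?case
  proof cases
    case 1
    obtain k where k: "j = Suc k" "1 \<le> k" using less.prems 1 by (cases j) auto
    have "act_Y m 1 (act_T m j F) = act_Pi m (act_T m k (Tinvs 1 m F))"
      using Tinvs_braid[of 1 k m F] less.prems k by (simp add: act_Y_def)
    also have "\<dots> = act_T m j (act_Y m 1 F)"
      using act_Pi_T[of k m "Tinvs 1 m F"] less.prems k by (simp add: act_Y_def Tinvs_closed)
    finally show ?thesis using 1 by simp
  next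
    case 2
    have j: "1 \<le> j" "Suc j < m" "j < m" "1 \<le> Suc j" using less.prems 2 by auto
    have Y: "act_Y m i G = act_T m (Suc j) (act_T m j (act_Y m j (act_T m j (act_T m (Suc j) G))))"
      if "G \<in> laurent_polys m" for G
      using Y_Suc[of "Suc j" G] Y_Suc[of j "act_T m (Suc j) G"] j that 2 by (simp add: simps)
    have "act_T m j (act_Y m i F) =
        act_T m (Suc j) (act_T m j (act_T m (Suc j) (act_Y m j (act_T m j (act_T m (Suc j) F)))))"
      using j less.prems by (simp add: Y act_T_braid simps)
    also have "act_T m (Suc j) (act_Y m j (act_T m j (act_T m (Suc j) F))) =
        act_Y m j (act_T m (Suc j) (act_T m j (act_T m (Suc j) F)))"
      using less.IH[of j "Suc j"] j less.prems 2 by (simp add: simps)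
    also have "act_T m (Suc j) (act_T m j (act_T m (Suc j) F)) =
        act_T m j (act_T m (Suc j) (act_T m j F))"
      using j less.prems by (simp add: act_T_braid)
    finally show ?thesis using j less.prems by (simp add: Y simps)
  next
    case 3
    obtain k where k: "i = Suc k" "1 \<le> k" using 3 by (cases i) auto
    have "act_T m j (act_T m k G) = act_T m k (act_T m j G)" if "G \<in> laurent_polys m" for G
      using less.prems 3 k that by (intro T_comm) auto
    then show ?thesis
      using less.IH[of k j] less.prems k 3 by (simp add: Y_Suc simps)
  qed
qed

text \<open>Both indices are lowered by \<open>Y_Suc\<close> until Y_1 and Y_2 remain. The T that is
  split off commutes with the other Y by \<open>T_Y\<close>: T_i with Y_j for j > i + 1, and T_j
  with Y_1 for j > 1.\<close>

lemma Y_comm_less: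
  assumes "1 \<le> i" "i < j" "j \<le> m" "F \<in> laurent_polys m"
  shows "act_Y m i (act_Y m j F) = act_Y m j (act_Y m i F)"
  using assms
proof (induction i arbitrary: j F rule: dec_induct)
  case base
  have "2 \<le> j" using base by simp
  then show ?case using base
  proof (induction j arbitrary: F rule: dec_induct)
    case base
    then show ?case using Y_1_Y_2 by simp
  next
    case (step j)
    then show ?case by (simp add: Y_Suc T_Y[of "Suc 0" j, symmetric] T_closed Y_closed)
  qed
next
  case (step i)
  then show ?case by (simp add: Y_Suc T_Y[of j i] T_closed Y_closed)
qed

lemma Y_comm:
  assumes "i \<in> {1..m}" "j \<in> {1..m}" "F \<in> laurent_polys m"
  shows "act_Y m i (act_Y m j F) = act_Y m j (act_Y m i F)"
  using assms Y_comm_less[of i j F] Y_comm_less[of j i F] by (cases i j rule: linorder_cases) auto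

section \<open>From operators to the classes Y_i and the product of their polynomials\<close>

lemma act_inv_hT:
  assumes i: "1 \<le> i" "i < m" and F: "F \<in> laurent_polys m"
  shows "act m (inv\<^bsub>hecke m\<^esub> (hT m i)) F = act_Tinv m i F"
proof -
  interpret H: ring "hecke m" by (rule ring_hecke)
  note U = hT_Units[OF m i]
  have "act m (inv\<^bsub>hecke m\<^esub> (hT m i)) (act m (hT m i) (act_Tinv m i F)) = act_Tinv m i F"
    using act_mult[OF m H.Units_inv_closed[OF U] hT_carrier[OF m i], of "act_Tinv m i F"]
      H.Units_l_inv[OF U] i F by (simp add: Tinv_closed act_one[OF m])
  then show ?thesis
    using i F by (simp add: act_hT[OF m] Tinv_closed T_Tinv)
qed

lemma hprod_carrier: "set us \<subseteq> carrier (hecke m) \<Longrightarrow> hprod m us \<in> carrier (hecke m)"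
proof -
  interpret H: ring "hecke m" by (rule ring_hecke)
  show "set us \<subseteq> carrier (hecke m) \<Longrightarrow> hprod m us \<in> carrier (hecke m)"
    by (induction us) (simp_all add: hprod_def)
qed

lemma act_hprod:
  assumes "set us \<subseteq> carrier (hecke m)" "F \<in> laurent_polys m"
  shows "act m (hprod m us) F = foldr (act m) us F"
  using assms(1)
proof (induction us)
  case Nil
  then show ?case using assms by (simp add: hprod_def act_one[OF m])
next
  case (Cons u us)
  then have "act m (hprod m (u # us)) F = act m u (act m (hprod m us) F)"
    using act_mult[OF m _ hprod_carrier[of us], of u F] assms by (simp add: hprod_def)
  then show ?case using Cons by simp
qed

lemma hY_factors:
  assumes "i \<in> {1..m}"
  shows "set (hscal m c # map (hT m) (rev [1..<i]) @ hPi m #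
    map (\<lambda>j. inv\<^bsub>hecke m\<^esub> (hT m j)) (rev [i..<m])) \<subseteq> carrier (hecke m)"
proof -
  interpret H: ring "hecke m" by (rule ring_hecke)
  show ?thesis
    using assms by (auto simp: hscal_carrier[OF m] hPi_carrier[OF m] hT_carrier[OF m] hT_Units[OF m])
qed

lemma hY_carrier: "i \<in> {1..m} \<Longrightarrow> hY m i \<in> carrier (hecke m)"
  unfolding hY_def by (rule hprod_carrier) (rule hY_factors)

lemma foldr_cong_on:
  assumes "\<And>x F. x \<in> set xs \<Longrightarrow> F \<in> V \<Longrightarrow> f x F = g x F" "\<And>x F. x \<in> set xs \<Longrightarrow> F \<in> V \<Longrightarrow> g x F \<in> V"
    and "F \<in> V"
  shows "foldr f xs F = foldr g xs F" "foldr g xs F \<in> V"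
  using assms(1,2) by (induction xs) (simp_all add: assms(3))

lemma act_hY:
  assumes i: "i \<in> {1..m}" and F: "F \<in> laurent_polys m"
  shows "act m (hY m i) F = lconst (tt ^ (m - i)) * act_Y m i F"
proof -
  have Tinvs: "foldr (act m) (map (\<lambda>j. inv\<^bsub>hecke m\<^esub> (hT m j)) (rev [i..<m])) F = Tinvs i m F"
    unfolding foldr_map comp_def using i F
    by (intro foldr_cong_on(1)[where V = "laurent_polys m"]) (auto simp: act_inv_hT Tinv_closed)
  have Ts: "foldr (act m) (map (hT m) (rev [1..<i])) G = foldr (act_T m) (rev [1..<i]) G"
    if "G \<in> laurent_polys m" for G
    unfolding foldr_map comp_def using i that
    by (intro foldr_cong_on(1)[where V = "laurent_polys m"]) (auto simp: act_hT[OF m] T_closed)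
  have L: "Tinvs i m F \<in> laurent_polys m" using i F by (intro Tinvs_closed) auto
  then have "act m (hY m i) F = act m (hscal m (tt ^ (m - i))) (act_Y m i F)"
    unfolding hY_def act_hprod[OF hY_factors[OF i] F]
    by (simp add: Tinvs Ts act_hPi[OF m] act_Pi_laurent[OF m] act_Y_def del: map_map One_nat_def)
  then show ?thesis using i F by (simp add: act_hscal[OF m] Y_closed)
qed

lemma hY_comm:
  assumes "i \<in> {1..m}" "j \<in> {1..m}" "F \<in> laurent_polys m"
  shows "act m (hY m i) (act m (hY m j) F) = act m (hY m j) (act m (hY m i) F)"
proof -
  have "act_Y m i F \<in> laurent_polys m" "act_Y m j F \<in> laurent_polys m"
    using assms by (auto intro: Y_closed)
  then show ?thesis
    using assms Y_comm[OF assms] linear_onD(3)[OF linear_act_Y]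
    by (simp add: act_hY mult.left_commute)
qed

lemma Y_polys_carrier: "H \<in> Y_polys m \<Longrightarrow> H \<in> carrier (hecke m)"
proof -
  interpret H: ring "hecke m" by (rule ring_hecke)
  assume "H \<in> Y_polys m"
  then show ?thesis
    unfolding Y_polys_def
    by (induction rule: generate_ring.induct) (auto simp: hscal_carrier[OF m] hY_carrier)
qed

text \<open>Induction on the generation of the ring: commuting with a linear f passes to sums,
  negatives and products, and scalars commute with f by linearity.\<close>

lemma Y_polys_commute_linear:
  assumes H: "H \<in> Y_polys m" and f: "linear_on (laurent_polys m) f"
    and comm: "\<And>i F. i \<in> {1..m} \<Longrightarrow> F \<in> laurent_polys m \<Longrightarrow> act m (hY m i) (f F) = f (act m (hY m i) F)"
    and F: "F \<in> laurent_polys m"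
  shows "act m H (f F) = f (act m H F)"
  using H F unfolding Y_polys_def
proof (induction arbitrary: F rule: generate_ring.induct)
  note L = linear_onD[OF f]
  {
    case one
    then show ?case by (simp add: act_one[OF m] L)
  next
    case (incl h)
    then show ?case using comm by (auto simp: act_hscal[OF m] L)
  next
    case (a_inv h)
    have h: "h \<in> carrier (hecke m)" using a_inv(1) Y_polys_carrier by (simp add: Y_polys_def)
    have "f (- G) = - f G" if "G \<in> laurent_polys m" for G
      using L(3)[OF that, of "- 1"] by (simp add: lconst_minus)
    then show ?case
      using a_inv linear_onD(1)[OF linear_act[OF m h]] by (simp add: act_a_inv[OF m h] L)
  next
    case (eng_add h h')
    have h: "h \<in> carrier (hecke m)" "h' \<in> carrier (hecke m)"
      using eng_add(1,2) Y_polys_carrier by (simp_all add: Y_polys_def)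
    then show ?case
      using eng_add linear_onD(1)[OF linear_act[OF m h(1)]] linear_onD(1)[OF linear_act[OF m h(2)]]
      by (simp add: act_add[OF m] L)
  next
    case (eng_mult h h')
    have h: "h \<in> carrier (hecke m)" "h' \<in> carrier (hecke m)"
      using eng_mult(1,2) Y_polys_carrier by (simp_all add: Y_polys_def)
    then show ?case
      using eng_mult linear_onD(1)[OF linear_act[OF m h(2)]] by (simp add: act_mult[OF m] L)
  }
qed

text \<open>\<open>Y_polys_commute_linear\<close> is used twice, first with the action of a single
  Y_i as f, then with the action of H'. It is the operators, not the classes, that are shown to
  commute; \<open>qmap\<close> depends on a class only through its operator.\<close>

lemma Y_polys_comm:
  assumes "H \<in> Y_polys m" "H' \<in> Y_polys m" "F \<in> laurent_polys m"
  shows "act m H (act m H' F) = act m H' (act m H F)"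
proof -
  have "act m (hY m i) (act m H' F) = act m H' (act m (hY m i) F)"
    if "i \<in> {1..m}" "F \<in> laurent_polys m" for i F
    using Y_polys_commute_linear[OF assms(2) linear_act[OF m hY_carrier[OF that(1)]] _ that(2)]
      hY_comm[OF _ that(1)] by simp
  then show ?thesis
    by (rule Y_polys_commute_linear[OF assms(1) linear_act[OF m Y_polys_carrier[OF assms(2)]] _ assms(3)])
qed

text \<open>Since the \<open>Y\<^sub>i\<close> commute, the product \<open>\<star>\<close> does not depend on the preimages under
  \<open>qmap\<close> picked by \<open>inv_into\<close>, whether or not \<open>qmap\<close> is injective.\<close>

lemma qstar_qmap:
  assumes "H \<in> Y_polys m" "K \<in> Y_polys m"
  shows "qstar m (qmap m H) (qmap m K) = act m H (qmap m K)"
proof -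
  define H' where "H' = inv_into (Y_polys m) (qmap m) (qmap m H)"
  define K' where "K' = inv_into (Y_polys m) (qmap m) (qmap m K)"
  have H': "H' \<in> Y_polys m" "act m H' 1 = qmap m H" and K': "K' \<in> Y_polys m" "act m K' 1 = qmap m K"
    using assms unfolding H'_def K'_def
    by (auto simp: inv_into_into f_inv_into_f simp flip: qmap_def)
  have "qstar m (qmap m H) (qmap m K) = qmap m (H' \<otimes>\<^bsub>hecke m\<^esub> K')"
    by (simp only: qstar_def H'_def K'_def)
  also have "\<dots> = act m H' (act m K' 1)"
    using H'(1) K'(1) by (simp add: qmap_def act_mult[OF m] Y_polys_carrier)
  also have "\<dots> = act m K' (act m H 1)"
    using Y_polys_comm[OF H'(1) K'(1), of 1] H'(2) by (simp add: qmap_def)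
  also have "\<dots> = act m H (qmap m K)"
    using Y_polys_comm[OF K'(1) assms(1), of 1] K'(2) by simp
  finally show ?thesis .
qed

end

subsection \<open>Elementary symmetric polynomials\<close>

abbreviation XS :: "nat set \<Rightarrow> lpoly" where
  "XS S \<equiv> \<Prod>i\<in>S. X i"

abbreviation subsets :: "nat \<Rightarrow> nat \<Rightarrow> nat set set" where
  "subsets m r \<equiv> {S. S \<subseteq> {1..m} \<and> card S = r}"

text \<open>As i runs through S in increasing order, the number of elements below i runs through 0,
  ..., |S| - 1. Adjoining a new largest element leaves the earlier counts unchanged.\<close>

lemma sum_power_card_below:
  fixes t :: "'a :: comm_semiring_1" and S :: "nat set"
  assumes "finite S"
  shows "(\<Sum>i\<in>S. t ^ card (S \<inter> {..<i})) = (\<Sum>k<card S. t ^ k)"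
  using assms
proof (induction S rule: finite_linorder_max_induct)
  case (insert b S)
  have "insert b S \<inter> {..<i} = S \<inter> {..<i}" if "i \<in> S" for i
    using insert.hyps(2) that by force
  moreover have "insert b S \<inter> {..<b} = S" using insert.hyps(2) by auto
  ultimately have "(\<Sum>i\<in>insert b S. t ^ card (insert b S \<inter> {..<i})) =
      t ^ card S + (\<Sum>i\<in>S. t ^ card (S \<inter> {..<i}))"
    using insert.hyps by (subst sum.insert) auto
  then show ?case using insert by (subst card_insert_disjoint) (auto simp: add.commute)
qed simp

lemma tint_eq_sum: "[n]\<^sub>t = (\<Sum>k<n. tt ^ k)"
  using sum_gp_strict[of tt n] by (simp add: tint_def)

lemma elem_sym_1: "elem_sym m 1 = (\<Sum>i\<in>{1..m}. X i)"
proof -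
  have "subsets m 1 = (\<lambda>i. {i}) ` {1..m}"
    by (auto simp: card_1_singleton_iff)
  then show ?thesis
    by (simp add: elem_sym_def sum.reindex del: One_nat_def)
qed

lemma sum_subsets_reindex:
  assumes "bij_betw c {1..m} {1..m}"
  shows "(\<Sum>S\<in>subsets m r. f (c ` S)) = (\<Sum>S\<in>subsets m r. f S)"
proof -
  have inj: "inj_on c {1..m}" and img: "c ` {1..m} = {1..m}"
    using assms by (auto simp: bij_betw_def)
  have "inj_on (image c) (subsets m r)"
    using inj by (intro inj_onI) (simp add: inj_on_image_eq_iff)
  moreover have "image c ` subsets m r = subsets m r"
  proof (rule card_subset_eq)
    show "finite (subsets m r)" by simp
    show "image c ` subsets m r \<subseteq> subsets m r"
    proof safe
      fix S x assume S: "S \<subseteq> {1..m}" 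
      show "c x \<in> {1..m}" if "x \<in> S" using S img that by blast
      show "card (c ` S) = card S" using inj S by (intro card_image) (rule inj_on_subset)
    qed
    show "card (image c ` subsets m r) = card (subsets m r)"
      by (rule card_image) fact
  qed
  ultimately show ?thesis
    using sum.reindex[of "image c" "subsets m r" f] by simp
qed

lemma bij_transpose: "1 \<le> i \<Longrightarrow> i < m \<Longrightarrow> bij_betw (transpose i (Suc i)) {1..m} {1..m}"
  by (rule bij_betw_byWitness[where f' = "transpose i (Suc i)"]) (auto simp: transpose_def)

lemma hs_XS:
  assumes i: "1 \<le> i" "i < m" and S: "S \<subseteq> {1..m}"
  shows "hs m i (XS S) = XS (transpose i (Suc i) ` S)"
proof -
  have "hs m i (XS S) = (\<Prod>j\<in>S. hs m i (X j))"
    by (simp add: hs_pos[OF i(1)] lsubst_prod)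
  also have "\<dots> = (\<Prod>j\<in>S. X (transpose i (Suc i) j))"
    using S i by (intro prod.cong refl hs_X) auto
  also have "\<dots> = XS (transpose i (Suc i) ` S)"
    by (simp add: prod.reindex)
  finally show ?thesis .
qed

lemma XS_laurent: "S \<subseteq> {1..m} \<Longrightarrow> XS S \<in> laurent_polys m"
  by (rule laurent_prod) auto

lemma elem_sym_laurent: "elem_sym m r \<in> laurent_polys m"
  unfolding elem_sym_def by (rule laurent_sum) (auto intro: XS_laurent simp del: One_nat_def)

lemma hs_elem_sym:
  assumes i: "1 \<le> i" "i < m"
  shows "hs m i (elem_sym m r) = elem_sym m r"
proof -
  have "hs m i (elem_sym m r) = (\<Sum>S\<in>subsets m r. hs m i (XS S))"
    by (simp add: elem_sym_def hs_pos[OF i(1)] lsubst_sum)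
  also have "\<dots> = (\<Sum>S\<in>subsets m r. XS (transpose i (Suc i) ` S))"
    by (intro sum.cong refl hs_XS[OF i]) auto
  also have "\<dots> = elem_sym m r"
    unfolding elem_sym_def by (rule sum_subsets_reindex[OF bij_transpose[OF i]])
  finally show ?thesis .
qed

text \<open>\<open>weighted_elem m r i\<close> is what \<open>T\<^bsub>i-1\<^esub> \<dots> T\<^sub>1\<close> makes of the sum of the square-free monomials of
  degree \<open>r + 1\<close> divisible by \<open>X\<^sub>1\<close>.\<close>

definition weighted_elem :: "nat \<Rightarrow> nat \<Rightarrow> nat \<Rightarrow> lpoly" where
  "weighted_elem m r i =
     (\<Sum>S\<in>subsets m (Suc r). if i \<in> S then lconst (tt ^ card (S \<inter> {..<i})) * XS S else 0)"

lemma sum_weighted_elem: "(\<Sum>i\<in>{1..m}. weighted_elem m r i) = lconst [Suc r]\<^sub>t * elem_sym m (Suc r)"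
proof -
  have "(\<Sum>i\<in>{1..m}. weighted_elem m r i) = (\<Sum>S\<in>subsets m (Suc r). \<Sum>i\<in>{1..m}.
      if i \<in> S then lconst (tt ^ card (S \<inter> {..<i})) * XS S else 0)"
    unfolding weighted_elem_def by (rule sum.swap)
  also have "\<dots> = (\<Sum>S\<in>subsets m (Suc r). lconst [Suc r]\<^sub>t * XS S)"
  proof (rule sum.cong[OF refl])
    fix S assume S: "S \<in> subsets m (Suc r)"
    have "(\<Sum>i\<in>{1..m}. if i \<in> S then lconst (tt ^ card (S \<inter> {..<i})) * XS S else 0) =
        (\<Sum>i\<in>S. lconst (tt ^ card (S \<inter> {..<i})) * XS S)"
      using S by (intro sum.mono_neutral_cong_right) auto
    also have "\<dots> = lconst (\<Sum>i\<in>S. tt ^ card (S \<inter> {..<i})) * XS S"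
      by (simp add: lconst_sum sum_distrib_right)
    also have "(\<Sum>i\<in>S. tt ^ card (S \<inter> {..<i})) = [Suc r]\<^sub>t"
    proof -
      have "finite S" "card S = Suc r" using S finite_index_set by blast+
      then show ?thesis by (simp only: sum_power_card_below tint_eq_sum)
    qed
    finally show "(\<Sum>i\<in>{1..m}. if i \<in> S then lconst (tt ^ card (S \<inter> {..<i})) * XS S else 0) =
        lconst [Suc r]\<^sub>t * XS S" .
  qed
  finally show ?thesis by (simp add: elem_sym_def sum_distrib_left)
qed

section \<open>Action of T_i and Y_i on invariants and square-free monomials\<close>

context
  fixes m :: nat
  assumes m: "1 \<le> m"
begin

text \<open>The cleared equation is linear over the s_i-invariants. This confines computations on
  monomials to the factor in X_i and X_{i+1}.\<close>

lemma T_sym_mult: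
  assumes i: "1 \<le> i" "i < m" and G: "G \<in> laurent_polys m" "hs m i G = G" and F: "F \<in> laurent_polys m"
  shows "act_T m i (G * F) = G * act_T m i F"
proof (rule act_T_eqI[OF i])
  show "(X (Suc i) - X i) * (G * act_T m i F) = (lconst tt - 1) * X (Suc i) * (G * F) +
      (X (Suc i) - lconst tt * X i) * hs m i (G * F)"
    unfolding hs_mult[OF i(1)] G(2) using act_T_mult(2)[OF i F] by Groebner_Basis.algebra
qed (use G F in simp)

lemma T_sym:
  assumes i: "1 \<le> i" "i < m" and G: "G \<in> laurent_polys m" "hs m i G = G"
  shows "act_T m i G = lconst tt * G"
  by (rule act_T_eqI[OF i G(1)]) (unfold G(2), Groebner_Basis.algebra)

lemma T_X:
  assumes i: "1 \<le> i" "i < m"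
  shows "act_T m i (X i) = X (Suc i)"
proof (rule act_T_eqI[OF i])
  have "hs m i (X i) = X (Suc i)" using i by (simp add: hs_X)
  then show "(X (Suc i) - X i) * X (Suc i) = (lconst tt - 1) * X (Suc i) * X i +
      (X (Suc i) - lconst tt * X i) * hs m i (X i)"
    by (simp add: algebra_simps)
qed (use i in simp)

text \<open>If S contains both or neither of i and i + 1, the monomial is s_i-invariant and T_i acts
  by t. If it contains only i, the invariant part splits off and T_i X_i = X_{i+1} applies. The
  excluded case, only i + 1 in S, produces two monomials.\<close>

lemma T_XS:
  assumes i: "1 \<le> i" "i < m" and S: "S \<subseteq> {1..m}" and "i \<in> S \<or> Suc i \<notin> S"
  shows "act_T m i (XS S) = lconst (if i \<in> S \<longrightarrow> Suc i \<in> S then tt else 1) * XS (transpose i (Suc i) ` S)"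
proof (cases "i \<in> S \<longrightarrow> Suc i \<in> S")
  case True
  then have "i \<in> S \<longleftrightarrow> Suc i \<in> S" using assms by blast
  then have "transpose i (Suc i) ` S = S"
    by (rule transpose_image_eq)
  then show ?thesis
    using True hs_XS[OF i S] T_sym[OF i XS_laurent[OF S]] by simp
next
  case False
  define R where "R = S - {i}"
  have R: "S = insert i R" "i \<notin> R" "Suc i \<notin> R" "R \<subseteq> {1..m}" "finite R"
    using False S finite_index_set[OF S] by (auto simp: R_def)
  have tR: "transpose i (Suc i) ` R = R"
    using R by (intro transpose_image_eq) blast
  then have "act_T m i (XS R * X i) = XS R * X (Suc i)"
    using T_sym_mult[OF i XS_laurent[OF R(4)] _ laurent_X] hs_XS[OF i R(4)] T_X[OF i] i by simp
  moreover have "XS S = XS R * X i" using R by (simp add: mult.commute)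
  moreover have "XS (transpose i (Suc i) ` S) = XS R * X (Suc i)"
    using R tR by (simp add: mult.commute)
  ultimately show ?thesis using False by simp
qed

lemma Tinv_sym:
  assumes i: "1 \<le> i" "i < m" and G: "G \<in> laurent_polys m" "hs m i G = G"
  shows "act_Tinv m i G = lconst (inverse tt) * G"
proof -
  have "G = lconst (inverse tt) * act_T m i G"
    using T_sym[OF i G] by (simp flip: mult.assoc)
  then have "act_Tinv m i G = act_Tinv m i (lconst (inverse tt) * act_T m i G)" by simp
  also have "\<dots> = lconst (inverse tt) * G"
    using linear_onD(3)[OF linear_act_Tinv[OF m i]] T_closed[OF m i G(1)] T_Tinv(2)[OF m i G(1)]
    by simp
  finally show ?thesis .
qed

lemma Tinv_XS_neither:
  assumes i: "1 \<le> i" "i < m" and S: "S \<subseteq> {1..m}" "i \<notin> S" "Suc i \<notin> S"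
  shows "act_Tinv m i (XS S) = lconst (inverse tt) * XS S"
proof -
  have "transpose i (Suc i) ` S = S"
    using S by (intro transpose_image_eq) blast
  then show ?thesis
    using Tinv_sym[OF i XS_laurent[OF S(1)]] hs_XS[OF i S(1)] by simp
qed

text \<open>This inverts the case of \<open>T_XS\<close> in which the set contains i but not i +
  1.\<close>

lemma Tinv_XS_move:
  assumes i: "1 \<le> i" "i < m" and S: "S \<subseteq> {1..m}" "i \<notin> S" "Suc i \<in> S"
  shows "act_Tinv m i (XS S) = XS (insert i (S - {Suc i}))"
proof -
  let ?R = "insert i (S - {Suc i})"
  have R: "?R \<subseteq> {1..m}" "transpose i (Suc i) ` ?R = S"
    using i S by (auto simp: transpose_def image_iff)
  then have "act_T m i (XS ?R) = XS S"
    using T_XS[OF i R(1)] by simp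
  then show ?thesis
    using T_Tinv(2)[OF m i XS_laurent[OF R(1)]] by simp
qed

lemma Ts_sym_mult:
  assumes i: "1 \<le> i" "i \<le> m" and G: "G \<in> laurent_polys m" "\<And>j. 1 \<le> j \<Longrightarrow> j < i \<Longrightarrow> hs m j G = G"
  shows "foldr (act_T m) (rev [1..<i]) (G * X 1) = G * X i"
  using i G(2)
proof (induction i rule: dec_induct)
  case (step j)
  then have "act_T m j (G * X j) = G * act_T m j (X j)"
    by (intro T_sym_mult) (auto simp: G)
  then show ?case
    using step by (simp add: T_X)
qed simp

text \<open>Each T_j^(-1) contributes t^(-1). The scalar t^(k-i), for k = m the normalisation of
  Y_i, compensates these factors exactly.\<close>

lemma Tinvs_sym:
  assumes i: "1 \<le> i" "i \<le> k" "k \<le> m"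
    and G: "G \<in> laurent_polys m" "\<And>j. i \<le> j \<Longrightarrow> j < k \<Longrightarrow> hs m j G = G"
  shows "lconst (tt ^ (k - i)) * foldr (act_Tinv m) (rev [i..<k]) G = G"
  using i(2,3) G(2)
proof (induction k rule: dec_induct)
  case (step k)
  let ?F = "foldr (act_Tinv m) (rev [i..<k]) G"
  have k: "1 \<le> k" "k < m" using step i by auto
  have F: "?F \<in> laurent_polys m"
    using k i G(1) by (intro Tinvs_closed[OF m]) auto
  have "lconst (tt ^ (Suc k - i)) * act_Tinv m k ?F =
      lconst tt * act_Tinv m k (lconst (tt ^ (k - i)) * ?F)"
    using step(1) linear_onD(3)[OF linear_act_Tinv[OF m k] F]
    by (simp add: Suc_diff_le lconst_mult mult.assoc)
  also have "\<dots> = G"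
    using step Tinv_sym[OF k G(1)] by (simp flip: mult.assoc)
  finally show ?case using step(1) by simp
qed simp

lemma act_hY_eq:
  assumes i: "i \<in> {1..m}" and F: "F \<in> laurent_polys m"
  shows "act m (hY m i) F = foldr (act_T m) (rev [1..<i])
    (act_Pi m (lconst (tt ^ (m - i)) * foldr (act_Tinv m) (rev [i..<m]) F))"
proof -
  have "foldr (act_Tinv m) (rev [i..<m]) F \<in> laurent_polys m"
    using i F by (intro Tinvs_closed[OF m]) auto
  moreover have "linear_on (laurent_polys m) (foldr (act_T m) (rev [1..<i]))"
    using i by (auto intro!: linear_on_foldr linear_act_T)
  ultimately show ?thesis
    using act_hY[OF m i F] linear_onD(3)[OF linear_act_Pi[OF m]] act_Pi_laurent[OF m]
    by (simp add: act_Y_def linear_onD(3) del: One_nat_def)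
qed

text \<open>T_j^(-1) moves X_{j+1} to X_j without a scalar if j + 1 is in S, and acts by t^(-1)
  otherwise. Hence t^(k-i) leaves one factor t for each element of S up to k.\<close>

lemma Tinvs_XS:
  assumes i: "1 \<le> i" "i \<le> k" "k \<le> m" and S: "S \<subseteq> {Suc i..m}"
  shows "lconst (tt ^ (k - i)) * foldr (act_Tinv m) (rev [i..<k]) (XS S) =
    lconst (tt ^ card (S \<inter> {..k})) * XS ({j. i \<le> j \<and> j < k \<and> Suc j \<in> S} \<union> {j \<in> S. k < j})"
  using i(2,3)
proof (induction k rule: dec_induct)
  case base
  have "S \<inter> {..i} = {}" "{j. i \<le> j \<and> j < i \<and> Suc j \<in> S} \<union> {j \<in> S. i < j} = S"
    using S by auto
  then show ?case by simp
next
  case (step k)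
  let ?F = "foldr (act_Tinv m) (rev [i..<k]) (XS S)"
  \<comment> \<open>The indices present after the factors below k have acted: elements of S up to k
    have been lowered by one, those above k are untouched. In particular k itself is vacant.\<close>
  let ?D = "\<lambda>k. {j. i \<le> j \<and> j < k \<and> Suc j \<in> S} \<union> {j \<in> S. k < j}"
  have k: "1 \<le> k" "k < m" using step i by auto
  note L = linear_onD(3)[OF linear_act_Tinv[OF m k]]
  have S': "S \<subseteq> {1..m}" using S i by auto
  have F: "?F \<in> laurent_polys m"
    using k i S' by (intro Tinvs_closed[OF m] XS_laurent) auto
  have D: "?D k \<subseteq> {1..m}" "k \<notin> ?D k" using S' k i by auto
  have "lconst (tt ^ (Suc k - i)) * act_Tinv m k ?F =
      lconst tt * act_Tinv m k (lconst (tt ^ (k - i)) * ?F)"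
    using step(1) L[OF F] by (simp add: Suc_diff_le lconst_mult mult.assoc)
  also have "\<dots> = lconst (tt ^ card (S \<inter> {..k})) * (lconst tt * act_Tinv m k (XS (?D k)))"
    using step L[OF XS_laurent[OF D(1)]] by (simp add: mult.left_commute)
  also have "\<dots> = lconst (tt ^ card (S \<inter> {..Suc k})) * XS (?D (Suc k))"
  proof (cases "Suc k \<in> S")
    case True
    then have "Suc k \<in> ?D k" by simp
    moreover have "insert k (?D k - {Suc k}) = ?D (Suc k)"
      using True step(1) by (auto simp: less_Suc_eq)
    ultimately have "act_Tinv m k (XS (?D k)) = XS (?D (Suc k))"
      using Tinv_XS_move[OF k D] by simp
    moreover have "S \<inter> {..Suc k} = insert (Suc k) (S \<inter> {..k})"
      using True by (auto simp: le_Suc_eq)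
    moreover have "finite (S \<inter> {..k})" "Suc k \<notin> S \<inter> {..k}" by auto
    ultimately show ?thesis
      by (simp add: lconst_mult mult_ac)
  next
    case False
    have "k < j \<longleftrightarrow> Suc k < j" if "j \<in> S" for j
      using False that by (cases "j = Suc k") auto
    then have "?D (Suc k) = ?D k" "S \<inter> {..Suc k} = S \<inter> {..k}"
      using False by (auto simp: less_Suc_eq le_Suc_eq)
    moreover have "Suc k \<notin> ?D k" using False by simp
    ultimately show ?thesis
      using Tinv_XS_neither[OF k D] by (simp flip: mult.assoc)
  qed
  finally show ?case using step(1) by simp
qed

lemma act_Pi_XS:
  assumes "D \<subseteq> {1..<m}"
  shows "act_Pi m (XS D) = X 1 * XS (Suc ` D)"
proof -
  have "lshift m (XS D) = (\<Prod>j\<in>D. X (Suc j))"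
    unfolding lsubst_prod using assms by (intro prod.cong refl lshift_X) auto
  then show ?thesis
    by (simp add: act_Pi_def prod.reindex)
qed

text \<open>The chain of inverses lowers every element of S by one, \<Pi> raises it again and
  creates X_1, and T_{i-1} ... T_1 carries X_1 to X_i. These last operators involve only indices up
  to i, so XS S is invariant under the transpositions that occur.\<close>

lemma act_hY_XS:
  assumes i: "i \<in> {1..m}" and S: "S \<subseteq> {Suc i..m}"
  shows "act m (hY m i) (XS S) = lconst (tt ^ card S) * XS (insert i S)"
proof -
  have S': "S \<subseteq> {1..m}" "finite S" "i \<notin> S" using i S finite_subset[OF S] by auto
  let ?D = "{j. i \<le> j \<and> j < m \<and> Suc j \<in> S}"
  have D: "Suc ` ?D = S" using S by (auto simp: image_iff) (metis Suc_le_D Suc_le_mono atLeastAtMost_iff less_eq_Suc_le subsetD)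
  have "S \<inter> {..m} = S" "?D \<union> {j \<in> S. m < j} = ?D" using S by auto
  then have "act m (hY m i) (XS S) = foldr (act_T m) (rev [1..<i])
      (act_Pi m (lconst (tt ^ card S) * XS ?D))"
    using act_hY_eq[OF i XS_laurent[OF S'(1)]] Tinvs_XS[of i m S] i S by simp
  also have "act_Pi m (lconst (tt ^ card S) * XS ?D) = lconst (tt ^ card S) * (X 1 * XS (Suc ` ?D))"
  proof -
    have D: "?D \<subseteq> {1..<m}" using i by auto
    then have "XS ?D \<in> laurent_polys m" by (intro XS_laurent) auto
    then show ?thesis
      using linear_onD(3)[OF linear_act_Pi[OF m]] act_Pi_XS[OF D] by simp
  qed
  also have "\<dots> = (lconst (tt ^ card S) * XS S) * X 1" by (simp add: D mult_ac)
  also have "foldr (act_T m) (rev [1..<i]) \<dots> = (lconst (tt ^ card S) * XS S) * X i"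
  proof (rule Ts_sym_mult)
    fix j assume j: "1 \<le> j" "j < i"
    have "j \<notin> S" "Suc j \<notin> S" using j S by auto
    then have "transpose j (Suc j) ` S = S"
      by (intro transpose_image_eq) blast
    then show "hs m j (lconst (tt ^ card S) * XS S) = lconst (tt ^ card S) * XS S"
      using j i hs_XS[of j m S] S' by (simp add: hs_mult hs_lconst)
  qed (use i S' in \<open>auto intro: laurent_mult XS_laurent simp del: One_nat_def\<close>)
  finally show ?thesis using S' by (simp add: mult_ac)
qed

section \<open>Square-free monomials and elementary symmetric polynomials in the image of
  \<open>qmap\<close>\<close>

lemma Y_polys_sum:
  assumes "finite A" "\<And>a. a \<in> A \<Longrightarrow> H a \<in> Y_polys m"
  shows "\<exists>K\<in>Y_polys m. \<forall>F\<in>laurent_polys m. act m K F = (\<Sum>a\<in>A. act m (H a) F)"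
  using assms
proof (induction A rule: finite_induct)
  case empty
  have "hscal m 0 \<in> Y_polys m"
    unfolding Y_polys_def by (rule generate_ring.incl) simp
  then show ?case by (auto simp: act_hscal[OF m] intro!: bexI[of _ "hscal m 0"])
next
  case (insert a A)
  then obtain K where K: "K \<in> Y_polys m" "\<forall>F\<in>laurent_polys m. act m K F = (\<Sum>a\<in>A. act m (H a) F)"
    by auto
  have "H a \<oplus>\<^bsub>hecke m\<^esub> K \<in> Y_polys m"
    using insert.prems K(1) unfolding Y_polys_def by (intro generate_ring.eng_add) auto
  moreover have "act m (H a \<oplus>\<^bsub>hecke m\<^esub> K) F = (\<Sum>a\<in>insert a A. act m (H a) F)"
    if "F \<in> laurent_polys m" for F
    using insert K that by (simp add: act_add[OF m] Y_polys_carrier[OF m])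
  ultimately show ?case by blast
qed

lemma hY_in_Y_polys: "i \<in> {1..m} \<Longrightarrow> hY m i \<in> Y_polys m"
  unfolding Y_polys_def by (rule generate_ring.incl) simp

text \<open>The indices are adjoined in decreasing order, so that each new i lies below S and
  \<open>act_hY_XS\<close> applies; the power of t arising there is divided out by a scalar.\<close>

lemma XS_in_image:
  assumes "S \<subseteq> {1..m}"
  shows "\<exists>H\<in>Y_polys m. qmap m H = XS S"
  using finite_index_set[OF assms] assms
proof (induction S rule: finite_linorder_min_induct)
  case empty
  have "\<one>\<^bsub>hecke m\<^esub> \<in> Y_polys m"
    unfolding Y_polys_def by (rule generate_ring.one)
  then show ?case by (intro bexI[of _ "\<one>\<^bsub>hecke m\<^esub>"]) (simp_all add: qmap_def act_one[OF m])
next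
  case (insert i S)
  obtain H where H: "H \<in> Y_polys m" "qmap m H = XS S" using insert by auto
  have i: "i \<in> {1..m}" and S: "S \<subseteq> {Suc i..m}" using insert by (auto simp: Suc_le_eq)
  let ?c = "hscal m (inverse (tt ^ card S))"
  have c: "?c \<in> Y_polys m"
    unfolding Y_polys_def by (rule generate_ring.incl) simp
  have YH: "hY m i \<otimes>\<^bsub>hecke m\<^esub> H \<in> Y_polys m"
    using H(1) hY_in_Y_polys[OF i] unfolding Y_polys_def by (rule generate_ring.eng_mult[rotated])
  then have "?c \<otimes>\<^bsub>hecke m\<^esub> (hY m i \<otimes>\<^bsub>hecke m\<^esub> H) \<in> Y_polys m"
    using c unfolding Y_polys_def by (rule generate_ring.eng_mult[rotated])
  moreover have "qmap m (?c \<otimes>\<^bsub>hecke m\<^esub> (hY m i \<otimes>\<^bsub>hecke m\<^esub> H)) = XS (insert i S)"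
  proof -
    have "XS S \<in> laurent_polys m" using i S by (intro XS_laurent) auto
    then have "act m (hY m i) (XS S) \<in> laurent_polys m"
      by (rule linear_onD(1)[OF linear_act[OF m hY_carrier[OF m i]]])
    then have "qmap m (?c \<otimes>\<^bsub>hecke m\<^esub> (hY m i \<otimes>\<^bsub>hecke m\<^esub> H)) =
        lconst (inverse (tt ^ card S)) * act m (hY m i) (XS S)"
      using YH c H hY_in_Y_polys[OF i]
      by (simp add: qmap_def act_mult[OF m] act_hscal[OF m] Y_polys_carrier[OF m])
    also have "\<dots> = (lconst (inverse (tt ^ card S)) * lconst (tt ^ card S)) * XS (insert i S)"
      by (simp only: act_hY_XS[OF i S] mult.assoc)
    finally show ?thesis by (simp only: lconst_inverse_cancel power_not_zero tt_nonzero
          not_False_eq_True mult_1 simp_thms)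
  qed
  ultimately show ?case by blast
qed

lemma elem_sym_in_image: "\<exists>H\<in>Y_polys m. qmap m H = elem_sym m r"
proof -
  obtain H where H: "\<And>S. S \<subseteq> {1..m} \<Longrightarrow> H S \<in> Y_polys m \<and> qmap m (H S) = XS S"
    using XS_in_image by metis
  obtain K where K: "K \<in> Y_polys m"
    "\<forall>F\<in>laurent_polys m. act m K F = (\<Sum>S\<in>subsets m r. act m (H S) F)"
    using Y_polys_sum[of "subsets m r" H] H by auto
  have "qmap m K = (\<Sum>S\<in>subsets m r. qmap m (H S))"
    using K(2) by (simp add: qmap_def)
  also have "\<dots> = elem_sym m r"
    unfolding elem_sym_def using H by (intro sum.cong) auto
  finally show ?thesis using K(1) by blast
qed

section \<open>Action of Y_i on elementary symmetric polynomials\<close>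

lemma lshift_elem_sym:
  "lshift m (elem_sym m r) =
    lconst (inverse qq) * elem_sym m r +
    lconst (1 - inverse qq) * (\<Sum>S\<in>subsets m r. if 1 \<in> S then 0 else XS S)"
proof -
  \<comment> \<open>The cyclic permutation of the indices underlying the shift. Only X_m picks up
    q^(-1), and m in S means 1 in c(S); reindexing by c thus puts q^(-1) on exactly the monomials
    that contain X_1.\<close>
  define c where "c j = (if j = m then 1 else Suc j)" for j
  have c: "bij_betw c {1..m} {1..m}"
    by (rule bij_betw_byWitness[where f' = "\<lambda>j. if j = 1 then m else j - 1"])
       (use m in \<open>auto simp: c_def\<close>)
  have shift: "lshift m (XS S) = lconst (if 1 \<in> c ` S then inverse qq else 1) * XS (c ` S)"
    if "S \<subseteq> {1..m}" for S
  proof -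
    have "lshift m (XS S) = (\<Prod>j\<in>S. lconst (if j = m then inverse qq else 1) * X (c j))"
      unfolding lsubst_prod using that lshift_X_last[OF m]
      by (intro prod.cong) (auto simp: c_def lshift_X)
    also have "\<dots> = (\<Prod>j\<in>S. lconst (if j = m then inverse qq else 1)) * XS (c ` S)"
      using c that by (simp add: prod.distrib prod.reindex inj_on_subset[OF bij_betw_imp_inj_on])
    also have "(\<Prod>j\<in>S. lconst (if j = m then inverse qq else 1)) =
        (\<Prod>j\<in>S. if j = m then lconst (inverse qq) else 1)"
      by (intro prod.cong) auto
    also have "\<dots> = lconst (if m \<in> S then inverse qq else 1)"
      using finite_index_set[OF that] by simp
    also have "m \<in> S \<longleftrightarrow> 1 \<in> c ` S"
      using that by (force simp: c_def)
    finally show ?thesis .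
  qed
  have "lshift m (elem_sym m r) = (\<Sum>S\<in>subsets m r. lshift m (XS S))"
    by (simp add: elem_sym_def lsubst_sum)
  also have "\<dots> = (\<Sum>S\<in>subsets m r. lconst (if 1 \<in> c ` S then inverse qq else 1) * XS (c ` S))"
    by (intro sum.cong refl shift) auto
  also have "\<dots> = (\<Sum>S\<in>subsets m r. lconst (if 1 \<in> S then inverse qq else 1) * XS S)"
    by (rule sum_subsets_reindex[OF c])
  \<comment> \<open>The coefficient is split as q^(-1) for every S, plus 1 - q^(-1) for those S
    without 1.\<close>
  also have "\<dots> = (\<Sum>S\<in>subsets m r. lconst (inverse qq) * XS S +
      lconst (1 - inverse qq) * (if 1 \<in> S then 0 else XS S))"
    by (intro sum.cong refl) (simp add: lconst_diff algebra_simps)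
  finally show ?thesis
    by (simp add: elem_sym_def sum.distrib sum_distrib_left)
qed

lemma weighted_elem_1:
  "weighted_elem m r 1 = X 1 * (\<Sum>S\<in>subsets m r. if 1 \<in> S then 0 else XS S)"
proof -
  have "weighted_elem m r 1 = (\<Sum>S\<in>{S \<in> subsets m (Suc r). 1 \<in> S}. XS S)"
    unfolding weighted_elem_def
  proof (rule sum.mono_neutral_cong_right)
    fix S assume "S \<in> {S \<in> subsets m (Suc r). 1 \<in> S}"
    then have "1 \<in> S" "S \<inter> {..<1} = {}" by auto
    then show "(if 1 \<in> S then lconst (tt ^ card (S \<inter> {..<1})) * XS S else 0) = XS S"
      by simp
  qed auto
  also have "\<dots> = (\<Sum>S\<in>{S \<in> subsets m r. 1 \<notin> S}. X 1 * XS S)"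
  proof (rule sum.reindex_bij_witness[of _ "insert 1" "\<lambda>S. S - {1}"])
    fix S assume S: "S \<in> {S \<in> subsets m (Suc r). 1 \<in> S}"
    then show "insert 1 (S - {1}) = S" by auto
    have "finite S" using S by (auto intro: finite_index_set simp del: One_nat_def)
    then show "S - {1} \<in> {S \<in> subsets m r. 1 \<notin> S}" "X 1 * XS (S - {1}) = XS S"
      using S by (auto simp: prod.remove[of S 1])
  next
    fix S assume S: "S \<in> {S \<in> subsets m r. 1 \<notin> S}"
    then show "insert 1 S - {1} = S" by auto
    have "finite S" using S by (auto intro: finite_index_set simp del: One_nat_def)
    then show "insert 1 S \<in> {S \<in> subsets m (Suc r). 1 \<in> S}"
      using S m by auto
  qed
  also have "\<dots> = X 1 * (\<Sum>S\<in>subsets m r. if 1 \<in> S then 0 else XS S)"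
    unfolding sum_distrib_left by (rule sum.mono_neutral_cong_left) auto
  finally show ?thesis .
qed

lemma act_Pi_elem_sym:
  "act_Pi m (elem_sym m r) =
    lconst (inverse qq) * (elem_sym m r * X 1) + lconst (1 - inverse qq) * weighted_elem m r 1"
  unfolding act_Pi_def lshift_elem_sym weighted_elem_1 by Groebner_Basis.algebra

lemma weighted_elem_laurent: "weighted_elem m r i \<in> laurent_polys m"
  unfolding weighted_elem_def
  by (rule laurent_sum) (auto intro!: laurent_mult XS_laurent split: if_splits)

text \<open>The identity holds term by term after reindexing by s_i. If S contains i and i + 1, T_i
  gives a factor t; if it contains only i, T_i moves the monomial to that of s_i(S) without a
  scalar. The weight changes in the same way.\<close>

lemma T_weighted_elem:
  assumes i: "1 \<le> i" "i < m"
  shows "act_T m i (weighted_elem m r i) = weighted_elem m r (Suc i)"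
proof -
  note lin = linear_act_T[OF i]
  let ?s = "transpose i (Suc i)"
  let ?w = "\<lambda>i S. if i \<in> S then lconst (tt ^ card (S \<inter> {..<i})) * XS S else 0"
  have T0: "act_T m i 0 = 0"
    using linear_onD(3)[OF lin laurent_0, of 0] by simp
  have "act_T m i (weighted_elem m r i) = (\<Sum>S\<in>subsets m (Suc r). act_T m i (?w i S))"
    unfolding weighted_elem_def
    by (rule linear_on_sum[OF lin]) (auto intro!: laurent_mult XS_laurent)
  also have "\<dots> = (\<Sum>S\<in>subsets m (Suc r). ?w (Suc i) (?s ` S))"
  proof (rule sum.cong[OF refl])
    fix S assume "S \<in> subsets m (Suc r)"
    then have S: "S \<subseteq> {1..m}" "finite S" by (auto intro: finite_index_set simp del: One_nat_def)
    have mem: "Suc i \<in> ?s ` S \<longleftrightarrow> i \<in> S"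
      by (metis image_eqI imageE transpose_apply_first transpose_apply_second transpose_involutory)
    show "act_T m i (?w i S) = ?w (Suc i) (?s ` S)"
    proof (cases "i \<in> S")
      case True
      \<comment> \<open>The transposed set has one more element below i + 1 than S has below i
        exactly when i + 1 is in S.\<close>
      have "?s ` S \<inter> {..<Suc i} = (if Suc i \<in> S then insert i (S \<inter> {..<i}) else S \<inter> {..<i})"
        using True by (auto simp: transpose_def image_iff split: if_splits)
      then have "card (?s ` S \<inter> {..<Suc i}) =
          (if Suc i \<in> S then Suc (card (S \<inter> {..<i})) else card (S \<inter> {..<i}))"
        using S by simp
      then show ?thesis
        using True mem T_XS[OF i S(1)] linear_onD(3)[OF lin XS_laurent[OF S(1)]]
        by (simp add: lconst_mult mult.left_commute)
    qed (simp add: mem T0)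
  qed
  also have "\<dots> = weighted_elem m r (Suc i)"
    unfolding weighted_elem_def by (rule sum_subsets_reindex[OF bij_transpose[OF i]])
  finally show ?thesis .
qed

lemma Ts_weighted_elem:
  assumes "1 \<le> i" "i \<le> m"
  shows "foldr (act_T m) (rev [1..<i]) (weighted_elem m r 1) = weighted_elem m r i"
  using assms by (induction i rule: dec_induct) (simp_all add: T_weighted_elem)

lemma act_hY_elem_sym:
  assumes i: "i \<in> {1..m}"
  shows "act m (hY m i) (elem_sym m r) =
    lconst (inverse qq) * (elem_sym m r * X i) + lconst (1 - inverse qq) * weighted_elem m r i"
proof -
  let ?U = "foldr (act_T m) (rev [1..<i])"
  have U: "linear_on (laurent_polys m) ?U"
    using i by (auto intro!: linear_on_foldr linear_act_T)
  have L: "elem_sym m r * X 1 \<in> laurent_polys m"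
    using m by (simp add: elem_sym_laurent)
  have "act m (hY m i) (elem_sym m r) = ?U (act_Pi m (elem_sym m r))"
    using Tinvs_sym[of i m "elem_sym m r"] i
    by (simp add: act_hY_eq elem_sym_laurent hs_elem_sym del: One_nat_def)
  also have "\<dots> = lconst (inverse qq) * ?U (elem_sym m r * X 1) +
      lconst (1 - inverse qq) * ?U (weighted_elem m r 1)"
    unfolding act_Pi_elem_sym using L weighted_elem_laurent
    by (simp add: linear_onD[OF U] del: One_nat_def)
  also have "?U (elem_sym m r * X 1) = elem_sym m r * X i"
    using i by (intro Ts_sym_mult) (auto simp: elem_sym_laurent hs_elem_sym)
  also have "?U (weighted_elem m r 1) = weighted_elem m r i"
    using i by (intro Ts_weighted_elem) auto
  finally show ?thesis .
qed

lemma qstar_elem_sym: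
  "qstar m (elem_sym m 1) (elem_sym m r) =
    lconst ((1 - inverse qq) * [Suc r]\<^sub>t) * elem_sym m (Suc r) +
    lconst (inverse qq) * (elem_sym m 1 * elem_sym m r)"
proof -
  \<comment> \<open>E represents the sum of the Y_i; it acts on 1 as e_1 because Y_i acts on 1 as
    X_i, the case of the empty monomial.\<close>
  obtain E where E: "E \<in> Y_polys m"
    "\<forall>F\<in>laurent_polys m. act m E F = (\<Sum>i\<in>{1..m}. act m (hY m i) F)"
    using Y_polys_sum[of "{1..m}" "hY m"] hY_in_Y_polys by auto
  have "act m (hY m i) 1 = X i" if "i \<in> {1..m}" for i
    using act_hY_XS[OF that, of "{}"] by simp
  then have "qmap m E = elem_sym m 1"
    unfolding elem_sym_1 using E(2) by (simp add: qmap_def del: One_nat_def)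
  moreover obtain K where "K \<in> Y_polys m" "qmap m K = elem_sym m r"
    using elem_sym_in_image by blast
  ultimately have "qstar m (elem_sym m 1) (elem_sym m r) = act m E (elem_sym m r)"
    using qstar_qmap[OF m E(1)] by metis
  also have "\<dots> = (\<Sum>i\<in>{1..m}. act m (hY m i) (elem_sym m r))"
    using E(2) elem_sym_laurent by blast
  also have "\<dots> = lconst (inverse qq) * (elem_sym m r * (\<Sum>i\<in>{1..m}. X i)) +
      lconst (1 - inverse qq) * (\<Sum>i\<in>{1..m}. weighted_elem m r i)"
    by (simp add: act_hY_elem_sym sum.distrib sum_distrib_left del: One_nat_def)
  finally show ?thesis
    by (simp only: sum_weighted_elem elem_sym_1 lconst_mult mult_ac add.commute)
qed

end

theorem theorem3p12:
  fixes r :: nat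
  shows "sf_e 1 \<star> sf_e r =
    ((1 - inverse qq) * [r + 1]\<^sub>t) *\<^sub>s sf_e (r + 1) + inverse qq *\<^sub>s (sf_e 1 * sf_e r)"
proof -
  let ?rhs = "((1 - inverse qq) * [r + 1]\<^sub>t) *\<^sub>s sf_e (r + 1) + inverse qq *\<^sub>s (sf_e 1 * sf_e r)"
  have "(if m = 0 then 0 else qstar m (comp_at (sf_e 1) m) (comp_at (sf_e r) m)) = comp_at ?rhs m" for m
    using qstar_elem_sym[of m r]
    by (simp add: plus_symfun.rep_eq times_symfun.rep_eq sf_scale.rep_eq sf_e.rep_eq)
  \<comment> \<open>The family of products agrees in every component, including the value 0 at m =
    0, with that of an existing symmetric function. Hence it lies in \<open>sf_set\<close>, and
    \<open>Abs_symfun\<close> recovers that function.\<close>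
  then have "sf_e 1 \<star> sf_e r = Abs_symfun (comp_at ?rhs)"
    by (simp only: sf_star_def)
  then show ?thesis by (simp only: comp_at_inverse)
qed

end
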